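(* Let $N\geq 6$ be even. Every point of the orbit $\Sigma_{2,N}$ is not identifiable, while for every $3\le l\le \frac N2$ every point of the orbit $\Sigma_{l,N}$ is identifiable. Moreover, for every $3\le l\le \frac N2$ every point of the orbit $\Theta_{l,N}$ is tangential-identifiable.
   Context: Setting: $N$ even; $V=\mathbb C^{2N}$ with basis $e_1,\dots,e_N,f_1,\dots,f_N$ and quadratic form $q=\sum_{k=1}^N x_kx_{N+k}$, with associated bilinear form $q(e_i,f_j)=\delta_{ij}$, $q(e_i,e_j)=q(f_i,f_j)=0$; $E=\langle e_1,\dots,e_N\rangle$, $E^\vee=\langle f_1,\dots,f_N\rangle$. $V$ acts on $\bigwedge^\bullet E$ by Clifford multiplication $(e+f)\cdot x=e\wedge x+f\neg x$ ($e\in E$, $f\in E^\vee$, $\neg$ = contraction via $q$), giving an action of the Clifford algebra $\mathrm{Cl}_q(V)$. $\mathrm{Spin}_{2N}=\{x\in \mathrm{Cl}_q^+(V)^\times : xVx^{-1}=V,\ xx^*=1\}$ ($^*$ is the reversal $v_1\cdots v_k\mapsto v_k\cdots v_1$) acts on $\bigwedge^{ev}E=\bigoplus_k\bigwedge^{2k}E$. Write $\mathbf e_{[k]}=e_1\wedge\dots\wedge e_k$, $\mathbf e_{[0]}=\mathbb 1\in\bigwedge^0E$. The Spinor variety is $\mathbb S_N^+=\mathrm{Spin}_{2N}\cdot[\mathbf e_{[N]}]\subset\mathbb P(\bigwedge^{ev}E)$; its points are the pure spinors. Hamming distance: for $p,p'\in\mathbb S_N^+$, $d(p,p')$ is the minimal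 number of lines contained in $\mathbb S_N^+$ in a chain connecting $p$ to $p'$. $\sigma_2^\circ(\mathbb S_N^+)=\{[a+b]: [a],[b]\in\mathbb S_N^+\}$; $\sigma_2(\mathbb S_N^+)$ is its Zariski closure; $\tau(\mathbb S_N^+)=\bigcup_{p\in\mathbb S_N^+}T_p\mathbb S_N^+$ is the tangential variety ($T_p$ = embedded projective tangent space). For $2\le l\le N/2$, $\Sigma_{l,N}=\{[a+b]\in\sigma_2^\circ(\mathbb S_N^+): d([a],[b])=l\}$; it is the $\mathrm{Spin}_{2N}$-orbit of $[\mathbf e_{[N]}+\mathbf e_{[N-2l]}]$. For $1\le l\le N/2$, $\Theta_{l,N}$ is the $\mathrm{Spin}_{2N}$-orbit of $\left[\sum_{i=1}^l e_{2i-1}\wedge e_{2i}\right]$ (equivalently, the set of points lying in some tangent space $T_{[a]}\mathbb S_N^+$ and corresponding there to a skew-symmetric $N\times N$ matrix of rank $2l$). A point $[p]\in\sigma_2^\circ(\mathbb S_N^+)$ is identifiable if there is exactly one unordered pair $\{[a],[b]\}$ of points of $\mathbb S_N^+$ with $[p]\in\langle[a],[b]\rangle$. A point $[q]\in\tau(\mathbb S_N^+)$ is tangential-identifiable if there is a unique $[p]\in\mathbb S_N^+$ with $[q]\in T_{[p]}\mathbb S_N^+$. *)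

theory Defs
  imports
    Complex_Main
    "HOL-Library.Function_Algebras"
    "HOL-Library.Extended_Nat"
    "HOL-Algebra.QuotRing"
begin

section \<open>Complex vector spaces of functions and their projectivizations\<close>

definition scl :: "complex \<Rightarrow> ('i \<Rightarrow> complex) \<Rightarrow> ('i \<Rightarrow> complex)" where
  "scl c x = (\<lambda>i. c * x i)"

global_interpretation cfun: vector_space scl
  by unfold_locales (auto simp: scl_def fun_eq_iff algebra_simps)

definition unit_fun :: "'i \<Rightarrow> 'i \<Rightarrow> complex" where
  "unit_fun i = (\<lambda>j. if j = i then 1 else 0)"

text \<open>A point of a projective space is a line through the origin; \<open>pt v\<close> is the point
  \<open>[v]\<close> for \<open>v \<noteq> 0\<close>, and \<open>projectivize W\<close> is the set of points of the projectivization of \<open>W\<close>.\<close>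

definition pt :: "('i \<Rightarrow> complex) \<Rightarrow> ('i \<Rightarrow> complex) set" where
  "pt v = cfun.span {v}"

definition projectivize :: "('i \<Rightarrow> complex) set \<Rightarrow> ('i \<Rightarrow> complex) set set" where
  "projectivize W = {pt v | v. v \<in> W \<and> v \<noteq> 0}"

text \<open>The projective span of two points.\<close>

definition proj_join :: "('i \<Rightarrow> complex) set \<Rightarrow> ('i \<Rightarrow> complex) set \<Rightarrow> ('i \<Rightarrow> complex) set set" where
  "proj_join p p' = projectivize (cfun.span (p \<union> p'))"

definition proj_line :: "('i \<Rightarrow> complex) set set \<Rightarrow> bool" where
  "proj_line L \<longleftrightarrow> (\<exists>W. cfun.subspace W \<and> cfun.dim W = 2 \<and> L = projectivize W)"

text \<open>The embedded projective tangent space at \<open>p\<close> of a set \<open>X\<close> of points of the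
  projectivization of a subspace \<open>W\<close>: the points \<open>[v]\<close> such that the differential at a
  representative of \<open>p\<close> of every polynomial vanishing on the affine cone \<open>\<Union>X\<close> is zero
  on \<open>v\<close>.\<close>

inductive polynomial_fun :: "(('i \<Rightarrow> complex) \<Rightarrow> complex) \<Rightarrow> bool" where
  const: "polynomial_fun (\<lambda>_. c)"
| coord: "polynomial_fun (\<lambda>x. x i)"
| add: "polynomial_fun F \<Longrightarrow> polynomial_fun G \<Longrightarrow> polynomial_fun (\<lambda>x. F x + G x)"
| mult: "polynomial_fun F \<Longrightarrow> polynomial_fun G \<Longrightarrow> polynomial_fun (\<lambda>x. F x * G x)"

definition proj_tangent_space ::
    "('i \<Rightarrow> complex) set \<Rightarrow> ('i \<Rightarrow> complex) set set \<Rightarrow> ('i \<Rightarrow> complex) set \<Rightarrow> ('i \<Rightarrow> complex) set set"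
  where
  "proj_tangent_space W X p = projectivize {v \<in> W.
     \<forall>F. polynomial_fun F \<and> (\<forall>x \<in> \<Union>X. F x = 0) \<longrightarrow>
       (\<forall>a \<in> p - {0}. ((\<lambda>t. F (a + scl t v)) has_field_derivative 0) (at 0))}"


section \<open>The quadratic space and its Clifford algebra\<close>

text \<open>A vector \<open>v\<close> of \<open>V\<close> has \<open>v k\<close> as coefficient of \<open>e\<^sub>k\<close> and \<open>v (N + k)\<close> as coefficient
  of \<open>f\<^sub>k\<close>, for \<open>1 \<le> k \<le> N\<close>.\<close>

definition Vspace :: "nat \<Rightarrow> (nat \<Rightarrow> complex) set" where
  "Vspace N = {v. \<forall>i. v i \<noteq> 0 \<longrightarrow> i \<in> {1..2*N}}"

definition quad_form :: "nat \<Rightarrow> (nat \<Rightarrow> complex) \<Rightarrow> complex" where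
  "quad_form N v = (\<Sum>k=1..N. v k * v (N + k))"

text \<open>The tensor algebra of \<open>V\<close>: finite linear combinations of words \<open>[i\<^sub>1, \<dots>, i\<^sub>k]\<close>, which
  stand for the tensor products of the basis vectors with these indices.\<close>

definition tensor_algebra :: "nat \<Rightarrow> (nat list \<Rightarrow> complex) ring" where
  "tensor_algebra N = \<lparr>
     carrier = {a. finite {w. a w \<noteq> 0} \<and> (\<forall>w. a w \<noteq> 0 \<longrightarrow> set w \<subseteq> {1..2*N})},
     mult = (\<lambda>a b w. \<Sum>k\<le>length w. a (take k w) * b (drop k w)),
     one = unit_fun [],
     zero = 0,
     add = (+)\<rparr>"

lemma conv_assoc:
  fixes a b c :: "nat list \<Rightarrow> complex"
  shows "(\<Sum>k\<le>length w. (\<Sum>i\<le>length (take k w). a (take i (take k w)) * b (drop i (take k w))) * c (drop k w))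
   = (\<Sum>i\<le>length w. a (take i w) * (\<Sum>j\<le>length (drop i w). b (take j (drop i w)) * c (drop j (drop i w))))"
  (is "?l = ?r")
proof -
  have "?l = (\<Sum>(k,i)\<in>(SIGMA k:{..length w}. {..k}). a (take i w) * b (take (k - i) (drop i w)) * c (drop k w))"
    by (subst sum.Sigma[symmetric]) (auto simp: sum_distrib_right min_def drop_take intro!: sum.cong)
  also have "\<dots> = (\<Sum>(i,j)\<in>(SIGMA i:{..length w}. {..length w - i}). a (take i w) * b (take j (drop i w)) * c (drop j (drop i w)))"
    by (rule sum.reindex_bij_witness[where j = "\<lambda>(k,i). (i, k-i)" and i = "\<lambda>(i,j). (i+j, i)"]) auto
  also have "\<dots> = ?r"
    by (subst sum.Sigma[symmetric]) (auto simp: sum_distrib_left mult.assoc intro!: sum.cong)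
  finally show ?thesis .
qed

lemma ring_tensor_algebra: "ring (tensor_algebra N)"
proof -
  let ?T = "tensor_algebra N"
  have closed: "a \<otimes>\<^bsub>?T\<^esub> b \<in> carrier ?T" if a: "a \<in> carrier ?T" and b: "b \<in> carrier ?T" for a b
  proof -
    have "{w. (a \<otimes>\<^bsub>?T\<^esub> b) w \<noteq> 0} \<subseteq> (\<lambda>(u,v). u @ v) ` ({u. a u \<noteq> 0} \<times> {v. b v \<noteq> 0})"
    proof
      fix w assume "w \<in> {w. (a \<otimes>\<^bsub>?T\<^esub> b) w \<noteq> 0}"
      then have "(\<Sum>k\<le>length w. a (take k w) * b (drop k w)) \<noteq> 0"
        by (simp add: tensor_algebra_def)
      then obtain k where "a (take k w) * b (drop k w) \<noteq> 0"
        by (meson sum.neutral)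
      then show "w \<in> (\<lambda>(u,v). u @ v) ` ({u. a u \<noteq> 0} \<times> {v. b v \<noteq> 0})"
        by (intro image_eqI[of _ _ "(take k w, drop k w)"]) auto
    qed
    moreover have "finite ((\<lambda>(u,v). u @ v) ` ({u. a u \<noteq> 0} \<times> {v. b v \<noteq> 0}))"
      using a b by (simp add: tensor_algebra_def)
    moreover have "set (u @ v) \<subseteq> {1..2*N}" if "a u \<noteq> 0" "b v \<noteq> 0" for u v
      using a b that unfolding tensor_algebra_def by fastforce
    ultimately show ?thesis
      by (fastforce simp: tensor_algebra_def dest: finite_subset)
  qed
  have one: "unit_fun [] \<otimes>\<^bsub>?T\<^esub> a = a" "a \<otimes>\<^bsub>?T\<^esub> unit_fun [] = a" for a
  proof -
    have "(\<Sum>k\<le>length w. unit_fun [] (take k w) * a (drop k w)) = (\<Sum>k\<le>length w. if k = 0 then a w else 0)" for w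
      by (rule sum.cong) (auto simp: unit_fun_def)
    then show "unit_fun [] \<otimes>\<^bsub>?T\<^esub> a = a"
      by (auto simp: tensor_algebra_def fun_eq_iff)
    have "(\<Sum>k\<le>length w. a (take k w) * unit_fun [] (drop k w)) = (\<Sum>k\<le>length w. if k = length w then a w else 0)" for w
      by (rule sum.cong) (auto simp: unit_fun_def)
    then show "a \<otimes>\<^bsub>?T\<^esub> unit_fun [] = a"
      by (auto simp: tensor_algebra_def fun_eq_iff)
  qed
  show ?thesis
  proof (rule ringI)
    show "abelian_group ?T"
    proof (rule abelian_groupI)
      fix x y assume xy: "x \<in> carrier ?T" "y \<in> carrier ?T"
      have "{w. x w + y w \<noteq> 0} \<subseteq> {w. x w \<noteq> 0} \<union> {w. y w \<noteq> 0}" by auto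
      then show "x \<oplus>\<^bsub>?T\<^esub> y \<in> carrier ?T"
        using xy by (fastforce simp: tensor_algebra_def dest: finite_subset)
    next
      fix x assume "x \<in> carrier ?T"
      then show "\<exists>y\<in>carrier ?T. y \<oplus>\<^bsub>?T\<^esub> x = \<zero>\<^bsub>?T\<^esub>"
        by (intro bexI[of _ "- x"]) (auto simp: tensor_algebra_def)
    qed (auto simp: tensor_algebra_def algebra_simps)
    show "Group.monoid ?T"
    proof (rule monoidI)
      show "\<one>\<^bsub>?T\<^esub> \<in> carrier ?T" by (auto simp: tensor_algebra_def unit_fun_def)
      show "\<one>\<^bsub>?T\<^esub> \<otimes>\<^bsub>?T\<^esub> x = x" "x \<otimes>\<^bsub>?T\<^esub> \<one>\<^bsub>?T\<^esub> = x" for x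
        using one[of x] by (simp_all add: tensor_algebra_def)
      show "x \<otimes>\<^bsub>?T\<^esub> y \<otimes>\<^bsub>?T\<^esub> z = x \<otimes>\<^bsub>?T\<^esub> (y \<otimes>\<^bsub>?T\<^esub> z)" for x y z
        unfolding tensor_algebra_def by (simp only: monoid.simps conv_assoc)
    qed (rule closed)
  qed (auto simp: tensor_algebra_def fun_eq_iff algebra_simps sum.distrib)
qed

definition tensor_vec :: "(nat \<Rightarrow> complex) \<Rightarrow> nat list \<Rightarrow> complex" where
  "tensor_vec v = (\<lambda>w. case w of [i] \<Rightarrow> v i | _ \<Rightarrow> 0)"

definition tensor_rev :: "(nat list \<Rightarrow> complex) \<Rightarrow> nat list \<Rightarrow> complex" where
  "tensor_rev a = (\<lambda>w. a (rev w))"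

definition clifford_ideal :: "nat \<Rightarrow> (nat list \<Rightarrow> complex) set" where
  "clifford_ideal N = genideal (tensor_algebra N)
     {(tensor_vec v \<otimes>\<^bsub>tensor_algebra N\<^esub> tensor_vec v) - scl (quad_form N v) (unit_fun []) | v.
        v \<in> Vspace N}"

definition clifford_algebra :: "nat \<Rightarrow> (nat list \<Rightarrow> complex) set ring" where
  "clifford_algebra N = tensor_algebra N Quot clifford_ideal N"

definition clifford_class :: "nat \<Rightarrow> (nat list \<Rightarrow> complex) \<Rightarrow> (nat list \<Rightarrow> complex) set" where
  "clifford_class N a = clifford_ideal N +>\<^bsub>tensor_algebra N\<^esub> a"

definition clifford_even :: "nat \<Rightarrow> (nat list \<Rightarrow> complex) set set" where
  "clifford_even N = clifford_class N `
     {a \<in> carrier (tensor_algebra N). \<forall>w. a w \<noteq> 0 \<longrightarrow> even (length w)}"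

definition clifford_vectors :: "nat \<Rightarrow> (nat list \<Rightarrow> complex) set set" where
  "clifford_vectors N = (clifford_class N \<circ> tensor_vec) ` Vspace N"

text \<open>Reversal preserves \<open>clifford_ideal N\<close>, so it maps classes to classes.\<close>

definition clifford_rev :: "(nat list \<Rightarrow> complex) set \<Rightarrow> (nat list \<Rightarrow> complex) set" where
  "clifford_rev g = tensor_rev ` g"

definition Spin :: "nat \<Rightarrow> (nat list \<Rightarrow> complex) set set" where
  "Spin N = {g \<in> Units (clifford_algebra N \<lparr>carrier := clifford_even N\<rparr>).
     (\<lambda>v. g \<otimes>\<^bsub>clifford_algebra N\<^esub> v \<otimes>\<^bsub>clifford_algebra N\<^esub> inv\<^bsub>clifford_algebra N\<^esub> g)
        ` clifford_vectors N = clifford_vectors N \<and>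
     g \<otimes>\<^bsub>clifford_algebra N\<^esub> clifford_rev g = \<one>\<^bsub>clifford_algebra N\<^esub>}"


section \<open>The spin representation\<close>

text \<open>An element \<open>x\<close> of the exterior algebra of \<open>E\<close> is given by its coordinates in the basis
  of the \<open>ext_basis S\<close>, for \<open>S \<subseteq> {1..N}\<close>, where \<open>ext_basis S\<close> is the wedge product of the
  \<open>e\<^sub>i\<close> with \<open>i \<in> S\<close> in increasing order of \<open>i\<close>.\<close>

abbreviation ext_basis :: "nat set \<Rightarrow> nat set \<Rightarrow> complex" where
  "ext_basis S \<equiv> unit_fun S"

definition ext_even :: "nat \<Rightarrow> (nat set \<Rightarrow> complex) set" where
  "ext_even N = {x. \<forall>S. x S \<noteq> 0 \<longrightarrow> S \<subseteq> {1..N} \<and> even (card S)}"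

text \<open>The next two definitions extend bilinearly, for \<open>i \<notin> S\<close> resp.\ \<open>i \<in> S\<close>,
  \<open>e\<^sub>i \<and> ext_basis S = (-1)\<^sup>m ext_basis (insert i S)\<close> and
  \<open>f\<^sub>i \<not> ext_basis S = (-1)\<^sup>m ext_basis (S - {i})\<close>, where \<open>m\<close> is the number of \<open>j \<in> S\<close>
  with \<open>j < i\<close>; both products are zero in the other case.\<close>

definition wedge :: "nat \<Rightarrow> (nat \<Rightarrow> complex) \<Rightarrow> (nat set \<Rightarrow> complex) \<Rightarrow> nat set \<Rightarrow> complex" where
  "wedge N e x = (\<lambda>S. \<Sum>i \<in> {1..N} \<inter> S. (-1) ^ card {j \<in> S. j < i} * e i * x (S - {i}))"

definition contract :: "nat \<Rightarrow> (nat \<Rightarrow> complex) \<Rightarrow> (nat set \<Rightarrow> complex) \<Rightarrow> nat set \<Rightarrow> complex" where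
  "contract N f x = (\<lambda>S. \<Sum>i \<in> {1..N} - S. (-1) ^ card {j \<in> S. j < i} * f i * x (insert i S))"

definition clifford_mult ::
    "nat \<Rightarrow> (nat \<Rightarrow> complex) \<Rightarrow> (nat set \<Rightarrow> complex) \<Rightarrow> nat set \<Rightarrow> complex" where
  "clifford_mult N v x = wedge N v x + contract N (\<lambda>k. v (N + k)) x"

definition tensor_act ::
    "nat \<Rightarrow> (nat list \<Rightarrow> complex) \<Rightarrow> (nat set \<Rightarrow> complex) \<Rightarrow> nat set \<Rightarrow> complex" where
  "tensor_act N a x = (\<Sum>w | a w \<noteq> 0. scl (a w) (foldr (\<lambda>i. clifford_mult N (unit_fun i)) w x))"

text \<open>On the exterior algebra all representatives of an element of the Clifford algebra act in
  the same way.\<close>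

definition clifford_act ::
    "nat \<Rightarrow> (nat list \<Rightarrow> complex) set \<Rightarrow> (nat set \<Rightarrow> complex) \<Rightarrow> nat set \<Rightarrow> complex" where
  "clifford_act N g x = the_elem ((\<lambda>a. tensor_act N a x) ` g)"

definition spin_orbit :: "nat \<Rightarrow> (nat set \<Rightarrow> complex) \<Rightarrow> (nat set \<Rightarrow> complex) set set" where
  "spin_orbit N x = {pt (clifford_act N g x) | g. g \<in> Spin N}"


section \<open>The spinor variety\<close>

definition spinor_variety :: "nat \<Rightarrow> (nat set \<Rightarrow> complex) set set" where
  "spinor_variety N = spin_orbit N (ext_basis {1..N})"

text \<open>Consecutive points of the chain lie on a common line; the distance is \<open>\<infinity>\<close> if there is
  no chain.\<close>

definition line_chain ::
    "nat \<Rightarrow> nat \<Rightarrow> (nat set \<Rightarrow> complex) set \<Rightarrow> (nat set \<Rightarrow> complex) set \<Rightarrow> bool" where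
  "line_chain N n p p' \<longleftrightarrow> (\<exists>c. c 0 = p \<and> c n = p' \<and>
     (\<forall>i<n. \<exists>L. proj_line L \<and> L \<subseteq> spinor_variety N \<and> c i \<in> L \<and> c (Suc i) \<in> L))"

definition hamming_dist ::
    "nat \<Rightarrow> (nat set \<Rightarrow> complex) set \<Rightarrow> (nat set \<Rightarrow> complex) set \<Rightarrow> enat" where
  "hamming_dist N p p' = Inf {enat n | n. line_chain N n p p'}"

definition Sigma_orbit :: "nat \<Rightarrow> nat \<Rightarrow> (nat set \<Rightarrow> complex) set set" where
  "Sigma_orbit l N = {pt (a + b) | a b.
     a \<noteq> 0 \<and> b \<noteq> 0 \<and> a + b \<noteq> 0 \<and> pt a \<in> spinor_variety N \<and> pt b \<in> spinor_variety N \<and>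
     hamming_dist N (pt a) (pt b) = enat l}"

definition Theta_orbit :: "nat \<Rightarrow> nat \<Rightarrow> (nat set \<Rightarrow> complex) set set" where
  "Theta_orbit l N = spin_orbit N (\<Sum>i=1..l. ext_basis {2*i - 1, 2*i})"

definition identifiable :: "nat \<Rightarrow> (nat set \<Rightarrow> complex) set \<Rightarrow> bool" where
  "identifiable N p \<longleftrightarrow>
     (\<exists>!P. \<exists>a \<in> spinor_variety N. \<exists>b \<in> spinor_variety N. P = {a, b} \<and> p \<in> proj_join a b)"

definition tangential_identifiable :: "nat \<Rightarrow> (nat set \<Rightarrow> complex) set \<Rightarrow> bool" where
  "tangential_identifiable N q \<longleftrightarrow>
     (\<exists>!p. p \<in> spinor_variety N \<and> q \<in> proj_tangent_space (ext_even N) (spinor_variety N) p)"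

end

theory Submission
  imports Defs
begin

text \<open>
  A spinor \<open>x\<close> is pure when the space \<open>Ann x\<close> of vectors annihilating it is its own orthogonal;
  it is then determined up to a scalar by \<open>Ann x\<close>. If \<open>a\<close> and \<open>b\<close> are pure and \<open>a + b\<close> has
  another decomposition into at most two pure spinors, multiplying by suitable vectors shows
  that \<open>Ann a\<close> and \<open>Ann b\<close> meet in codimension at most four. Then \<open>a\<close> is a multiple of
  \<open>e\<^sub>4 e\<^sub>3 e\<^sub>2 e\<^sub>1 b\<close> or of \<open>e\<^sub>2 e\<^sub>1 b\<close>, with orthogonal isotropic vectors \<open>e\<^sub>i\<close>, and the lines joining
  \<open>b\<close>, \<open>e\<^sub>2 e\<^sub>1 b\<close> and \<open>e\<^sub>4 e\<^sub>3 e\<^sub>2 e\<^sub>1 b\<close> lie in the variety, so that the distance is at most two.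
  Conversely, a chain \<open>[a], [c], [b]\<close> gives the further decomposition
  \<open>a + b = (a + c) + (b - c)\<close>.

  For the tangential part, polarizing Cartan's quadrics shows that if \<open>[x]\<close> lies in the tangent
  spaces at \<open>[a]\<close> and at another point \<open>[b]\<close>, then some vector not annihilating \<open>a\<close> maps \<open>x\<close> to
  a vector multiple of \<open>b\<close>, which is zero or pure; this is impossible when the bivector of \<open>x\<close>
  at \<open>a\<close> has rank at least six.
\<close>

section \<open>Clifford multiplication\<close>

text \<open>The obstacle is to compare annihilators without computing dimensions. Purity is
  therefore phrased by orthogonality and uniqueness, both of which are verified directly only for
  the top form and then carried along by invertible operators. A nonzero product of a pure spinor
  with a vector is again pure because the vector may be changed by an element of the annihilator
  until its square is one; the same device keeps products of two vectors inside the spin orbit. The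
  threshold 3 for \<open>l\<close> comes from parity: four conditions yield at most four factors,
  their number is even since both spinors are even, and each pair of factors is one line. The
  tangent space is defined by all polynomials vanishing on the cone, and their ideal is never
  determined: membership is shown by lines of the variety through the point, non-membership by
  Cartan's quadrics alone.\<close>

definition sgn_at :: "nat \<Rightarrow> nat set \<Rightarrow> complex" where
  "sgn_at i S = (-1) ^ card {j \<in> S. j < i}"

text \<open>Wedge with \<open>e_k\<close> for \<open>k \<le> N\<close> and contraction with
  \<open>f_(k-N)\<close> beyond: a single index running over the basis of V, so that the Clifford
  relations become one table of signs.\<close>

definition gen_op :: "nat \<Rightarrow> nat \<Rightarrow> (nat set \<Rightarrow> complex) \<Rightarrow> nat set \<Rightarrow> complex" where
  "gen_op N k x = (\<lambda>S. if k \<le> N then (if k \<in> S then sgn_at k S * x (S - {k}) else 0)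
     else (if k - N \<in> S then 0 else sgn_at (k - N) S * x (insert (k - N) S)))"

text \<open>The polar form q(u+v) - q(u) - q(v), without a factor 1/2: \<open>e_k\<close> and
  \<open>f_k\<close> pair to 1, and \<open>bil N v v\<close> is twice the quadratic form.\<close>

definition bil :: "nat \<Rightarrow> (nat \<Rightarrow> complex) \<Rightarrow> (nat \<Rightarrow> complex) \<Rightarrow> complex" where
  "bil N u v = (\<Sum>k=1..N. u k * v (N + k) + u (N + k) * v k)"

lemma sum_two_halves:
  "(\<Sum>k=1..2*N. g k) = (\<Sum>k=1..N. g k) + (\<Sum>k=1..N. g (N + k))" for g :: "nat \<Rightarrow> 'a::comm_monoid_add"
proof -
  have "{1..2*N} = {1..N} \<union> {N+1..N+N}" by auto
  then have "(\<Sum>k=1..2*N. g k) = (\<Sum>k=1..N. g k) + (\<Sum>k=N+1..N+N. g k)"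
    by (simp add: sum.union_disjoint)
  also have "(\<Sum>k=N+1..N+N. g k) = (\<Sum>k=1..N. g (N + k))"
    by (rule sum.reindex_bij_witness[where i="\<lambda>k. N + k" and j="\<lambda>k. k - N"]) auto
  finally show ?thesis .
qed

lemma clifford_mult_gen_op:
  "clifford_mult N v x S = (\<Sum>k=1..2*N. v k * gen_op N k x S)"
proof -
  have 1: "wedge N v x S = (\<Sum>k=1..N. v k * gen_op N k x S)"
    unfolding wedge_def
    by (rule sum.mono_neutral_cong_left) (auto simp: gen_op_def sgn_at_def)
  have 2: "contract N (\<lambda>k. v (N + k)) x S = (\<Sum>k=1..N. v (N + k) * gen_op N (N + k) x S)"
    unfolding contract_def
    by (rule sum.mono_neutral_cong_left) (auto simp: gen_op_def sgn_at_def)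
  show ?thesis
    unfolding clifford_mult_def plus_fun_def 1 2 by (rule sum_two_halves[symmetric])
qed

lemma sgn_at_diff: "sgn_at i (S - {j}) = (if j \<in> S \<and> j < i then - sgn_at i S else sgn_at i S)"
proof -
  have *: "{k \<in> S - {j}. k < i} = {k \<in> S. k < i} - {j}" by auto
  have "card {k \<in> S. k < i} = Suc (card ({k \<in> S. k < i} - {j}))" if "j \<in> S" "j < i"
    using that by (intro card.remove) auto
  then show ?thesis unfolding sgn_at_def * by (cases "j \<in> S \<and> j < i") (auto simp del: card_Diff_insert)
qed

lemma sgn_at_insert: "sgn_at i (insert j S) = (if j \<notin> S \<and> j < i then - sgn_at i S else sgn_at i S)"
proof -
  have *: "{k \<in> insert j S. k < i} = (if j < i then insert j {k \<in> S. k < i} else {k \<in> S. k < i})" by auto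
  show ?thesis unfolding sgn_at_def * by (auto simp: insert_absorb)
qed

lemma sgn_at_sq: "sgn_at i S * sgn_at i S = 1"
  unfolding sgn_at_def by (simp add: power_mult_distrib[symmetric])

lemma sgn_at_nonzero: "sgn_at i S \<noteq> 0"
  unfolding sgn_at_def by simp

text \<open>For distinct underlying indices the sign at the larger one depends on whether the
  smaller one has already been moved, so the two orders cancel. For a dual pair exactly one order
  survives and its sign is squared; for \<open>k = m\<close> both terms vanish.\<close>

lemma gen_op_anticommute:
  assumes "k \<in> {1..2*N}" "m \<in> {1..2*N}"
  shows "gen_op N k (gen_op N m x) S + gen_op N m (gen_op N k x) S
    = (if k = N + m \<or> m = N + k then x S else 0)"
proof -
  have c: "insert a S - {b} = insert a (S - {b})" if "a \<noteq> b" for a b using that by auto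
  have i: "insert a (insert b S) = insert b (insert a S)" for a b by auto
  have d: "S - {a} - {b} = S - {b} - {a}" for a b by auto
  have sq: "sgn_at i S * (sgn_at i S * z) = z" for i z
    using sgn_at_sq[of i S] by (metis mult.assoc mult_1)
  consider "k \<le> N" "m \<le> N" | "k \<le> N" "m > N" | "k > N" "m \<le> N" | "k > N" "m > N" by linarith
  then show ?thesis
  proof cases
    case 1
    then show ?thesis using assms
      by (cases "k < m"; cases "k = m") (auto simp: gen_op_def sgn_at_diff sgn_at_insert d[of k m])
  next
    case 2
    define m' where "m' = m - N"
    have m: "m = N + m'" "m' \<ge> 1" "m' \<le> N" using 2 assms by (auto simp: m'_def)
    show ?thesis using 2 assms unfolding m(1)
      by (cases "k < m'"; cases "k = m'")
        (auto simp: gen_op_def sgn_at_diff sgn_at_insert c insert_absorb sq)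
  next
    case 3
    define m' where "m' = k - N"
    have m: "k = N + m'" "m' \<ge> 1" "m' \<le> N" using 3 assms by (auto simp: m'_def)
    show ?thesis using 3 assms unfolding m(1)
      by (cases "m < m'"; cases "m = m'")
        (auto simp: gen_op_def sgn_at_diff sgn_at_insert c insert_absorb sq)
  next
    case 4
    define m' where "m' = m - N"
    define k' where "k' = k - N"
    have m: "m = N + m'" "m' \<ge> 1" "k = N + k'" "k' \<ge> 1" using 4 assms by (auto simp: m'_def k'_def)
    show ?thesis using 4 assms unfolding m(1,3)
      by (cases "k' < m'"; cases "k' = m'") (auto simp: gen_op_def sgn_at_diff sgn_at_insert i[of k' m'])
  qed
qed

lemma gen_op_sum: "gen_op N k (\<lambda>S. \<Sum>m\<in>A. c m * y m S) S = (\<Sum>m\<in>A. c m * gen_op N k (y m) S)"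
  by (auto simp: gen_op_def sum_distrib_left intro!: sum.cong)

lemma bil_gen: "bil N u v = (\<Sum>k=1..2*N. \<Sum>m=1..2*N. u k * v m * (if k = N + m \<or> m = N + k then 1 else 0))"
proof -
  have 1: "(\<Sum>m=1..2*N. u k * v m * (if k = N + m \<or> m = N + k then 1 else 0)) = u k * v (N + k)"
    if "k \<in> {1..N}" for k
  proof -
    have "(\<Sum>m=1..2*N. u k * v m * (if k = N + m \<or> m = N + k then 1 else 0))
        = (\<Sum>m=1..2*N. if m = N + k then u k * v m else 0)"
      using that by (intro sum.cong) auto
    then show ?thesis using that by (simp add: sum.delta)
  qed
  have 2: "(\<Sum>m=1..2*N. u (N+k) * v m * (if N+k = N + m \<or> m = N + (N+k) then 1 else 0)) = u (N+k) * v k"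
    if "k \<in> {1..N}" for k
  proof -
    have "(\<Sum>m=1..2*N. u (N+k) * v m * (if N+k = N + m \<or> m = N + (N+k) then 1 else 0))
        = (\<Sum>m=1..2*N. if m = k then u (N+k) * v m else 0)"
      using that by (intro sum.cong) auto
    then show ?thesis using that by (simp add: sum.delta)
  qed
  have "bil N u v = (\<Sum>k=1..N. \<Sum>m=1..2*N. u k * v m * (if k = N + m \<or> m = N + k then 1 else 0))
      + (\<Sum>k=1..N. \<Sum>m=1..2*N. u (N+k) * v m * (if N+k = N + m \<or> m = N + (N+k) then 1 else 0))"
    unfolding bil_def sum.distrib by (intro arg_cong2[of _ _ _ _ "(+)"] sum.cong refl 1[symmetric] 2[symmetric])
  then show ?thesis
    by (simp only: sum_two_halves[of "\<lambda>k. \<Sum>m=1..2*N. u k * v m * (if k = N + m \<or> m = N + k then 1 else 0)"])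
qed

lemma clifford_mult_anticommute:
  "clifford_mult N u (clifford_mult N v x) + clifford_mult N v (clifford_mult N u x) = scl (bil N u v) x"
proof
  fix S
  have *: "clifford_mult N u (clifford_mult N v x) S
     = (\<Sum>k=1..2*N. \<Sum>m=1..2*N. u k * v m * gen_op N k (gen_op N m x) S)" for u v
  proof -
    have "clifford_mult N v x = (\<lambda>S. \<Sum>m=1..2*N. v m * gen_op N m x S)"
      using clifford_mult_gen_op by blast
    then show ?thesis
      by (simp add: clifford_mult_gen_op gen_op_sum sum_distrib_left mult.assoc)
  qed
  have "clifford_mult N v (clifford_mult N u x) S
     = (\<Sum>k=1..2*N. \<Sum>m=1..2*N. u k * v m * gen_op N m (gen_op N k x) S)"
    unfolding * by (subst sum.swap) (simp add: mult.commute)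
  then have "(clifford_mult N u (clifford_mult N v x) + clifford_mult N v (clifford_mult N u x)) S
     = (\<Sum>k=1..2*N. \<Sum>m=1..2*N. u k * v m * (gen_op N k (gen_op N m x) S + gen_op N m (gen_op N k x) S))"
    unfolding * plus_fun_def by (simp add: sum.distrib distrib_left)
  also have "\<dots> = (\<Sum>k=1..2*N. \<Sum>m=1..2*N. u k * v m * (if k = N + m \<or> m = N + k then x S else 0))"
    by (intro sum.cong refl arg_cong2[of _ _ _ _ "(*)"] gen_op_anticommute)
  also have "\<dots> = (\<Sum>k=1..2*N. \<Sum>m=1..2*N. u k * v m * (if k = N + m \<or> m = N + k then 1 else 0) * x S)"
    by (intro sum.cong) auto
  also have "\<dots> = scl (bil N u v) x S"
    by (simp add: bil_gen scl_def sum_distrib_right)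
  finally show "(clifford_mult N u (clifford_mult N v x) + clifford_mult N v (clifford_mult N u x)) S
    = scl (bil N u v) x S" .
qed

lemma bil_self: "bil N v v = 2 * quad_form N v"
  unfolding bil_def quad_form_def by (simp add: sum_distrib_left mult.commute)

lemma clifford_mult_scl: "clifford_mult N v (scl c x) = scl c (clifford_mult N v x)"
  by (auto simp: fun_eq_iff clifford_mult_gen_op scl_def gen_op_def sum_distrib_left intro!: sum.cong)

lemma clifford_mult_add: "clifford_mult N v (x + y) = clifford_mult N v x + clifford_mult N v y"
  by (auto simp: fun_eq_iff clifford_mult_gen_op gen_op_def sum.distrib[symmetric] algebra_simps intro!: sum.cong)

lemma clifford_mult_minus: "clifford_mult N v (- x) = - clifford_mult N v x"
  by (auto simp: fun_eq_iff clifford_mult_gen_op gen_op_def sum_negf[symmetric] intro!: sum.cong)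

lemma clifford_mult_diff: "clifford_mult N v (x - y) = clifford_mult N v x - clifford_mult N v y"
  using clifford_mult_add[of N v x "- y"] by (simp add: clifford_mult_minus)

lemma clifford_mult_zero [simp]: "clifford_mult N v 0 = 0"
  using clifford_mult_add[of N v 0 0] by simp

lemma clifford_mult_scl_vec: "clifford_mult N (scl c v) x = scl c (clifford_mult N v x)"
  by (auto simp: fun_eq_iff clifford_mult_gen_op scl_def sum_distrib_left intro!: sum.cong)

lemma clifford_mult_add_vec: "clifford_mult N (u + v) x = clifford_mult N u x + clifford_mult N v x"
  by (auto simp: fun_eq_iff clifford_mult_gen_op sum.distrib[symmetric] algebra_simps intro!: sum.cong)

lemma clifford_mult_diff_vec: "clifford_mult N (u - v) x = clifford_mult N u x - clifford_mult N v x"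
  by (auto simp: fun_eq_iff clifford_mult_gen_op sum_subtractf[symmetric] algebra_simps intro!: sum.cong)

lemma clifford_mult_sum:
  fixes x :: "'a \<Rightarrow> nat set \<Rightarrow> complex"
  shows "clifford_mult N v (\<Sum>i\<in>A. x i) = (\<Sum>i\<in>A. clifford_mult N v (x i))"
  by (rule additive.sum[where f="clifford_mult N v"]) (simp add: additive_def clifford_mult_add)

lemma clifford_mult_sum_vec:
  fixes v :: "'a \<Rightarrow> nat \<Rightarrow> complex"
  shows "clifford_mult N (\<Sum>i\<in>A. v i) x = (\<Sum>i\<in>A. clifford_mult N (v i) x)"
  by (rule additive.sum[where f="\<lambda>v. clifford_mult N v x"]) (simp add: additive_def clifford_mult_add_vec)

lemma clifford_mult_square: "clifford_mult N v (clifford_mult N v x) = scl (quad_form N v) x"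
proof -
  have "scl 2 (clifford_mult N v (clifford_mult N v x)) = scl 2 (scl (quad_form N v) x)"
    using clifford_mult_anticommute[of N v v x]
    by (auto simp: bil_self scl_def fun_eq_iff)
  then show ?thesis by (auto simp: scl_def fun_eq_iff)
qed

lemma clifford_mult_swap:
  "clifford_mult N u (clifford_mult N v x) = scl (bil N u v) x - clifford_mult N v (clifford_mult N u x)"
  using clifford_mult_anticommute[of N u v x] by (simp add: algebra_simps)

lemma bil_sym: "bil N u v = bil N v u"
  unfolding bil_def by (simp add: algebra_simps)

lemma bil_add_left: "bil N (u + v) w = bil N u w + bil N v w"
  and bil_add_right: "bil N w (u + v) = bil N w u + bil N w v"
  and bil_diff_left: "bil N (u - v) w = bil N u w - bil N v w"
  and bil_diff_right: "bil N w (u - v) = bil N w u - bil N w v"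
  and bil_scl_left: "bil N (scl c u) w = c * bil N u w"
  and bil_scl_right: "bil N w (scl c u) = c * bil N w u"
  unfolding bil_def scl_def
  by (simp_all add: sum.distrib[symmetric] sum_subtractf[symmetric] sum_distrib_left algebra_simps)

lemmas bil_simps = bil_add_left bil_add_right bil_diff_left bil_diff_right bil_scl_left bil_scl_right

lemma quad_form_add: "quad_form N (u + v) = quad_form N u + quad_form N v + bil N u v"
  unfolding bil_def quad_form_def by (simp add: sum.distrib[symmetric] algebra_simps)

lemma quad_form_scl: "quad_form N (scl c u) = c\<^sup>2 * quad_form N u"
  unfolding quad_form_def scl_def by (simp add: sum_distrib_left power2_eq_square algebra_simps)

lemma Vspace_add: "u \<in> Vspace N \<Longrightarrow> v \<in> Vspace N \<Longrightarrow> u + v \<in> Vspace N"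
  and Vspace_diff: "u \<in> Vspace N \<Longrightarrow> v \<in> Vspace N \<Longrightarrow> u - v \<in> Vspace N"
  and Vspace_scl: "u \<in> Vspace N \<Longrightarrow> scl c u \<in> Vspace N"
  and Vspace_unit: "k \<in> {1..2*N} \<Longrightarrow> unit_fun k \<in> Vspace N"
  and Vspace_zero: "0 \<in> Vspace N"
  unfolding Vspace_def scl_def unit_fun_def by (simp_all add: zero_fun_def) (metis add.right_neutral diff_zero)+

lemma pt_iff: "y \<in> pt x \<longleftrightarrow> (\<exists>c. y = scl c x)"
  unfolding pt_def cfun.span_singleton by auto

lemma scl_zero_iff [simp]: "scl c x = 0 \<longleftrightarrow> c = 0 \<or> x = 0"
  by (rule cfun.scale_eq_0_iff)

lemma scl_scl [simp]: "scl c (scl d x) = scl (c * d) x"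
  by (rule cfun.scale_scale)

lemma scl_one [simp]: "scl 1 x = x"
  by (rule cfun.scale_one)

lemma pt_scl: "c \<noteq> 0 \<Longrightarrow> pt (scl c x) = pt x"
proof -
  assume c: "c \<noteq> 0"
  have "scl d x = scl (d / c) (scl c x)" for d using c by simp
  then show ?thesis unfolding set_eq_iff pt_iff by (metis scl_scl)
qed

lemma pt_eqI: "y \<in> pt x \<Longrightarrow> y \<noteq> 0 \<Longrightarrow> pt y = pt x"
  by (auto simp: pt_iff pt_scl)

lemma pt_self: "x \<in> pt x"
  unfolding pt_iff by (metis scl_one)

lemma pt_eqD: "pt y = pt x \<Longrightarrow> y \<noteq> 0 \<Longrightarrow> \<exists>c. c \<noteq> 0 \<and> y = scl c x"
  using pt_self[of y] by (auto simp: pt_iff)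

text \<open>Only the parity of \<open>p\<close> matters; a number in place of a truth value lets
  every multiplication by a vector be recorded as \<open>Suc\<close>, hence a product by the length
  of its list.\<close>

definition spinors :: "nat \<Rightarrow> nat \<Rightarrow> (nat set \<Rightarrow> complex) set" where
  "spinors N p = {x. \<forall>S. x S \<noteq> 0 \<longrightarrow> S \<subseteq> {1..N} \<and> (even (card S) \<longleftrightarrow> even p)}"

definition ext_alg :: "nat \<Rightarrow> (nat set \<Rightarrow> complex) set" where
  "ext_alg N = {x. \<forall>S. x S \<noteq> 0 \<longrightarrow> S \<subseteq> {1..N}}"

lemma spinors_0: "spinors N 0 = ext_even N"
  by (simp add: spinors_def ext_even_def)

lemma spinors_even: "even p \<Longrightarrow> spinors N p = ext_even N"
  by (simp add: spinors_def ext_even_def)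

lemma spinors_ext_alg: "x \<in> spinors N p \<Longrightarrow> x \<in> ext_alg N"
  by (auto simp: spinors_def ext_alg_def)

lemma gen_op_support:
  assumes "k \<in> {1..2*N}" "x \<in> ext_alg N" "gen_op N k x S \<noteq> 0"
  shows "\<exists>T. x T \<noteq> 0 \<and> S \<subseteq> {1..N} \<and> (even (card S) \<longleftrightarrow> odd (card T))"
proof (cases "k \<le> N")
  case True
  with assms have k: "k \<in> S" "x (S - {k}) \<noteq> 0" by (auto simp: gen_op_def split: if_splits)
  with assms have s: "S - {k} \<subseteq> {1..N}" by (auto simp: ext_alg_def)
  then have S: "S \<subseteq> {1..N}" using True assms by auto
  then have "card S = Suc (card (S - {k}))" using k by (intro card.remove) (auto intro: finite_subset)
  with S k show ?thesis by (intro exI[of _ "S - {k}"]) auto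
next
  case False
  with assms have k: "k - N \<notin> S" "x (insert (k - N) S) \<noteq> 0" by (auto simp: gen_op_def split: if_splits)
  with assms have s: "insert (k - N) S \<subseteq> {1..N}" by (auto simp: ext_alg_def)
  then have "card (insert (k-N) S) = Suc (card S)" using k by (intro card_insert_disjoint) (auto intro: finite_subset)
  with s k show ?thesis by (intro exI[of _ "insert (k - N) S"]) auto
qed

lemma clifford_mult_ext_alg: "x \<in> ext_alg N \<Longrightarrow> clifford_mult N v x \<in> ext_alg N"
proof (unfold ext_alg_def, safe)
  fix S i assume x: "\<forall>S. x S \<noteq> 0 \<longrightarrow> S \<subseteq> {1..N}" and S: "clifford_mult N v x S \<noteq> 0" "i \<in> S"
  from S obtain k where "k \<in> {1..2*N}" "gen_op N k x S \<noteq> 0"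
    unfolding clifford_mult_gen_op by (metis (no_types, lifting) mult_zero_right sum.neutral)
  with x gen_op_support[of k N x S] S show "i \<in> {1..N}" by (auto simp: ext_alg_def)
qed

lemma clifford_mult_spinors: "x \<in> spinors N p \<Longrightarrow> clifford_mult N v x \<in> spinors N (Suc p)"
proof -
  assume x: "x \<in> spinors N p"
  show ?thesis unfolding spinors_def
  proof (rule CollectI, intro allI impI)
    fix S assume S: "clifford_mult N v x S \<noteq> 0"
    then obtain k where "k \<in> {1..2*N}" "gen_op N k x S \<noteq> 0"
      unfolding clifford_mult_gen_op by (metis (no_types, lifting) mult_zero_right sum.neutral)
    with gen_op_support[of k N x S] spinors_ext_alg[OF x]
    obtain T where "x T \<noteq> 0" "S \<subseteq> {1..N}" "even (card S) \<longleftrightarrow> odd (card T)" by auto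
    with x show "S \<subseteq> {1..N} \<and> even (card S) = even (Suc p)"
      by (auto simp: spinors_def)
  qed
qed

section \<open>Pure spinors\<close>

definition Ann :: "nat \<Rightarrow> (nat set \<Rightarrow> complex) \<Rightarrow> (nat \<Rightarrow> complex) set" where
  "Ann N x = {v \<in> Vspace N. clifford_mult N v x = 0}"

text \<open>Together with \<open>Ann_isotropic\<close> the third conjunct makes the annihilator
  equal to its orthogonal, which replaces the requirement of dimension N. Uniqueness up to a scalar
  is part of the definition, so that it is transported together with maximality instead of being
  derived anew for each spinor.\<close>

definition pure_spinor :: "nat \<Rightarrow> (nat set \<Rightarrow> complex) \<Rightarrow> bool" where
  "pure_spinor N x \<longleftrightarrow> x \<noteq> 0 \<and> x \<in> ext_alg N \<and>
     (\<forall>v \<in> Vspace N. (\<forall>w \<in> Ann N x. bil N v w = 0) \<longrightarrow> v \<in> Ann N x) \<and>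
     (\<forall>y \<in> ext_alg N. (\<forall>w \<in> Ann N x. clifford_mult N w y = 0) \<longrightarrow> y \<in> pt x)"

lemma Ann_Vspace: "v \<in> Ann N x \<Longrightarrow> v \<in> Vspace N"
  and Ann_mult: "v \<in> Ann N x \<Longrightarrow> clifford_mult N v x = 0"
  by (auto simp: Ann_def)

lemma Ann_add: "u \<in> Ann N x \<Longrightarrow> v \<in> Ann N x \<Longrightarrow> u + v \<in> Ann N x"
  and Ann_diff: "u \<in> Ann N x \<Longrightarrow> v \<in> Ann N x \<Longrightarrow> u - v \<in> Ann N x"
  and Ann_scl: "u \<in> Ann N x \<Longrightarrow> scl c u \<in> Ann N x"
  by (simp_all add: Ann_def Vspace_add Vspace_diff Vspace_scl clifford_mult_add_vec
      clifford_mult_diff_vec clifford_mult_scl_vec)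

lemma Ann_scl_spinor: "c \<noteq> 0 \<Longrightarrow> Ann N (scl c x) = Ann N x"
  by (auto simp: Ann_def clifford_mult_scl)

lemma Ann_mono_pt: "y \<in> pt x \<Longrightarrow> Ann N x \<subseteq> Ann N y"
  by (auto simp: Ann_def pt_iff clifford_mult_scl)

lemma Ann_uminus: "Ann N (- x) = Ann N x"
  by (auto simp: Ann_def clifford_mult_minus)

lemma Ann_isotropic: "x \<noteq> 0 \<Longrightarrow> v \<in> Ann N x \<Longrightarrow> w \<in> Ann N x \<Longrightarrow> bil N v w = 0"
  using clifford_mult_swap[of N v w x] by (auto simp: Ann_def)

lemma Ann_quad_form: "x \<noteq> 0 \<Longrightarrow> v \<in> Ann N x \<Longrightarrow> quad_form N v = 0"
  using Ann_isotropic[of x v N v] by (simp add: bil_self)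

lemma pure_nonzero: "pure_spinor N x \<Longrightarrow> x \<noteq> 0"
  and pure_ext_alg: "pure_spinor N x \<Longrightarrow> x \<in> ext_alg N"
  and pure_maximal: "pure_spinor N x \<Longrightarrow> v \<in> Vspace N \<Longrightarrow> (\<And>w. w \<in> Ann N x \<Longrightarrow> bil N v w = 0) \<Longrightarrow> v \<in> Ann N x"
  and pure_unique: "pure_spinor N x \<Longrightarrow> y \<in> ext_alg N \<Longrightarrow> Ann N x \<subseteq> Ann N y \<Longrightarrow> y \<in> pt x"
  by (auto simp: pure_spinor_def Ann_def)

lemma pure_scl: "pure_spinor N x \<Longrightarrow> c \<noteq> 0 \<Longrightarrow> pure_spinor N (scl c x)"
  unfolding pure_spinor_def by (simp add: Ann_scl_spinor pt_scl) (simp add: ext_alg_def scl_def)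

lemma pure_Ann_subset_pt:
  assumes "pure_spinor N x" "pure_spinor N y" "Ann N x \<subseteq> Ann N y"
  shows "pt y = pt x"
  using assms by (intro pt_eqI pure_unique) (auto simp: pure_nonzero pure_ext_alg)

text \<open>The relation between \<open>v\<close> and \<open>v'\<close> below says that \<open>v' = s (T v T\<inverse>)\<close> as operators;
  both the action of the spin group (\<open>s = 1\<close>) and reflections (\<open>s = -1\<close>) are of this form.\<close>

lemma pure_transfer:
  assumes add: "\<And>y z. T (y + z) = T y + T z"
    and scl: "\<And>c y. T (scl c y) = scl c (T y)"
    and inv: "\<And>y. T' (T y) = y" "\<And>y. T (T' y) = y"
    and ext: "\<And>y. y \<in> ext_alg N \<Longrightarrow> T y \<in> ext_alg N" "\<And>y. y \<in> ext_alg N \<Longrightarrow> T' y \<in> ext_alg N"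
    and s: "s * s = 1"
    and fwd: "\<And>v. v \<in> Vspace N \<Longrightarrow>
      \<exists>v' \<in> Vspace N. \<forall>y. clifford_mult N v' (T y) = scl s (T (clifford_mult N v y))"
    and bwd: "\<And>v'. v' \<in> Vspace N \<Longrightarrow>
      \<exists>v \<in> Vspace N. \<forall>y. clifford_mult N v' (T y) = scl s (T (clifford_mult N v y))"
    and x: "pure_spinor N x"
  shows "pure_spinor N (T x)"
proof -
  define R where "R v v' \<longleftrightarrow> v \<in> Vspace N \<and> v' \<in> Vspace N \<and>
    (\<forall>y. clifford_mult N v' (T y) = scl s (T (clifford_mult N v y)))" for v v'
  have s0: "s \<noteq> 0" using s by auto
  have T0: "T y = 0 \<longleftrightarrow> y = 0" for y
  proof -
    have "T 0 = 0" using scl[of 0 0] by simp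
    then show ?thesis by (metis inv(1))
  qed
  have x0: "x \<noteq> 0" using x by (rule pure_nonzero)
  \<comment> \<open>The sign \<open>s\<close> enters twice in a product of two vectors and cancels,
    so evaluating the Clifford relation on the nonzero spinor \<open>T x\<close> shows that the form
    is preserved.\<close>
  have R_bil: "bil N v' w' = bil N v w" if "R v v'" "R w w'" for v v' w w'
  proof -
    have *: "clifford_mult N v' (clifford_mult N w' (T x)) = T (clifford_mult N v (clifford_mult N w x))"
      if "R v v'" "R w w'" for v v' w w'
      using that s by (simp add: R_def clifford_mult_scl)
    have "scl (bil N v' w') (T x) = T (clifford_mult N v (clifford_mult N w x)) + T (clifford_mult N w (clifford_mult N v x))"
      using *[OF that] *[OF that(2,1)] clifford_mult_anticommute[of N v' w' "T x"] by simp
    moreover have "T (clifford_mult N v (clifford_mult N w x)) + T (clifford_mult N w (clifford_mult N v x)) = scl (bil N v w) (T x)"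
      by (simp only: add[symmetric] scl[symmetric] clifford_mult_anticommute)
    ultimately have "scl (bil N v' w' - bil N v w) (T x) = 0" by (simp add: scl_def fun_eq_iff left_diff_distrib)
    then show ?thesis using T0 x0 by simp
  qed
  have R_Ann: "v' \<in> Ann N (T y) \<longleftrightarrow> v \<in> Ann N y" if "R v v'" for v v' y
    using that s0 T0 by (simp add: R_def Ann_def)
  show ?thesis
    unfolding pure_spinor_def
  proof (intro conjI ballI impI)
    show "T x \<noteq> 0" using T0 x0 by simp
    show "T x \<in> ext_alg N" using ext(1) x by (simp add: pure_ext_alg)
  next
    fix v' assume v': "v' \<in> Vspace N" "\<forall>w \<in> Ann N (T x). bil N v' w = 0"
    then obtain v where v: "R v v'" using bwd R_def by blast
    have "v \<in> Ann N x"
    proof (rule pure_maximal[OF x])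
      show "v \<in> Vspace N" using v R_def by blast
      fix w assume w: "w \<in> Ann N x"
      then obtain w' where "R w w'" using fwd R_def by (meson Ann_Vspace)
      then show "bil N v w = 0" using w v' v R_bil R_Ann by metis
    qed
    then show "v' \<in> Ann N (T x)" using v R_Ann by blast
  next
    fix y assume y: "y \<in> ext_alg N" "\<forall>w \<in> Ann N (T x). clifford_mult N w y = 0"
    have "T' y \<in> pt x"
    proof (rule pure_unique[OF x ext(2)[OF y(1)]], rule subsetI)
      fix w assume w: "w \<in> Ann N x"
      then obtain w' where w': "R w w'" using fwd R_def by (meson Ann_Vspace)
      then have "w' \<in> Ann N (T (T' y))" using w y R_Ann[of w w' x] by (simp add: inv) (auto simp: Ann_def)
      then show "w \<in> Ann N (T' y)" using w' R_Ann by blast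
    qed
    then show "y \<in> pt (T x)" by (metis pt_iff scl inv(2))
  qed
qed
text \<open>Since \<open>u\<close> squares to one, multiplication by it is its own inverse, and it
  turns multiplication by \<open>v\<close> into minus multiplication by the reflection
  \<open>v - scl (bil N u v) u\<close>.\<close>

lemma pure_unit_mult:
  assumes x: "pure_spinor N x" and u: "u \<in> Vspace N" "quad_form N u = 1"
  shows "pure_spinor N (clifford_mult N u x)"
proof (rule pure_transfer[where T = "clifford_mult N u" and T' = "clifford_mult N u" and s = "-1"])
  have u2: "clifford_mult N u (clifford_mult N u y) = y" for y
    by (simp add: clifford_mult_square u)
  have R: "clifford_mult N (v - scl (bil N u v) u) (clifford_mult N u y) = scl (-1) (clifford_mult N u (clifford_mult N v y))" for v y
    using clifford_mult_swap[of N v u y]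
    by (simp add: clifford_mult_diff_vec clifford_mult_scl_vec u2 bil_sym[of N u v])
  show "\<exists>v'\<in>Vspace N. \<forall>y. clifford_mult N v' (clifford_mult N u y) = scl (- 1) (clifford_mult N u (clifford_mult N v y))"
    if "v \<in> Vspace N" for v
    using R[of v] that u by (blast intro: Vspace_diff Vspace_scl)
  show "\<exists>v\<in>Vspace N. \<forall>y. clifford_mult N v' (clifford_mult N u y) = scl (- 1) (clifford_mult N u (clifford_mult N v y))"
    if "v' \<in> Vspace N" for v'
  proof -
    \<comment> \<open>The reflection is an involution, so the preimage of \<open>v'\<close> is its
      own reflection.\<close>
    let ?v = "v' - scl (bil N u v') u"
    have "bil N u ?v = - bil N u v'"
      using u by (simp add: bil_simps bil_self)
    then have v: "?v - scl (bil N u ?v) u = v'" by (auto simp: scl_def fun_eq_iff)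
    then have "\<forall>y. clifford_mult N v' (clifford_mult N u y) = scl (- 1) (clifford_mult N u (clifford_mult N ?v y))"
      using R[of ?v] unfolding v by simp
    moreover have "?v \<in> Vspace N" using that u by (blast intro: Vspace_diff Vspace_scl)
    ultimately show ?thesis by blast
  qed
qed (use x u in \<open>simp_all add: clifford_mult_add clifford_mult_scl clifford_mult_ext_alg clifford_mult_square\<close>)

text \<open>If \<open>v\<close> were orthogonal to the whole annihilator, maximality would put it
  inside; any element pairing nontrivially with \<open>v\<close> can then be rescaled.\<close>

lemma pure_dual:
  assumes "pure_spinor N x" "v \<in> Vspace N" "clifford_mult N v x \<noteq> 0"
  obtains f where "f \<in> Ann N x" "bil N v f = c"
proof -
  obtain f where f: "f \<in> Ann N x" "bil N v f \<noteq> 0"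
    using assms pure_maximal by (metis Ann_mult)
  show ?thesis
    using that[of "scl (c / bil N v f) f"] f by (simp add: Ann_scl bil_simps)
qed

text \<open>Adding an isotropic \<open>f\<close> from \<open>Ann N x\<close> does not change the
  product with \<open>x\<close> but shifts the quadratic form by \<open>bil N v f\<close>. Thus even
  an isotropic vector may be replaced by one of square one, to which reflections and the spin group
  apply.\<close>

lemma pure_unit_representative:
  assumes "pure_spinor N x" "v \<in> Vspace N" "clifford_mult N v x \<noteq> 0"
  obtains u where "u \<in> Vspace N" "quad_form N u = 1" "clifford_mult N u x = clifford_mult N v x"
proof -
  obtain f where f: "f \<in> Ann N x" "bil N v f = 1 - quad_form N v"
    using pure_dual[OF assms] .
  show ?thesis
  proof (rule that[of "v + f"])
    show "quad_form N (v + f) = 1"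
      using f Ann_quad_form[OF pure_nonzero[OF assms(1)] f(1)] by (simp add: quad_form_add)
  qed (use f assms in \<open>auto simp: Ann_def Vspace_add clifford_mult_add_vec\<close>)
qed

lemma pure_mult:
  assumes "pure_spinor N x" "v \<in> Vspace N" "clifford_mult N v x \<noteq> 0"
  shows "pure_spinor N (clifford_mult N v x)"
  using pure_unit_representative[OF assms] pure_unit_mult[OF assms(1)] by metis

section \<open>Annihilators that meet in small codimension\<close>

lemma Ann_mult_perp:
  "z \<in> Ann N x \<Longrightarrow> bil N v z = 0 \<Longrightarrow> z \<in> Ann N (clifford_mult N v x)"
  using clifford_mult_swap[of N z v x] by (simp add: Ann_def bil_sym)

text \<open>Codimension is measured by counting linear conditions: \<open>Ann N d\<close> cut out by the form
  \<open>bil N w\<close> being contained in \<open>Ann N h\<close> says that the two annihilators meet in codimension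
  at most one. Counted in this way, no dimension theory is needed.\<close>

lemma near_reverse:
  assumes d: "pure_spinor N d" and h: "pure_spinor N h"
    and near: "\<And>z. z \<in> Ann N d \<Longrightarrow> bil N w z = 0 \<Longrightarrow> z \<in> Ann N h"
  obtains d0 where "d0 \<in> Vspace N" "\<And>z. z \<in> Ann N h \<Longrightarrow> bil N d0 z = 0 \<Longrightarrow> z \<in> Ann N d"
proof (cases "\<exists>d0 \<in> Ann N d. bil N w d0 \<noteq> 0")
  \<comment> \<open>The condition is void on \<open>Ann N d\<close>, so \<open>Ann N d\<close> lies
    in \<open>Ann N h\<close>; the reverse inclusion follows from maximality, and the zero vector
    serves as condition.\<close>
  case False
  have "z \<in> Ann N d" if "z \<in> Ann N h" for z
  proof (rule pure_maximal[OF d Ann_Vspace[OF that]])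
    fix y assume "y \<in> Ann N d"
    then show "bil N z y = 0"
      using near False that Ann_isotropic[OF pure_nonzero[OF h]] by blast
  qed
  then show ?thesis using that[of 0] Vspace_zero by blast
next
  case True
  then obtain d0 where d0: "d0 \<in> Ann N d" "bil N w d0 \<noteq> 0" by blast
  \<comment> \<open>\<open>Ann N d\<close> is the sum of the line of \<open>d0\<close> and the
    hyperplane cut out by \<open>w\<close>. The hyperplane lies in the isotropic
    \<open>Ann N h\<close>, so only orthogonality to \<open>d0\<close> has to be imposed on
    \<open>z\<close>.\<close>
  show ?thesis
  proof (rule that[of d0])
    fix z assume z: "z \<in> Ann N h" "bil N d0 z = 0"
    show "z \<in> Ann N d"
    proof (rule pure_maximal[OF d Ann_Vspace[OF z(1)]])
      fix y assume y: "y \<in> Ann N d"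
      define y' where "y' = y - scl (bil N w y / bil N w d0) d0"
      have "y' \<in> Ann N d" "bil N w y' = 0"
        using y d0 by (auto simp: y'_def Ann_diff Ann_scl bil_simps)
      then have "bil N z y' = 0"
        using near z Ann_isotropic[OF pure_nonzero[OF h]] by blast
      then show "bil N z y = 0"
        using z by (simp add: y'_def bil_simps bil_sym[of N z d0])
    qed
  qed (use d0 Ann_Vspace in blast)
qed

text \<open>A vector \<open>w\<close> annihilating the sum but not \<open>b\<close> gives
  \<open>w a = - w b\<close>, a common neighbour of \<open>a\<close> and \<open>b\<close>: one
  condition leads from \<open>a\<close> to it, one more from it to \<open>b\<close>. Without such a
  \<open>w\<close> all three spinors are proportional.\<close>

lemma near_of_pure_sum:
  assumes a: "pure_spinor N a" and b: "pure_spinor N b" and ab: "pure_spinor N (a + b)"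
  obtains w d where "w \<in> Vspace N" "d \<in> Vspace N"
    "\<And>z. z \<in> Ann N a \<Longrightarrow> bil N w z = 0 \<Longrightarrow> bil N d z = 0 \<Longrightarrow> z \<in> Ann N b"
proof (cases "Ann N (a + b) \<subseteq> Ann N b")
  case True
  then have "b \<in> pt (a + b)" using pure_unique[OF ab] pure_ext_alg[OF b] by blast
  then obtain c where c: "b = scl c (a + b)" by (auto simp: pt_iff)
  then have c0: "c \<noteq> 0" using pure_nonzero[OF b] by auto
  have *: "scl (1 - c) b = scl c a" using c by (auto simp: scl_def fun_eq_iff algebra_simps)
  \<comment> \<open>The value \<open>c = 1\<close> would force \<open>a = 0\<close>.\<close>
  then have "b = scl (c / (1 - c)) a"
    using c0 pure_nonzero[OF a] by (cases "c = 1") (auto simp: scl_def fun_eq_iff field_simps)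
  then have "Ann N a \<subseteq> Ann N b" by (intro Ann_mono_pt) (auto simp: pt_iff)
  then show ?thesis using that[of 0 0] Vspace_zero by blast
next
  case False
  then obtain w where w: "w \<in> Ann N (a + b)" "w \<notin> Ann N b" by blast
  then have wV: "w \<in> Vspace N" by (auto dest: Ann_Vspace)
  define h where "h = clifford_mult N w b"
  have "h \<noteq> 0" using w wV by (simp add: h_def Ann_def)
  then have h: "pure_spinor N h" using pure_mult[OF b wV] by (simp add: h_def)
  have "clifford_mult N w a = - h"
    using Ann_mult[OF w(1)] by (simp add: clifford_mult_add h_def eq_neg_iff_add_eq_0)
  then have ha: "Ann N (clifford_mult N w a) = Ann N h" by (simp add: Ann_uminus)
  obtain d where d: "d \<in> Vspace N" "\<And>z. z \<in> Ann N h \<Longrightarrow> bil N d z = 0 \<Longrightarrow> z \<in> Ann N b"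
    using near_reverse[OF b h] Ann_mult_perp unfolding h_def by metis
  show ?thesis
    using that[OF wV d(1)] Ann_mult_perp ha d(2) by metis
qed

text \<open>A vector space is not the union of two proper subspaces; one of \<open>u\<close>,
  \<open>w\<close> and \<open>u + w\<close> is always a witness.\<close>

lemma Ann_not_covered:
  assumes "\<not> Ann N c \<subseteq> Ann N a" "\<not> Ann N c \<subseteq> Ann N b"
  obtains v where "v \<in> Ann N c" "v \<notin> Ann N a" "v \<notin> Ann N b"
proof -
  obtain u where u: "u \<in> Ann N c" "u \<notin> Ann N a" using assms by blast
  obtain w where w: "w \<in> Ann N c" "w \<notin> Ann N b" using assms by blast
  have 1: "u + w \<notin> Ann N a" if "w \<in> Ann N a" using u Ann_diff[of "u + w" N a w] that by auto
  have 2: "u + w \<notin> Ann N b" if "u \<in> Ann N b" using w Ann_diff[of "u + w" N b u] that by auto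
  show ?thesis
    using that[of u] that[of w] that[of "u + w"] u w 1 2 Ann_add by blast
qed

text \<open>A vector \<open>v\<close> annihilating \<open>c\<close> but neither \<open>a\<close> nor \<open>b\<close> turns the two decompositions into
  \<open>v \<cdot> a + v \<cdot> b = v \<cdot> d\<close>, a sum of two pure spinors that is pure or zero.\<close>

lemma near_of_two_decompositions:
  assumes a: "pure_spinor N a" and b: "pure_spinor N b" and c: "pure_spinor N c"
    and d: "pure_spinor N d" and eq: "a + b = c + d"
    and ca: "pt c \<noteq> pt a" and cb: "pt c \<noteq> pt b"
  obtains t1 t2 t3 t4 where "set [t1, t2, t3, t4] \<subseteq> Vspace N"
    "\<And>z. z \<in> Ann N a \<Longrightarrow> (\<And>t. t \<in> set [t1, t2, t3, t4] \<Longrightarrow> bil N t z = 0) \<Longrightarrow> z \<in> Ann N b"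
proof -
  obtain v where v: "v \<in> Ann N c" "v \<notin> Ann N a" "v \<notin> Ann N b"
    using Ann_not_covered pure_Ann_subset_pt a b c ca cb by metis
  have vV: "v \<in> Vspace N" using v by (auto dest: Ann_Vspace)
  define a' where "a' = clifford_mult N v a"
  define b' where "b' = clifford_mult N v b"
  have a': "pure_spinor N a'" and b': "pure_spinor N b'"
    using v vV pure_mult a b by (auto simp: a'_def b'_def Ann_def)
  have sum: "a' + b' = clifford_mult N v d"
    using Ann_mult[OF v(1)] by (simp add: a'_def b'_def clifford_mult_add[symmetric] eq)
      (simp add: clifford_mult_add)
  have "\<exists>w1 w2. w1 \<in> Vspace N \<and> w2 \<in> Vspace N \<and>
    (\<forall>z \<in> Ann N a'. bil N w1 z = 0 \<longrightarrow> bil N w2 z = 0 \<longrightarrow> z \<in> Ann N b')"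
  proof (cases "clifford_mult N v d = 0")
    case True
    then have "a' = - b'" using sum by (simp add: eq_neg_iff_add_eq_0)
    then show ?thesis using Ann_uminus[of N b'] Vspace_zero by auto
  next
    case False
    then have "pure_spinor N (a' + b')" using sum pure_mult[OF d vV] by simp
    then show ?thesis using near_of_pure_sum[OF a' b'] by metis
  qed
  then obtain w1 w2 where w: "w1 \<in> Vspace N" "w2 \<in> Vspace N"
    "\<And>z. z \<in> Ann N a' \<Longrightarrow> bil N w1 z = 0 \<Longrightarrow> bil N w2 z = 0 \<Longrightarrow> z \<in> Ann N b'" by blast
  obtain b0 where b0: "b0 \<in> Vspace N" "\<And>z. z \<in> Ann N b' \<Longrightarrow> bil N b0 z = 0 \<Longrightarrow> z \<in> Ann N b"
    using near_reverse[OF b b'] Ann_mult_perp unfolding b'_def by metis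
  \<comment> \<open>The origin of the number four: \<open>v\<close> leads from \<open>a\<close> to
    \<open>v a\<close>, then \<open>w1\<close> and \<open>w2\<close> to \<open>v b\<close>, and
    \<open>b0\<close> back to \<open>b\<close>.\<close>
  show ?thesis
  proof (rule that[of v w1 w2 b0])
    fix z assume z: "z \<in> Ann N a" "\<And>t. t \<in> set [v, w1, w2, b0] \<Longrightarrow> bil N t z = 0"
    then have "z \<in> Ann N a'" unfolding a'_def by (intro Ann_mult_perp) auto
    then show "z \<in> Ann N b" using w(3) b0(2) z(2) by simp
  qed (use vV w b0 in auto)
qed

text \<open>Each condition costs at most one factor. If some \<open>e\<close> in
  \<open>Ann N a\<close> meets all conditions but the first and does not annihilate
  \<open>b\<close>, then passing to \<open>e b\<close> disposes of the first condition; if there is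
  no such \<open>e\<close>, the remaining conditions already suffice. With none left, maximality and
  uniqueness make \<open>a\<close> and \<open>b\<close> proportional. As all factors come from
  \<open>Ann N a\<close>, they are isotropic and mutually orthogonal.\<close>

lemma near_factorization:
  assumes "pure_spinor N a" "pure_spinor N b" "set ts \<subseteq> Vspace N"
    "\<And>z. z \<in> Ann N a \<Longrightarrow> (\<And>t. t \<in> set ts \<Longrightarrow> bil N t z = 0) \<Longrightarrow> z \<in> Ann N b"
  shows "\<exists>es. length es \<le> length ts \<and> set es \<subseteq> Ann N a \<and> a \<in> pt (foldr (clifford_mult N) es b)"
  using assms(2-4)
proof (induction ts arbitrary: b)
  case Nil
  then have "pt b = pt a" using pure_Ann_subset_pt assms(1) by (metis empty_iff list.set(1) subsetI)
  then show ?case using pt_self by (intro exI[of _ "[]"]) auto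
next
  case (Cons t ts)
  show ?case
  proof (cases "\<exists>e \<in> Ann N a. (\<forall>t \<in> set ts. bil N t e = 0) \<and> e \<notin> Ann N b")
    case False
    have "\<exists>es. length es \<le> length ts \<and> set es \<subseteq> Ann N a \<and> a \<in> pt (foldr (clifford_mult N) es b)"
      by (rule Cons.IH[OF Cons.prems(1)]) (use Cons.prems(2) False in auto)
    then obtain es where "length es \<le> length ts" "set es \<subseteq> Ann N a" "a \<in> pt (foldr (clifford_mult N) es b)"
      by blast
    then show ?thesis by (intro exI[of _ es]) auto
  next
    case True
    then obtain e where e: "e \<in> Ann N a" "\<And>t. t \<in> set ts \<Longrightarrow> bil N t e = 0" "e \<notin> Ann N b" by blast
    define b1 where "b1 = clifford_mult N e b"
    have eV: "e \<in> Vspace N" using e Ann_Vspace by blast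
    then have b1: "pure_spinor N b1" unfolding b1_def using e Cons.prems(1) by (intro pure_mult) (auto simp: Ann_def)
    \<comment> \<open>Otherwise \<open>e\<close> would meet all conditions and hence annihilate
      \<open>b\<close>.\<close>
    have te: "bil N t e \<noteq> 0" using Cons.prems(3)[OF e(1)] e by auto
    have iso: "bil N e z = 0" if "z \<in> Ann N a" for z
      using Ann_isotropic[OF pure_nonzero[OF assms(1)] e(1) that] .
    have eb1: "e \<in> Ann N b1"
      using eV e(1) Ann_quad_form[OF pure_nonzero[OF assms(1)]]
      by (auto simp: b1_def Ann_def clifford_mult_square)
    have "z \<in> Ann N b1" if z: "z \<in> Ann N a" "\<And>t. t \<in> set ts \<Longrightarrow> bil N t z = 0" for z
    proof -
      \<comment> \<open>Correcting \<open>z\<close> along \<open>e\<close> restores the dropped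
        condition; the correction is harmless, because \<open>e\<close> annihilates
        \<open>e b\<close>.\<close>
      define z' where "z' = z - scl (bil N t z / bil N t e) e"
      have z': "z' \<in> Ann N a" "\<And>t'. t' \<in> set (t # ts) \<Longrightarrow> bil N t' z' = 0"
        using z e te by (auto simp: z'_def Ann_diff Ann_scl bil_simps)
      then have "z' \<in> Ann N b1" unfolding b1_def
        using Cons.prems(3) iso by (intro Ann_mult_perp) auto
      then have "z' + scl (bil N t z / bil N t e) e \<in> Ann N b1" using eb1 Ann_add Ann_scl by blast
      then show ?thesis by (simp add: z'_def)
    qed
    then obtain es where "length es \<le> length ts" "set es \<subseteq> Ann N a" "a \<in> pt (foldr (clifford_mult N) es b1)"
      using Cons.IH[OF b1] Cons.prems(2) by auto
    \<comment> \<open>\<open>foldr\<close> applies the last entry of the list first, hence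
      \<open>e\<close> is appended at the end.\<close>
    then show ?thesis using e(1) by (intro exI[of _ "es @ [e]"]) (auto simp: b1_def)
  qed
qed

section \<open>The action of the Clifford algebra\<close>

abbreviation word_act :: "nat \<Rightarrow> nat list \<Rightarrow> (nat set \<Rightarrow> complex) \<Rightarrow> nat set \<Rightarrow> complex" where
  "word_act N w \<equiv> foldr (\<lambda>i. clifford_mult N (unit_fun i)) w"

text \<open>The support of \<open>a\<close> varies with \<open>a\<close>; summing over a fixed
  finite superset makes the actions of different tensors comparable term by term.\<close>

lemma tensor_act_finite:
  assumes "finite F" "{w. a w \<noteq> 0} \<subseteq> F"
  shows "tensor_act N a x = (\<Sum>w\<in>F. scl (a w) (word_act N w x))"
  unfolding tensor_act_def by (rule sum.mono_neutral_left) (use assms in auto)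

lemma word_act_add: "word_act N w (x + y) = word_act N w x + word_act N w y"
  by (induction w) (simp_all only: foldr.simps o_apply id_apply clifford_mult_add)

lemma word_act_scl: "word_act N w (scl c x) = scl c (word_act N w x)"
  by (induction w) (simp_all only: foldr.simps o_apply id_apply clifford_mult_scl)

lemma word_act_sum:
  fixes x :: "'a \<Rightarrow> nat set \<Rightarrow> complex"
  shows "word_act N w (\<Sum>i\<in>A. x i) = (\<Sum>i\<in>A. word_act N w (x i))"
  by (rule additive.sum[where f="word_act N w"]) (simp add: additive_def word_act_add)

lemma tensor_act_add_spinor: "tensor_act N a (x + y) = tensor_act N a x + tensor_act N a y"
  unfolding tensor_act_def by (simp add: word_act_add cfun.scale_right_distrib sum.distrib)

lemma tensor_act_scl_spinor: "tensor_act N a (scl c x) = scl c (tensor_act N a x)"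
  unfolding tensor_act_def by (simp add: word_act_scl cfun.scale_sum_right mult.commute)

lemma tensor_act_zero_spinor [simp]: "tensor_act N a 0 = 0"
  using tensor_act_scl_spinor[of N a 0 0] by simp

lemma tensor_act_add:
  assumes "a \<in> carrier (tensor_algebra N)" "b \<in> carrier (tensor_algebra N)"
  shows "tensor_act N (a + b) x = tensor_act N a x + tensor_act N b x"
proof -
  let ?F = "{w. a w \<noteq> 0} \<union> {w. b w \<noteq> 0}"
  have F: "finite ?F" using assms by (simp add: tensor_algebra_def)
  have "tensor_act N c x = (\<Sum>w\<in>?F. scl (c w) (word_act N w x))" if "c \<in> {a, b, a + b}" for c
    by (rule tensor_act_finite[OF F]) (use that in auto)
  then show ?thesis by (simp add: cfun.scale_left_distrib sum.distrib)
qed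

lemma tensor_act_scl:
  assumes "a \<in> carrier (tensor_algebra N)"
  shows "tensor_act N (scl c a) x = scl c (tensor_act N a x)"
proof -
  let ?F = "{w. a w \<noteq> 0}"
  have F: "finite ?F" using assms by (simp add: tensor_algebra_def)
  have "tensor_act N d x = (\<Sum>w\<in>?F. scl (d w) (word_act N w x))" if "d \<in> {a, scl c a}" for d
    by (rule tensor_act_finite[OF F]) (use that in \<open>auto simp: scl_def\<close>)
  then show ?thesis by (simp add: cfun.scale_sum_right scl_def[of c a])
qed

lemma tensor_act_mult:
  assumes a: "a \<in> carrier (tensor_algebra N)" and b: "b \<in> carrier (tensor_algebra N)"
  shows "tensor_act N (a \<otimes>\<^bsub>tensor_algebra N\<^esub> b) x = tensor_act N a (tensor_act N b x)"
proof -
  let ?A = "{w. a w \<noteq> 0}" and ?B = "{w. b w \<noteq> 0}"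
  let ?F = "(\<lambda>(u,v). u @ v) ` (?A \<times> ?B)"
  have td: "take (length u) (u @ v) = u" "drop (length u) (u @ v) = v" for u v :: "nat list" by simp_all
  have fin: "finite ?A" "finite ?B" using a b by (simp_all add: tensor_algebra_def)
  then have F: "finite ?F" by simp
  have ab: "(a \<otimes>\<^bsub>tensor_algebra N\<^esub> b) w = (\<Sum>k\<le>length w. a (take k w) * b (drop k w))" for w
    by (simp add: tensor_algebra_def)
  have "{w. (a \<otimes>\<^bsub>tensor_algebra N\<^esub> b) w \<noteq> 0} \<subseteq> ?F"
  proof
    fix w assume "w \<in> {w. (a \<otimes>\<^bsub>tensor_algebra N\<^esub> b) w \<noteq> 0}"
    then obtain k where "a (take k w) * b (drop k w) \<noteq> 0"
      unfolding ab by (metis (mono_tags, lifting) mem_Collect_eq sum.neutral)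
    then show "w \<in> ?F" by (intro image_eqI[of _ _ "(take k w, drop k w)"]) auto
  qed
  then have "tensor_act N (a \<otimes>\<^bsub>tensor_algebra N\<^esub> b) x
      = (\<Sum>w\<in>?F. scl (\<Sum>k\<le>length w. a (take k w) * b (drop k w)) (word_act N w x))"
    by (subst tensor_act_finite[OF F]) (simp_all add: ab)
  also have "\<dots> = (\<Sum>w\<in>?F. \<Sum>k\<le>length w. scl (a (take k w) * b (drop k w)) (word_act N w x))"
    by (simp add: cfun.scale_sum_left)
  also have "\<dots> = (\<Sum>(w,k)\<in>(SIGMA w:?F. {..length w}). scl (a (take k w) * b (drop k w)) (word_act N w x))"
    using F by (subst sum.Sigma) auto
  \<comment> \<open>A word may arise from several pairs, but a word together with a cut position
    determines the pair; after discarding zero terms, cutting is a bijection onto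
    \<open>?A \<times> ?B\<close>.\<close>
  also have "\<dots> = (\<Sum>(w,k)\<in>{p \<in> (SIGMA w:?F. {..length w}). a (take (snd p) (fst p)) * b (drop (snd p) (fst p)) \<noteq> 0}.
      scl (a (take k w) * b (drop k w)) (word_act N w x))"
    using F by (intro sum.mono_neutral_right finite_SigmaI) auto
  also have "\<dots> = (\<Sum>(u,v)\<in>?A \<times> ?B. scl (a u * b v) (word_act N (u @ v) x))"
    by (rule sum.reindex_bij_witness[where
        i = "\<lambda>(u,v). (u @ v, length u)" and j = "\<lambda>(w,k). (take k w, drop k w)"])
      (auto simp: td simp del: foldr_append take_append drop_append)
  also have "\<dots> = (\<Sum>u\<in>?A. \<Sum>v\<in>?B. scl (a u * b v) (word_act N (u @ v) x))"
    using fin by (subst sum.Sigma) auto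
  also have "\<dots> = tensor_act N a (tensor_act N b x)"
    unfolding tensor_act_def by (simp add: word_act_sum word_act_scl cfun.scale_sum_right)
  finally show ?thesis .
qed

lemma tensor_vec_support:
  assumes "v \<in> Vspace N"
  shows "{w. tensor_vec v w \<noteq> 0} \<subseteq> (\<lambda>i. [i]) ` {1..2*N}"
proof
  fix w assume "w \<in> {w. tensor_vec v w \<noteq> 0}"
  then obtain i where "w = [i]" "v i \<noteq> 0"
    by (auto simp: tensor_vec_def split: list.splits)
  then show "w \<in> (\<lambda>i. [i]) ` {1..2*N}" using assms by (auto simp: Vspace_def)
qed

lemma tensor_vec_carrier: "v \<in> Vspace N \<Longrightarrow> tensor_vec v \<in> carrier (tensor_algebra N)"
proof -
  assume v: "v \<in> Vspace N"
  have "finite {w. tensor_vec v w \<noteq> 0}" by (rule finite_subset[OF tensor_vec_support[OF v]]) simp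
  then show ?thesis using v by (auto simp: tensor_algebra_def tensor_vec_def Vspace_def split: list.splits)
qed

lemma unit_carrier: "scl c (unit_fun []) \<in> carrier (tensor_algebra N)"
proof -
  have "{w. scl c (unit_fun []) w \<noteq> 0} \<subseteq> {[]}" by (auto simp: scl_def unit_fun_def)
  then have "finite {w. scl c (unit_fun []) w \<noteq> 0}" by (rule finite_subset) simp
  then show ?thesis by (auto simp: tensor_algebra_def scl_def unit_fun_def split: if_splits)
qed

lemma tensor_act_vec:
  assumes v: "v \<in> Vspace N"
  shows "tensor_act N (tensor_vec v) x = clifford_mult N v x"
proof -
  have "tensor_act N (tensor_vec v) x = (\<Sum>w\<in>(\<lambda>i. [i]) ` {1..2*N}. scl (tensor_vec v w) (word_act N w x))"
    by (rule tensor_act_finite[OF _ tensor_vec_support[OF v]]) simp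
  also have "\<dots> = (\<Sum>i=1..2*N. scl (v i) (clifford_mult N (unit_fun i) x))"
    by (subst sum.reindex) (auto simp: inj_on_def tensor_vec_def)
  also have "\<dots> = (\<Sum>i=1..2*N. clifford_mult N (scl (v i) (unit_fun i)) x)"
    by (simp add: clifford_mult_scl_vec)
  also have "\<dots> = clifford_mult N (\<Sum>i=1..2*N. scl (v i) (unit_fun i)) x"
    by (simp only: clifford_mult_sum_vec)
  also have "(\<Sum>i=1..2*N. scl (v i) (unit_fun i)) = v"
  proof
    fix k
    have "(\<Sum>i=1..2*N. scl (v i) (unit_fun i)) k = (\<Sum>i=1..2*N. scl (v i) (unit_fun i) k)"
      by (rule additive.sum[where f="\<lambda>h. h k"]) (simp add: additive_def)
    also have "\<dots> = (\<Sum>i=1..2*N. if i = k then v k else 0)"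
      by (intro sum.cong) (auto simp: scl_def unit_fun_def)
    also have "\<dots> = v k" using v by (auto simp: Vspace_def)
    finally show "(\<Sum>i=1..2*N. scl (v i) (unit_fun i)) k = v k" .
  qed
  finally show ?thesis .
qed

lemma tensor_act_unit: "tensor_act N (unit_fun []) x = x"
proof -
  have "{w. (unit_fun [] :: nat list \<Rightarrow> complex) w \<noteq> 0} = {[]}" by (auto simp: unit_fun_def)
  then show ?thesis by (simp add: tensor_act_def) (simp add: unit_fun_def)
qed

section \<open>The ideal of the Clifford relations\<close>

lemma tensor_algebra_simps:
  "\<one>\<^bsub>tensor_algebra N\<^esub> = unit_fun []" "\<zero>\<^bsub>tensor_algebra N\<^esub> = 0" "a \<oplus>\<^bsub>tensor_algebra N\<^esub> b = a + b"
  by (simp_all add: tensor_algebra_def)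

lemma tensor_algebra_uminus:
  assumes "a \<in> carrier (tensor_algebra N)"
  shows "\<ominus>\<^bsub>tensor_algebra N\<^esub> a = - a" "- a \<in> carrier (tensor_algebra N)"
proof -
  interpret ring "tensor_algebra N" by (rule ring_tensor_algebra)
  show c: "- a \<in> carrier (tensor_algebra N)" using assms by (simp add: tensor_algebra_def)
  show "\<ominus>\<^bsub>tensor_algebra N\<^esub> a = - a"
    by (rule minus_equality[OF _ assms c]) (simp add: tensor_algebra_simps)
qed

lemma tensor_algebra_minus:
  assumes "a \<in> carrier (tensor_algebra N)" "b \<in> carrier (tensor_algebra N)"
  shows "a \<ominus>\<^bsub>tensor_algebra N\<^esub> b = a - b" "a - b \<in> carrier (tensor_algebra N)"
proof -
  interpret ring "tensor_algebra N" by (rule ring_tensor_algebra)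
  show 1: "a \<ominus>\<^bsub>tensor_algebra N\<^esub> b = a - b"
    using assms by (simp add: a_minus_def tensor_algebra_uminus tensor_algebra_simps)
  show "a - b \<in> carrier (tensor_algebra N)"
    using assms minus_closed unfolding 1[symmetric] by blast
qed

lemma clifford_relation_carrier:
  "v \<in> Vspace N \<Longrightarrow> (tensor_vec v \<otimes>\<^bsub>tensor_algebra N\<^esub> tensor_vec v) - scl (quad_form N v) (unit_fun [])
     \<in> carrier (tensor_algebra N)"
  using ring.ring_simprules(5)[OF ring_tensor_algebra tensor_vec_carrier tensor_vec_carrier]
  by (intro tensor_algebra_minus unit_carrier) auto

lemma ideal_clifford_ideal: "ideal (clifford_ideal N) (tensor_algebra N)"
  unfolding clifford_ideal_def
  by (intro ring.genideal_ideal ring_tensor_algebra) (use clifford_relation_carrier in blast)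

text \<open>Serves as an induction principle: a property holds on the Clifford ideal once the
  tensors having it form an ideal that contains the relations.\<close>

lemma clifford_ideal_minimal:
  assumes "ideal J (tensor_algebra N)"
    "\<And>v. v \<in> Vspace N \<Longrightarrow>
      (tensor_vec v \<otimes>\<^bsub>tensor_algebra N\<^esub> tensor_vec v) - scl (quad_form N v) (unit_fun []) \<in> J"
  shows "clifford_ideal N \<subseteq> J"
  unfolding clifford_ideal_def
  by (intro ring.genideal_minimal ring_tensor_algebra assms(1)) (use assms(2) in blast)

lemma clifford_relation_mem:
  "v \<in> Vspace N \<Longrightarrow>
    (tensor_vec v \<otimes>\<^bsub>tensor_algebra N\<^esub> tensor_vec v) - scl (quad_form N v) (unit_fun []) \<in> clifford_ideal N"
  unfolding clifford_ideal_def
  by (rule subsetD[OF ring.genideal_self[OF ring_tensor_algebra]]) (use clifford_relation_carrier in blast)+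

lemma idealI_tensor:
  assumes "J \<subseteq> carrier (tensor_algebra N)" "0 \<in> J"
    and "\<And>a b. a \<in> J \<Longrightarrow> b \<in> J \<Longrightarrow> a + b \<in> J"
    and "\<And>a. a \<in> J \<Longrightarrow> - a \<in> J"
    and "\<And>a b. a \<in> J \<Longrightarrow> b \<in> carrier (tensor_algebra N) \<Longrightarrow> b \<otimes>\<^bsub>tensor_algebra N\<^esub> a \<in> J"
    and "\<And>a b. a \<in> J \<Longrightarrow> b \<in> carrier (tensor_algebra N) \<Longrightarrow> a \<otimes>\<^bsub>tensor_algebra N\<^esub> b \<in> J"
  shows "ideal J (tensor_algebra N)"
proof (rule idealI[OF ring_tensor_algebra])
  interpret ring "tensor_algebra N" by (rule ring_tensor_algebra)
  show "subgroup J (add_monoid (tensor_algebra N))"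
  proof (rule subgroup.intro)
    fix a assume "a \<in> J"
    then show "inv\<^bsub>add_monoid (tensor_algebra N)\<^esub> a \<in> J"
      using assms(1,4) tensor_algebra_uminus[of a N] unfolding a_inv_def by auto
  qed (use assms in \<open>simp_all add: tensor_algebra_simps\<close>)
qed (use assms in simp_all)

text \<open>Tensors acting by zero form an ideal because the action is multiplicative, and the
  relations act by zero by \<open>clifford_mult_square\<close>. This is what makes the action of the
  quotient well defined.\<close>

lemma tensor_act_clifford_ideal:
  assumes "a \<in> clifford_ideal N"
  shows "tensor_act N a x = 0"
proof -
  interpret ring "tensor_algebra N" by (rule ring_tensor_algebra)
  let ?J = "{a \<in> carrier (tensor_algebra N). \<forall>x. tensor_act N a x = 0}"
  have neg: "tensor_act N (- a) x = - tensor_act N a x" if "a \<in> carrier (tensor_algebra N)" for a x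
    using tensor_act_scl[OF that, of "-1"] by simp
  have "clifford_ideal N \<subseteq> ?J"
  proof (rule clifford_ideal_minimal)
    show "ideal ?J (tensor_algebra N)"
    proof (rule idealI_tensor)
      show "0 \<in> ?J" using zero_closed by (simp add: tensor_algebra_simps) (simp add: tensor_act_def)
      show "a + b \<in> ?J" if "a \<in> ?J" "b \<in> ?J" for a b
        using that a_closed[of a b] by (simp add: tensor_act_add tensor_algebra_simps)
    qed (auto simp: neg tensor_algebra_uminus tensor_act_mult)
    fix v assume v: "v \<in> Vspace N"
    let ?vv = "tensor_vec v \<otimes>\<^bsub>tensor_algebra N\<^esub> tensor_vec v"
    note c = tensor_vec_carrier[OF v] m_closed[OF tensor_vec_carrier[OF v] tensor_vec_carrier[OF v]]
    have "tensor_act N (?vv + - scl (quad_form N v) (unit_fun [])) x = 0" for x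
      using c v unit_carrier[of 1 N]
      by (subst tensor_act_add)
        (simp_all add: neg unit_carrier tensor_algebra_uminus tensor_act_mult tensor_act_vec
          clifford_mult_square tensor_act_scl tensor_act_unit)
    then show "?vv - scl (quad_form N v) (unit_fun []) \<in> ?J"
      using clifford_relation_carrier[OF v] by simp
  qed
  then show ?thesis using assms by blast
qed

section \<open>The spin group\<close>

abbreviation Cl :: "nat \<Rightarrow> (nat list \<Rightarrow> complex) set ring" where
  "Cl N \<equiv> clifford_algebra N"

abbreviation cvec :: "nat \<Rightarrow> (nat \<Rightarrow> complex) \<Rightarrow> (nat list \<Rightarrow> complex) set" where
  "cvec N v \<equiv> clifford_class N (tensor_vec v)"

abbreviation cscal :: "nat \<Rightarrow> complex \<Rightarrow> (nat list \<Rightarrow> complex) set" where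
  "cscal N c \<equiv> clifford_class N (scl c (unit_fun []))"

section \<open>The quotient algebra and its action on spinors\<close>

lemma ring_clifford: "ring (Cl N)"
  unfolding clifford_algebra_def by (rule ideal.quotient_is_ring[OF ideal_clifford_ideal])

lemma clifford_class_hom: "clifford_class N \<in> ring_hom (tensor_algebra N) (Cl N)"
proof -
  have "clifford_class N = (+>\<^bsub>tensor_algebra N\<^esub>) (clifford_ideal N)" by (simp add: clifford_class_def fun_eq_iff)
  then show ?thesis
    unfolding clifford_algebra_def using ideal.rcos_ring_hom[OF ideal_clifford_ideal] by simp
qed

lemma class_closed: "a \<in> carrier (tensor_algebra N) \<Longrightarrow> clifford_class N a \<in> carrier (Cl N)"
  by (rule ring_hom_closed[OF clifford_class_hom])

lemma class_mult:
  "a \<in> carrier (tensor_algebra N) \<Longrightarrow> b \<in> carrier (tensor_algebra N) \<Longrightarrow>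
    clifford_class N (a \<otimes>\<^bsub>tensor_algebra N\<^esub> b) = clifford_class N a \<otimes>\<^bsub>Cl N\<^esub> clifford_class N b"
  by (rule ring_hom_mult[OF clifford_class_hom])

lemma class_add:
  "a \<in> carrier (tensor_algebra N) \<Longrightarrow> b \<in> carrier (tensor_algebra N) \<Longrightarrow>
    clifford_class N (a + b) = clifford_class N a \<oplus>\<^bsub>Cl N\<^esub> clifford_class N b"
  using ring_hom_add[OF clifford_class_hom] by (simp add: tensor_algebra_simps)

lemma class_one: "clifford_class N (unit_fun []) = \<one>\<^bsub>Cl N\<^esub>"
  using ring_hom_one[OF clifford_class_hom] by (simp add: tensor_algebra_simps)

lemma class_eq_iff:
  assumes "a \<in> carrier (tensor_algebra N)" "b \<in> carrier (tensor_algebra N)"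
  shows "clifford_class N a = clifford_class N b \<longleftrightarrow> a - b \<in> clifford_ideal N"
  unfolding clifford_class_def
  using ring.quotient_eq_iff_same_a_r_cos[OF ring_tensor_algebra ideal_clifford_ideal assms]
  by (simp add: tensor_algebra_minus[OF assms])

lemma class_surj:
  assumes "g \<in> carrier (Cl N)"
  obtains a where "a \<in> carrier (tensor_algebra N)" "g = clifford_class N a"
  using assms unfolding clifford_algebra_def FactRing_def A_RCOSETS_def' clifford_class_def by auto

lemma class_set: "clifford_class N a = {h + a | h. h \<in> clifford_ideal N}"
  unfolding clifford_class_def a_r_coset_def' by (auto simp: tensor_algebra_simps)

lemma ideal_carrier: "h \<in> clifford_ideal N \<Longrightarrow> h \<in> carrier (tensor_algebra N)"
  using ideal.Icarr[OF ideal_clifford_ideal] .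

lemma ideal_zero: "0 \<in> clifford_ideal N"
  using additive_subgroup.zero_closed[OF ideal.axioms(1)[OF ideal_clifford_ideal]]
  by (simp add: tensor_algebra_simps)

text \<open>Elements of one coset differ by the ideal, which acts by zero, so
  \<open>the_elem\<close> in \<open>clifford_act\<close> is applied to a singleton.\<close>

lemma class_act:
  assumes a: "a \<in> carrier (tensor_algebra N)"
  shows "clifford_act N (clifford_class N a) x = tensor_act N a x"
proof -
  have "(\<lambda>a. tensor_act N a x) ` clifford_class N a = {tensor_act N a x}"
  proof
    show "(\<lambda>a. tensor_act N a x) ` clifford_class N a \<subseteq> {tensor_act N a x}"
      unfolding class_set by (auto simp: tensor_act_add[OF ideal_carrier a] tensor_act_clifford_ideal)
    have "a \<in> clifford_class N a" unfolding class_set using ideal_zero by force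
    then show "{tensor_act N a x} \<subseteq> (\<lambda>a. tensor_act N a x) ` clifford_class N a" by blast
  qed
  then show ?thesis by (simp add: clifford_act_def)
qed

lemma act_mult:
  assumes "g \<in> carrier (Cl N)" "h \<in> carrier (Cl N)"
  shows "clifford_act N (g \<otimes>\<^bsub>Cl N\<^esub> h) x = clifford_act N g (clifford_act N h x)"
proof -
  obtain a b where "a \<in> carrier (tensor_algebra N)" "g = clifford_class N a"
     "b \<in> carrier (tensor_algebra N)" "h = clifford_class N b"
    using assms class_surj by metis
  then show ?thesis
    using ring.ring_simprules(5)[OF ring_tensor_algebra, of a N b]
    by (simp add: class_mult[symmetric] class_act tensor_act_mult)
qed

lemma act_one: "clifford_act N \<one>\<^bsub>Cl N\<^esub> x = x"
  unfolding class_one[symmetric]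
  using class_act[of "unit_fun []" N] unit_carrier[of 1 N] by (simp add: tensor_act_unit)

lemma act_vec: "v \<in> Vspace N \<Longrightarrow> clifford_act N (cvec N v) x = clifford_mult N v x"
  by (simp add: class_act tensor_vec_carrier tensor_act_vec)

lemma act_add_spinor: "g \<in> carrier (Cl N) \<Longrightarrow> clifford_act N g (x + y) = clifford_act N g x + clifford_act N g y"
  by (elim class_surj) (simp add: class_act tensor_act_add_spinor)

lemma act_scl_spinor: "g \<in> carrier (Cl N) \<Longrightarrow> clifford_act N g (scl c x) = scl c (clifford_act N g x)"
  by (elim class_surj) (simp add: class_act tensor_act_scl_spinor)

lemma sum_scl_nonzero:
  assumes "(\<Sum>i\<in>A. scl (c i) (x i)) S \<noteq> 0"
  obtains i where "i \<in> A" "c i \<noteq> 0" "x i S \<noteq> 0"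
proof -
  have "(\<Sum>i\<in>A. scl (c i) (x i)) S = (\<Sum>i\<in>A. scl (c i) (x i) S)"
    by (rule additive.sum[where f="\<lambda>h. h S"]) (simp add: additive_def)
  then obtain i where "i \<in> A" "scl (c i) (x i) S \<noteq> 0"
    using assms by (metis (mono_tags, lifting) sum.not_neutral_contains_not_neutral)
  then show ?thesis using that by (auto simp: scl_def)
qed

lemma ext_alg_sum:
  assumes "\<And>i. i \<in> A \<Longrightarrow> x i \<in> ext_alg N"
  shows "(\<Sum>i\<in>A. scl (c i) (x i)) \<in> ext_alg N"
  unfolding ext_alg_def
proof (rule CollectI, intro allI impI)
  fix S assume "(\<Sum>i\<in>A. scl (c i) (x i)) S \<noteq> 0"
  then obtain i where "i \<in> A" "x i S \<noteq> 0" by (rule sum_scl_nonzero)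
  then show "S \<subseteq> {1..N}" using assms unfolding ext_alg_def by blast
qed

lemma word_act_ext_alg: "x \<in> ext_alg N \<Longrightarrow> word_act N w x \<in> ext_alg N"
  by (induction w) (simp_all add: clifford_mult_ext_alg)

lemma word_act_spinors: "x \<in> spinors N p \<Longrightarrow> word_act N w x \<in> spinors N (length w + p)"
  by (induction w) (simp_all add: clifford_mult_spinors)

lemma act_ext_alg: "g \<in> carrier (Cl N) \<Longrightarrow> x \<in> ext_alg N \<Longrightarrow> clifford_act N g x \<in> ext_alg N"
  by (elim class_surj) (simp add: class_act tensor_act_def ext_alg_sum word_act_ext_alg)

lemma act_ext_even:
  assumes g: "g \<in> clifford_even N" and x: "x \<in> ext_even N"
  shows "clifford_act N g x \<in> ext_even N"
proof -
  obtain a where a: "a \<in> carrier (tensor_algebra N)" "\<And>w. a w \<noteq> 0 \<Longrightarrow> even (length w)" "g = clifford_class N a"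
    using g by (auto simp: clifford_even_def)
  have eq: "clifford_act N g x = (\<Sum>w | a w \<noteq> 0. scl (a w) (word_act N w x))"
    by (simp add: a class_act tensor_act_def)
  have w: "word_act N w x \<in> ext_even N" if "a w \<noteq> 0" for w
    using word_act_spinors[of x N 0 w] a(2)[OF that] x by (simp add: spinors_even)
  show ?thesis unfolding ext_even_def eq
  proof (rule CollectI, intro allI impI)
    fix S assume "(\<Sum>w | a w \<noteq> 0. scl (a w) (word_act N w x)) S \<noteq> 0"
    then obtain u where "a u \<noteq> 0" "word_act N u x S \<noteq> 0" by (rule sum_scl_nonzero)
    then show "S \<subseteq> {1..N} \<and> even (card S)" using w[of u] unfolding ext_even_def by blast
  qed
qed

section \<open>The even part\<close>

lemma even_mult:
  assumes a: "a \<in> carrier (tensor_algebra N)" "\<And>w. a w \<noteq> 0 \<Longrightarrow> even (length w)"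
    and b: "\<And>w. b w \<noteq> 0 \<Longrightarrow> even (length w)"
    and w: "(a \<otimes>\<^bsub>tensor_algebra N\<^esub> b) w \<noteq> 0"
  shows "even (length w)"
proof -
  have "(\<Sum>k\<le>length w. a (take k w) * b (drop k w)) \<noteq> 0" using w by (simp add: tensor_algebra_def)
  then obtain k where "k \<le> length w" "a (take k w) \<noteq> 0" "b (drop k w) \<noteq> 0"
    by (metis (no_types, lifting) atMost_iff mult_eq_0_iff sum.neutral)
  then have "even (length (take k w))" "even (length (drop k w))" using a(2) b by blast+
  then show ?thesis by (metis append_take_drop_id even_add length_append)
qed

lemma clifford_even_closed:
  assumes "g \<in> clifford_even N" "h \<in> clifford_even N"
  shows "g \<otimes>\<^bsub>Cl N\<^esub> h \<in> clifford_even N"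
proof -
  obtain a b where a: "a \<in> carrier (tensor_algebra N)" "\<And>w. a w \<noteq> 0 \<Longrightarrow> even (length w)" "g = clifford_class N a"
    and b: "b \<in> carrier (tensor_algebra N)" "\<And>w. b w \<noteq> 0 \<Longrightarrow> even (length w)" "h = clifford_class N b"
    using assms by (auto simp: clifford_even_def)
  have "a \<otimes>\<^bsub>tensor_algebra N\<^esub> b \<in> carrier (tensor_algebra N)"
    using a b by (intro ring.ring_simprules(5)[OF ring_tensor_algebra])
  moreover have "g \<otimes>\<^bsub>Cl N\<^esub> h = clifford_class N (a \<otimes>\<^bsub>tensor_algebra N\<^esub> b)"
    using a b by (simp add: class_mult)
  ultimately show ?thesis
    unfolding clifford_even_def using even_mult[OF a(1,2) b(2)] by blast
qed

lemma clifford_even_carrier: "g \<in> clifford_even N \<Longrightarrow> g \<in> carrier (Cl N)"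
  by (auto simp: clifford_even_def class_closed)

lemma clifford_even_one: "\<one>\<^bsub>Cl N\<^esub> \<in> clifford_even N"
  unfolding class_one[symmetric] clifford_even_def using unit_carrier[of 1 N]
  by (intro imageI) (auto simp: unit_fun_def split: if_splits)

lemma monoid_clifford_even: "Group.monoid (Cl N\<lparr>carrier := clifford_even N\<rparr>)"
proof -
  interpret ring "Cl N" by (rule ring_clifford)
  show ?thesis
    by (rule Group.monoidI)
      (auto simp: clifford_even_closed clifford_even_one clifford_even_carrier m_assoc)
qed

section \<open>Reversal\<close>

lemma tensor_rev_rev [simp]: "tensor_rev (tensor_rev a) = a"
  by (simp add: tensor_rev_def)

lemma tensor_rev_add: "tensor_rev (a + b) = tensor_rev a + tensor_rev b"
  and tensor_rev_minus: "tensor_rev (a - b) = tensor_rev a - tensor_rev b"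
  and tensor_rev_uminus: "tensor_rev (- a) = - tensor_rev a"
  and tensor_rev_zero: "tensor_rev 0 = 0"
  and tensor_rev_scl: "tensor_rev (scl c a) = scl c (tensor_rev a)"
  by (auto simp: tensor_rev_def scl_def)

lemma tensor_rev_unit: "tensor_rev (unit_fun []) = unit_fun []"
  by (auto simp: tensor_rev_def unit_fun_def)

lemma tensor_rev_vec: "tensor_rev (tensor_vec v) = tensor_vec v"
proof
  fix w show "tensor_rev (tensor_vec v) w = tensor_vec v w"
    unfolding tensor_rev_def tensor_vec_def
    by (cases w rule: rev_cases; cases w; cases "tl w") (auto split: list.splits)
qed

lemma tensor_rev_carrier: "a \<in> carrier (tensor_algebra N) \<Longrightarrow> tensor_rev a \<in> carrier (tensor_algebra N)"
proof -
  assume a: "a \<in> carrier (tensor_algebra N)"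
  have "{w. a (rev w) \<noteq> 0} = rev -` {w. a w \<noteq> 0}" by auto
  moreover have "finite (rev -` {w. a w \<noteq> 0})"
    using a by (intro finite_vimageI) (auto simp: tensor_algebra_def)
  ultimately have "finite {w. a (rev w) \<noteq> 0}" by simp
  moreover have "set w \<subseteq> {1..2*N}" if "a (rev w) \<noteq> 0" for w
    using a that set_rev[of w] by (auto simp del: set_rev simp: tensor_algebra_def)
  ultimately show ?thesis by (simp add: tensor_algebra_def tensor_rev_def)
qed

lemma tensor_rev_mult:
  "tensor_rev (a \<otimes>\<^bsub>tensor_algebra N\<^esub> b) = tensor_rev b \<otimes>\<^bsub>tensor_algebra N\<^esub> tensor_rev a"
proof
  fix w
  have "(\<Sum>k\<le>length w. a (take k (rev w)) * b (drop k (rev w)))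
      = (\<Sum>k\<le>length w. b (rev (take k w)) * a (rev (drop k w)))"
    by (rule sum.reindex_bij_witness[where i = "\<lambda>k. length w - k" and j = "\<lambda>k. length w - k"])
      (auto simp: take_rev drop_rev)
  then show "tensor_rev (a \<otimes>\<^bsub>tensor_algebra N\<^esub> b) w = (tensor_rev b \<otimes>\<^bsub>tensor_algebra N\<^esub> tensor_rev a) w"
    by (simp add: tensor_rev_def tensor_algebra_def)
qed

lemma tensor_rev_ideal:
  assumes "a \<in> clifford_ideal N"
  shows "tensor_rev a \<in> clifford_ideal N"
proof -
  interpret I: ideal "clifford_ideal N" "tensor_algebra N" by (rule ideal_clifford_ideal)
  let ?J = "{a \<in> carrier (tensor_algebra N). tensor_rev a \<in> clifford_ideal N}"
  have "clifford_ideal N \<subseteq> ?J"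
  proof (rule clifford_ideal_minimal)
    show "ideal ?J (tensor_algebra N)"
    proof (rule idealI_tensor)
      show "0 \<in> ?J" using I.zero_closed by (simp add: tensor_rev_zero ideal_zero tensor_algebra_simps)
      show "a + b \<in> ?J" if "a \<in> ?J" "b \<in> ?J" for a b
        using that ring.ring_simprules(1)[OF ring_tensor_algebra, of a N b]
          additive_subgroup.a_closed[OF ideal.axioms(1)[OF ideal_clifford_ideal], of "tensor_rev a" N "tensor_rev b"] by (simp add: tensor_rev_add tensor_algebra_simps)
      show "- a \<in> ?J" if "a \<in> ?J" for a
        using that additive_subgroup.a_inv_closed[OF ideal.axioms(1)[OF ideal_clifford_ideal], of "tensor_rev a" N]
        by (simp add: tensor_rev_uminus tensor_algebra_uminus tensor_rev_carrier)
    qed (auto simp: tensor_rev_mult tensor_rev_carrier I.I_l_closed I.I_r_closed)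
    fix v assume v: "v \<in> Vspace N"
    then show "(tensor_vec v \<otimes>\<^bsub>tensor_algebra N\<^esub> tensor_vec v) - scl (quad_form N v) (unit_fun []) \<in> ?J"
      using clifford_relation_carrier[OF v] clifford_relation_mem[OF v]
      by (simp add: tensor_rev_minus tensor_rev_mult tensor_rev_vec tensor_rev_scl tensor_rev_unit)
  qed
  then show ?thesis using assms by blast
qed

lemma clifford_rev_class: "clifford_rev (clifford_class N a) = clifford_class N (tensor_rev a)"
proof -
  have "\<exists>h'. h + tensor_rev a = tensor_rev (h' + a) \<and> h' \<in> clifford_ideal N" if "h \<in> clifford_ideal N" for h
    using that tensor_rev_ideal by (intro exI[of _ "tensor_rev h"]) (simp add: tensor_rev_add)
  then show ?thesis
    unfolding clifford_rev_def class_set by (fastforce simp: tensor_rev_add tensor_rev_ideal)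
qed

lemma clifford_rev_mult:
  assumes "g \<in> carrier (Cl N)" "h \<in> carrier (Cl N)"
  shows "clifford_rev (g \<otimes>\<^bsub>Cl N\<^esub> h) = clifford_rev h \<otimes>\<^bsub>Cl N\<^esub> clifford_rev g"
proof -
  obtain a b where "a \<in> carrier (tensor_algebra N)" "g = clifford_class N a"
     "b \<in> carrier (tensor_algebra N)" "h = clifford_class N b"
    using assms class_surj by metis
  then show ?thesis
    by (simp add: class_mult[symmetric] clifford_rev_class tensor_rev_mult tensor_rev_carrier)
qed

lemma clifford_rev_closed: "g \<in> carrier (Cl N) \<Longrightarrow> clifford_rev g \<in> carrier (Cl N)"
  by (metis class_surj clifford_rev_class tensor_rev_carrier class_closed)

lemma tensor_scal_mult: "scl c (unit_fun []) \<otimes>\<^bsub>tensor_algebra N\<^esub> a = scl c a"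
proof
  fix w
  have "(scl c (unit_fun []) \<otimes>\<^bsub>tensor_algebra N\<^esub> a) w = (\<Sum>k\<le>length w. scl c (unit_fun []) (take k w) * a (drop k w))"
    by (simp add: tensor_algebra_def)
  also have "\<dots> = (\<Sum>k\<le>length w. if k = 0 then c * a w else 0)"
    by (rule sum.cong) (auto simp: unit_fun_def scl_def)
  finally show "(scl c (unit_fun []) \<otimes>\<^bsub>tensor_algebra N\<^esub> a) w = scl c a w" by (simp add: scl_def)
qed

section \<open>Vectors inside the Clifford algebra\<close>

lemma tensor_vec_add: "tensor_vec (u + v) = tensor_vec u + tensor_vec v"
  and tensor_vec_scl: "tensor_vec (scl c v) = scl c (tensor_vec v)"
  by (auto simp: tensor_vec_def scl_def fun_eq_iff split: list.splits)

lemma cvec_closed: "v \<in> Vspace N \<Longrightarrow> cvec N v \<in> carrier (Cl N)"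
  by (intro class_closed tensor_vec_carrier)

lemma cvec_square: "v \<in> Vspace N \<Longrightarrow> cvec N v \<otimes>\<^bsub>Cl N\<^esub> cvec N v = cscal N (quad_form N v)"
  using class_eq_iff[of "tensor_vec v \<otimes>\<^bsub>tensor_algebra N\<^esub> tensor_vec v" N "scl (quad_form N v) (unit_fun [])"]
    ring.ring_simprules(5)[OF ring_tensor_algebra, of "tensor_vec v" N "tensor_vec v"]
  by (simp add: clifford_relation_mem tensor_vec_carrier unit_carrier class_mult)

lemma cscal_add: "cscal N (c + d) = cscal N c \<oplus>\<^bsub>Cl N\<^esub> cscal N d"
  by (simp add: class_add[symmetric] unit_carrier cfun.scale_left_distrib)

lemma cscal_cvec: "v \<in> Vspace N \<Longrightarrow> cscal N c \<otimes>\<^bsub>Cl N\<^esub> cvec N v = cvec N (scl c v)"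
  by (simp add: class_mult[symmetric] unit_carrier tensor_vec_carrier tensor_scal_mult tensor_vec_scl)

lemma cvec_add: "u \<in> Vspace N \<Longrightarrow> v \<in> Vspace N \<Longrightarrow> cvec N (u + v) = cvec N u \<oplus>\<^bsub>Cl N\<^esub> cvec N v"
  by (simp add: class_add tensor_vec_carrier tensor_vec_add)

text \<open>Polarization of \<open>cvec_square\<close> at \<open>u + v\<close>; the two squares are
  cancelled in the additive group.\<close>

lemma cvec_anticommute:
  assumes "u \<in> Vspace N" "v \<in> Vspace N"
  shows "cvec N u \<otimes>\<^bsub>Cl N\<^esub> cvec N v \<oplus>\<^bsub>Cl N\<^esub> cvec N v \<otimes>\<^bsub>Cl N\<^esub> cvec N u = cscal N (bil N u v)"
proof -
  interpret ring "Cl N" by (rule ring_clifford)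
  let ?u = "cvec N u" and ?v = "cvec N v" and ?m = "\<lambda>x y. x \<otimes>\<^bsub>Cl N\<^esub> y"
  note c = assms[THEN cvec_closed]
  have k: "cscal N z \<in> carrier (Cl N)" for z by (intro class_closed unit_carrier)
  have "(?m ?u ?v \<oplus>\<^bsub>Cl N\<^esub> ?m ?v ?u) \<oplus>\<^bsub>Cl N\<^esub> (?m ?u ?u \<oplus>\<^bsub>Cl N\<^esub> ?m ?v ?v)
      = ?m (?u \<oplus>\<^bsub>Cl N\<^esub> ?v) (?u \<oplus>\<^bsub>Cl N\<^esub> ?v)"
    using c by (simp add: l_distr r_distr a_ac)
  also have "\<dots> = cscal N (quad_form N (u + v))"
    using assms by (simp add: cvec_add[symmetric] cvec_square Vspace_add)
  also have "\<dots> = cscal N (bil N u v) \<oplus>\<^bsub>Cl N\<^esub> (?m ?u ?u \<oplus>\<^bsub>Cl N\<^esub> ?m ?v ?v)"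
    using assms k by (simp add: quad_form_add cscal_add cvec_square a_ac)
  finally show ?thesis
    using c k by (subst (asm) add.right_cancel) auto
qed

lemma cvec_unit_square: "u \<in> Vspace N \<Longrightarrow> quad_form N u = 1 \<Longrightarrow> cvec N u \<otimes>\<^bsub>Cl N\<^esub> cvec N u = \<one>\<^bsub>Cl N\<^esub>"
  by (simp add: cvec_square class_one)

text \<open>Conjugation by a vector of square one is minus the reflection in it: moving
  \<open>u\<close> past \<open>v\<close> yields the scalar \<open>bil N u v\<close> and a
  sign.\<close>

lemma cvec_conj:
  assumes u: "u \<in> Vspace N" "quad_form N u = 1" and v: "v \<in> Vspace N"
  shows "cvec N u \<otimes>\<^bsub>Cl N\<^esub> cvec N v \<otimes>\<^bsub>Cl N\<^esub> cvec N u = cvec N (scl (bil N u v) u - v)"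
proof -
  interpret ring "Cl N" by (rule ring_clifford)
  let ?u = "cvec N u" and ?v = "cvec N v" and ?m = "\<lambda>x y. x \<otimes>\<^bsub>Cl N\<^esub> y"
  let ?w = "scl (bil N u v) u - v"
  note c = cvec_closed[OF u(1)] cvec_closed[OF v]
  have w: "?w \<in> Vspace N" using u v by (intro Vspace_diff Vspace_scl)
  have "?m (?m ?u ?v) ?u \<oplus>\<^bsub>Cl N\<^esub> ?v = ?m (?m ?u ?v) ?u \<oplus>\<^bsub>Cl N\<^esub> ?m (?m ?v ?u) ?u"
    using c by (simp add: m_assoc cvec_unit_square u)
  also have "\<dots> = ?m (?m ?u ?v \<oplus>\<^bsub>Cl N\<^esub> ?m ?v ?u) ?u" using c by (simp add: l_distr)
  also have "\<dots> = cvec N (scl (bil N u v) u)" using u v by (simp add: cvec_anticommute cscal_cvec)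
  also have "\<dots> = cvec N ?w \<oplus>\<^bsub>Cl N\<^esub> ?v" using w v by (simp add: cvec_add[symmetric])
  finally show ?thesis using c cvec_closed[OF w] by (subst (asm) add.right_cancel) auto
qed

section \<open>Elements of the spin group\<close>

lemma Spin_even: "g \<in> Spin N \<Longrightarrow> g \<in> clifford_even N"
  by (auto simp: Spin_def Units_def)

lemma Spin_carrier: "g \<in> Spin N \<Longrightarrow> g \<in> carrier (Cl N)"
  using Spin_even clifford_even_carrier by blast

lemma Spin_Units: "g \<in> Spin N \<Longrightarrow> g \<in> Units (Cl N)"
  by (auto simp: Spin_def Units_def dest: clifford_even_carrier)

lemma Spin_conj: "g \<in> Spin N \<Longrightarrow>
  (\<lambda>v. g \<otimes>\<^bsub>Cl N\<^esub> v \<otimes>\<^bsub>Cl N\<^esub> inv\<^bsub>Cl N\<^esub> g) ` clifford_vectors N = clifford_vectors N"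
  by (simp add: Spin_def)

lemma clifford_vectors_eq: "clifford_vectors N = cvec N ` Vspace N"
  by (simp add: clifford_vectors_def image_image)

lemma clifford_vectors_carrier: "v \<in> clifford_vectors N \<Longrightarrow> v \<in> carrier (Cl N)"
  by (auto simp: clifford_vectors_eq cvec_closed)

lemma clifford_vectors_conj:
  assumes u: "u \<in> Vspace N" "quad_form N u = 1"
  shows "(\<lambda>v. cvec N u \<otimes>\<^bsub>Cl N\<^esub> v \<otimes>\<^bsub>Cl N\<^esub> cvec N u) ` clifford_vectors N = clifford_vectors N"
proof -
  interpret ring "Cl N" by (rule ring_clifford)
  let ?f = "\<lambda>v. cvec N u \<otimes>\<^bsub>Cl N\<^esub> v \<otimes>\<^bsub>Cl N\<^esub> cvec N u"
  have sub: "?f ` clifford_vectors N \<subseteq> clifford_vectors N"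
    using u by (auto simp: clifford_vectors_eq cvec_conj Vspace_diff Vspace_scl)
  have "?f (?f v) = v" if "v \<in> clifford_vectors N" for v
  proof -
    note c = clifford_vectors_carrier[OF that] cvec_closed[OF u(1)]
    have "?f (?f v) = (cvec N u \<otimes>\<^bsub>Cl N\<^esub> cvec N u) \<otimes>\<^bsub>Cl N\<^esub> v \<otimes>\<^bsub>Cl N\<^esub> (cvec N u \<otimes>\<^bsub>Cl N\<^esub> cvec N u)"
      using c by (simp add: m_assoc)
    then show ?thesis using c u by (simp add: cvec_unit_square)
  qed
  then show ?thesis using sub by (metis (no_types, lifting) image_eqI subset_antisym subsetI image_subset_iff)
qed

text \<open>The source of all nontrivial group elements constructed here. The product in the
  opposite order is both the inverse and the reversal, and conjugation is a composition of two maps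
  preserving the vectors.\<close>

lemma Spin_mult_unit_vectors:
  assumes u: "u \<in> Vspace N" "quad_form N u = 1" and w: "w \<in> Vspace N" "quad_form N w = 1"
  shows "cvec N w \<otimes>\<^bsub>Cl N\<^esub> cvec N u \<in> Spin N"
proof -
  interpret ring "Cl N" by (rule ring_clifford)
  let ?u = "cvec N u" and ?w = "cvec N w" and ?m = "\<lambda>x y. x \<otimes>\<^bsub>Cl N\<^esub> y"
  note c = cvec_closed[OF u(1)] cvec_closed[OF w(1)]
  have prod: "?m (?m (cvec N w) (cvec N u)) (?m (cvec N u) (cvec N w)) = \<one>\<^bsub>Cl N\<^esub>"
    if "u \<in> Vspace N" "quad_form N u = 1" "w \<in> Vspace N" "quad_form N w = 1" for u w
  proof -
    note c = cvec_closed[OF that(1)] cvec_closed[OF that(3)]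
    have "?m (?m (cvec N w) (cvec N u)) (?m (cvec N u) (cvec N w))
        = ?m (cvec N w) (?m (?m (cvec N u) (cvec N u)) (cvec N w))"
      using c by (simp only: m_assoc m_closed)
    also have "\<dots> = \<one>\<^bsub>Cl N\<^esub>" using c that by (simp add: cvec_unit_square)
    finally show ?thesis .
  qed
  have even: "?m (cvec N w) (cvec N u) \<in> clifford_even N" if "u \<in> Vspace N" "w \<in> Vspace N" for u w
  proof -
    let ?a = "tensor_vec w \<otimes>\<^bsub>tensor_algebra N\<^esub> tensor_vec u"
    have "even (length x)" if "?a x \<noteq> 0" for x
    proof -
      have "(\<Sum>k\<le>length x. tensor_vec w (take k x) * tensor_vec u (drop k x)) \<noteq> 0"
        using that by (simp add: tensor_algebra_def)
      then obtain k where "tensor_vec w (take k x) \<noteq> 0" "tensor_vec u (drop k x) \<noteq> 0"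
        by (metis (no_types, lifting) mult_eq_0_iff sum.neutral)
      then have "length (take k x) = 1" "length (drop k x) = 1"
        by (auto simp: tensor_vec_def simp del: length_take length_drop split: list.splits)
      then have "length x = 2" by (metis append_take_drop_id length_append one_add_one)
      then show ?thesis by simp
    qed
    moreover have "?a \<in> carrier (tensor_algebra N)"
      using that by (intro ring.ring_simprules(5)[OF ring_tensor_algebra] tensor_vec_carrier)
    moreover have "?m (cvec N w) (cvec N u) = clifford_class N ?a"
      using that by (simp add: class_mult tensor_vec_carrier)
    ultimately show ?thesis unfolding clifford_even_def by blast
  qed
  have inv: "inv\<^bsub>Cl N\<^esub> (?m ?w ?u) = ?m ?u ?w"
    using c prod[OF u w] prod[OF w u] by (intro inv_char) auto
  have "(\<lambda>v. ?m (?m (?m ?w ?u) v) (?m ?u ?w)) ` clifford_vectors N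
      = (\<lambda>v. ?m (?m ?w v) ?w) ` ((\<lambda>v. ?m (?m ?u v) ?u) ` clifford_vectors N)"
    unfolding image_image using c by (intro image_cong refl) (simp add: m_assoc clifford_vectors_carrier)
  then have conj: "(\<lambda>v. ?m (?m (?m ?w ?u) v) (?m ?u ?w)) ` clifford_vectors N = clifford_vectors N"
    using clifford_vectors_conj[OF u] clifford_vectors_conj[OF w] by simp
  have rev: "clifford_rev (?m ?w ?u) = ?m ?u ?w"
    using c by (simp add: clifford_rev_mult clifford_rev_class tensor_rev_vec)
  have "?m ?w ?u \<in> Units (Cl N\<lparr>carrier := clifford_even N\<rparr>)"
    unfolding Units_def using even u w prod[OF u w] prod[OF w u] by auto
  then show ?thesis unfolding Spin_def using inv conj rev prod[OF u w] by simp
qed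

lemma Spin_mult:
  assumes g: "g \<in> Spin N" and h: "h \<in> Spin N"
  shows "g \<otimes>\<^bsub>Cl N\<^esub> h \<in> Spin N"
proof -
  interpret ring "Cl N" by (rule ring_clifford)
  let ?m = "\<lambda>x y. x \<otimes>\<^bsub>Cl N\<^esub> y" and ?i = "\<lambda>x. inv\<^bsub>Cl N\<^esub> x"
  note c = Spin_carrier[OF g] Spin_carrier[OF h]
  note U = Spin_Units[OF g] Spin_Units[OF h]
  have ci: "?i g \<in> carrier (Cl N)" "?i h \<in> carrier (Cl N)" using U by auto
  have "g \<in> Units (Cl N\<lparr>carrier := clifford_even N\<rparr>)" "h \<in> Units (Cl N\<lparr>carrier := clifford_even N\<rparr>)"
    using g h by (auto simp: Spin_def)
  from monoid.Units_m_closed[OF monoid_clifford_even this]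
  have units: "?m g h \<in> Units (Cl N\<lparr>carrier := clifford_even N\<rparr>)" by simp
  have inv: "?i (?m g h) = ?m (?i h) (?i g)"
  proof (rule inv_char)
    have "?m (?m g h) (?m (?i h) (?i g)) = ?m g (?m (?m h (?i h)) (?i g))" using c ci by (simp add: m_assoc)
    then show "?m (?m g h) (?m (?i h) (?i g)) = \<one>\<^bsub>Cl N\<^esub>" using c ci U by simp
    have "?m (?m (?i h) (?i g)) (?m g h) = ?m (?i h) (?m (?m (?i g) g) h)" using c ci by (simp add: m_assoc)
    then show "?m (?m (?i h) (?i g)) (?m g h) = \<one>\<^bsub>Cl N\<^esub>" using c ci U by simp
  qed (use c ci in simp_all)
  have "(\<lambda>v. ?m (?m (?m g h) v) (?m (?i h) (?i g))) ` clifford_vectors N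
      = (\<lambda>v. ?m (?m g v) (?i g)) ` ((\<lambda>v. ?m (?m h v) (?i h)) ` clifford_vectors N)"
    unfolding image_image using c ci by (intro image_cong refl) (simp add: m_assoc clifford_vectors_carrier)
  then have conj: "(\<lambda>v. ?m (?m (?m g h) v) (?m (?i h) (?i g))) ` clifford_vectors N = clifford_vectors N"
    by (simp add: Spin_conj g h)
  have one: "?m g (clifford_rev g) = \<one>\<^bsub>Cl N\<^esub>" "?m h (clifford_rev h) = \<one>\<^bsub>Cl N\<^esub>"
    using g h by (auto simp: Spin_def)
  have "?m (?m g h) (?m (clifford_rev h) (clifford_rev g)) = ?m g (?m (?m h (clifford_rev h)) (clifford_rev g))"
    using c by (simp add: m_assoc clifford_rev_closed)
  then have "?m (?m g h) (clifford_rev (?m g h)) = \<one>\<^bsub>Cl N\<^esub>"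
    using c one by (simp add: clifford_rev_mult clifford_rev_closed)
  then show ?thesis unfolding Spin_def using units inv conj by simp
qed

lemma Spin_one: "\<one>\<^bsub>Cl N\<^esub> \<in> Spin N"
proof -
  interpret ring "Cl N" by (rule ring_clifford)
  have "clifford_rev \<one>\<^bsub>Cl N\<^esub> = \<one>\<^bsub>Cl N\<^esub>"
    unfolding class_one[symmetric] by (simp add: clifford_rev_class tensor_rev_unit)
  moreover have "(\<lambda>v. \<one>\<^bsub>Cl N\<^esub> \<otimes>\<^bsub>Cl N\<^esub> v \<otimes>\<^bsub>Cl N\<^esub> inv\<^bsub>Cl N\<^esub> \<one>\<^bsub>Cl N\<^esub>) ` clifford_vectors N
      = (\<lambda>v. v) ` clifford_vectors N"
    by (intro image_cong refl) (simp add: clifford_vectors_carrier)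
  moreover have "\<one>\<^bsub>Cl N\<^esub> \<in> Units (Cl N\<lparr>carrier := clifford_even N\<rparr>)"
    using monoid.Units_one_closed[OF monoid_clifford_even] by simp
  ultimately show ?thesis by (simp add: Spin_def)
qed

lemma Spin_inverse:
  assumes g: "g \<in> Spin N"
  shows "inv\<^bsub>Cl N\<^esub> g \<in> Spin N"
proof -
  interpret ring "Cl N" by (rule ring_clifford)
  let ?m = "\<lambda>x y. x \<otimes>\<^bsub>Cl N\<^esub> y" and ?i = "\<lambda>x. inv\<^bsub>Cl N\<^esub> x"
  note c = Spin_carrier[OF g] and U = Spin_Units[OF g]
  obtain h where h: "h \<in> clifford_even N" "?m h g = \<one>\<^bsub>Cl N\<^esub>" "?m g h = \<one>\<^bsub>Cl N\<^esub>"
    using g by (auto simp: Spin_def Units_def)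
  have ig: "?i g = h" using c h clifford_even_carrier by (intro inv_char) auto
  note ch = clifford_even_carrier[OF h(1)]
  have ih: "?i h = g" using c h ch by (intro inv_char) auto
  \<comment> \<open>By the defining equation of the group the reversal is a right inverse of the
    unit \<open>g\<close>, hence equal to \<open>h\<close>.\<close>
  have "clifford_rev g = ?m h (?m g (clifford_rev g))"
    using c ch h clifford_rev_closed[OF c] by (simp add: m_assoc[symmetric])
  also have "\<dots> = h" using g ch by (simp add: Spin_def)
  finally have "clifford_rev g = h" .
  then have rev: "clifford_rev h = g" by (auto simp: clifford_rev_def image_image)
  have "(\<lambda>v. ?m (?m h v) g) ` clifford_vectors N
      = (\<lambda>v. ?m (?m h v) g) ` ((\<lambda>v. ?m (?m g v) h) ` clifford_vectors N)"
    using Spin_conj[OF g] by (simp add: ig)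
  also have "\<dots> = (\<lambda>v. v) ` clifford_vectors N"
    unfolding image_image
  proof (intro image_cong refl)
    fix v assume "v \<in> clifford_vectors N"
    then have v: "v \<in> carrier (Cl N)" by (rule clifford_vectors_carrier)
    have "?m (?m h (?m (?m g v) h)) g = ?m (?m (?m h g) v) (?m h g)" using c ch v by (simp only: m_assoc m_closed)
    then show "?m (?m h (?m (?m g v) h)) g = v" using v h by simp
  qed
  finally have conj: "(\<lambda>v. ?m (?m h v) g) ` clifford_vectors N = clifford_vectors N" by simp
  have "h \<in> Units (Cl N\<lparr>carrier := clifford_even N\<rparr>)"
    using h Spin_even[OF g] by (auto simp: Units_def)
  then show ?thesis unfolding ig Spin_def using conj ih rev h by simp
qed

lemma Spin_act_inverse:
  assumes "g \<in> Spin N"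
  shows "clifford_act N (inv\<^bsub>Cl N\<^esub> g) (clifford_act N g x) = x"
    and "clifford_act N g (clifford_act N (inv\<^bsub>Cl N\<^esub> g) x) = x"
proof -
  interpret ring "Cl N" by (rule ring_clifford)
  show "clifford_act N (inv\<^bsub>Cl N\<^esub> g) (clifford_act N g x) = x"
    "clifford_act N g (clifford_act N (inv\<^bsub>Cl N\<^esub> g) x) = x"
    using Spin_Units[OF assms] Spin_carrier[OF assms] Units_inv_closed[OF Spin_Units[OF assms]]
    by (simp_all add: act_mult[symmetric] act_one del: Units_inv_closed)
qed

lemma Spin_act_vector:
  assumes g: "g \<in> Spin N" and v: "v \<in> Vspace N" "v' \<in> Vspace N"
    and eq: "cvec N v' = g \<otimes>\<^bsub>Cl N\<^esub> cvec N v \<otimes>\<^bsub>Cl N\<^esub> inv\<^bsub>Cl N\<^esub> g"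
  shows "clifford_mult N v' (clifford_act N g y) = clifford_act N g (clifford_mult N v y)"
proof -
  interpret ring "Cl N" by (rule ring_clifford)
  note c = Spin_carrier[OF g] cvec_closed[OF v(1)]
  have "cvec N v' \<otimes>\<^bsub>Cl N\<^esub> g = g \<otimes>\<^bsub>Cl N\<^esub> cvec N v"
    unfolding eq using c Spin_Units[OF g] by (simp add: m_assoc)
  then have "clifford_act N (cvec N v') (clifford_act N g y) = clifford_act N g (clifford_act N (cvec N v) y)"
    using c cvec_closed[OF v(2)] by (metis act_mult)
  then show ?thesis using v by (simp add: act_vec)
qed

lemma Spin_vector_forward:
  assumes g: "g \<in> Spin N" and v: "v \<in> Vspace N"
  shows "\<exists>v' \<in> Vspace N. \<forall>y. clifford_mult N v' (clifford_act N g y) = clifford_act N g (clifford_mult N v y)"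
proof -
  have "g \<otimes>\<^bsub>Cl N\<^esub> cvec N v \<otimes>\<^bsub>Cl N\<^esub> inv\<^bsub>Cl N\<^esub> g \<in> clifford_vectors N"
    using Spin_conj[OF g] v by (auto simp: clifford_vectors_eq)
  then show ?thesis using Spin_act_vector[OF g v] by (auto simp: clifford_vectors_eq)
qed

text \<open>Needs that conjugation by \<open>g\<close> maps onto the vectors, not merely into
  them.\<close>

lemma Spin_vector_backward:
  assumes g: "g \<in> Spin N" and v': "v' \<in> Vspace N"
  shows "\<exists>v \<in> Vspace N. \<forall>y. clifford_mult N v' (clifford_act N g y) = clifford_act N g (clifford_mult N v y)"
proof -
  have "cvec N v' \<in> (\<lambda>v. g \<otimes>\<^bsub>Cl N\<^esub> v \<otimes>\<^bsub>Cl N\<^esub> inv\<^bsub>Cl N\<^esub> g) ` clifford_vectors N"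
    using Spin_conj[OF g] v' by (auto simp: clifford_vectors_eq)
  then show ?thesis using Spin_act_vector[OF g _ v'] by (auto simp: clifford_vectors_eq)
qed

lemma pure_Spin:
  assumes g: "g \<in> Spin N" and x: "pure_spinor N x"
  shows "pure_spinor N (clifford_act N g x)"
proof -
  interpret ring "Cl N" by (rule ring_clifford)
  show ?thesis
  proof (rule pure_transfer[where T = "clifford_act N g" and T' = "clifford_act N (inv\<^bsub>Cl N\<^esub> g)" and s = 1])
  qed (use g x Spin_vector_forward[OF g] Spin_vector_backward[OF g] Spin_Units[OF g] in
      \<open>simp_all add: act_add_spinor act_scl_spinor Spin_carrier Spin_act_inverse act_ext_alg\<close>)
qed

section \<open>The spinor variety and its lines\<close>

lemma clifford_mult_unit:
  "k \<in> {1..2*N} \<Longrightarrow> clifford_mult N (unit_fun k) x = gen_op N k x"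
  by (auto simp: fun_eq_iff clifford_mult_gen_op unit_fun_def if_distrib[of "\<lambda>c. c * _"] sum.delta cong: if_cong)

lemma bil_unit:
  "k \<in> {1..N} \<Longrightarrow> bil N v (unit_fun k) = v (N + k)"
  "k \<in> {1..N} \<Longrightarrow> bil N v (unit_fun (N + k)) = v k"
proof -
  assume k: "k \<in> {1..N}"
  have "bil N v (unit_fun k) = (\<Sum>j=1..N. if j = k then v (N + k) else 0)"
    unfolding bil_def using k by (intro sum.cong) (auto simp: unit_fun_def)
  then show "bil N v (unit_fun k) = v (N + k)" using k by simp
  have "bil N v (unit_fun (N + k)) = (\<Sum>j=1..N. if j = k then v k else 0)"
    unfolding bil_def using k by (intro sum.cong) (auto simp: unit_fun_def)
  then show "bil N v (unit_fun (N + k)) = v k" using k by simp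
qed

text \<open>The annihilator is E: the coordinate of \<open>v\<close> at \<open>f_k\<close> appears,
  up to sign, as the coefficient of the product at \<open>{1..N} - {k}\<close>. A spinor killed by E
  is a multiple of the top form, because a coefficient at a set missing \<open>k\<close> would
  survive the wedge with \<open>e_k\<close>.\<close>

lemma pure_top: "pure_spinor N (ext_basis {1..N})"
proof -
  let ?t = "ext_basis {1..N}"
  have 1: "gen_op N k ?t = 0" if "k \<in> {1..N}" for k
  proof
    fix S
    have "S - {k} \<noteq> {1..N}" using that by blast
    then show "gen_op N k ?t S = 0 S" using that by (simp add: gen_op_def unit_fun_def)
  qed
  have 2: "gen_op N (N + k) ?t S = (if S = {1..N} - {k} then sgn_at k S else 0)" if k: "k \<in> {1..N}" for k S
  proof -
    have "insert k S = {1..N} \<longleftrightarrow> S = {1..N} - {k}" if "k \<notin> S" using k that by blast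
    then show ?thesis using k by (cases "k \<in> S") (auto simp: gen_op_def unit_fun_def simp del: insert_Diff_single)
  qed
  have mult: "clifford_mult N v ?t S = (\<Sum>k=1..N. v (N + k) * (if S = {1..N} - {k} then sgn_at k S else 0))" for v S
    unfolding clifford_mult_gen_op by (subst sum_two_halves) (simp add: 1 2 del: One_nat_def)
  have Ann: "v \<in> Ann N ?t \<longleftrightarrow> v \<in> Vspace N \<and> (\<forall>k\<in>{1..N}. v (N + k) = 0)" for v
  proof -
    have "v (N + k) = 0" if "clifford_mult N v ?t = 0" "k \<in> {1..N}" for k
    proof -
      have "(\<Sum>j=1..N. v (N + j) * (if {1..N} - {k} = {1..N} - {j} then sgn_at j ({1..N} - {k}) else 0))
         = (\<Sum>j=1..N. if j = k then v (N + k) * sgn_at k ({1..N} - {k}) else 0)"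
      proof (intro sum.cong refl)
        fix j assume "j \<in> {1..N}"
        then have "{1..N} - {k} = {1..N} - {j} \<longleftrightarrow> j = k" using that(2) by blast
        then show "v (N + j) * (if {1..N} - {k} = {1..N} - {j} then sgn_at j ({1..N} - {k}) else 0)
          = (if j = k then v (N + k) * sgn_at k ({1..N} - {k}) else 0)" by simp
      qed
      then show ?thesis
        using mult[of v "{1..N} - {k}"] that by (simp add: sgn_at_nonzero)
    qed
    moreover have "clifford_mult N v ?t = 0" if "\<forall>k\<in>{1..N}. v (N + k) = 0"
      using that by (auto simp: fun_eq_iff mult simp del: One_nat_def)
    ultimately show ?thesis by (auto simp: Ann_def)
  qed
  have unit: "unit_fun k \<in> Ann N ?t" if "k \<in> {1..N}" for k
    unfolding Ann using that by (auto simp: Vspace_unit) (auto simp: unit_fun_def)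
  show ?thesis
    unfolding pure_spinor_def
  proof (intro conjI ballI impI)
    show "?t \<noteq> 0" by (auto simp: fun_eq_iff unit_fun_def)
    show "?t \<in> ext_alg N" by (auto simp: ext_alg_def unit_fun_def split: if_splits)
    fix v assume "v \<in> Vspace N" "\<forall>w\<in>Ann N ?t. bil N v w = 0"
    then show "v \<in> Ann N ?t" unfolding Ann[of v] using unit bil_unit(1)[of _ N v] by metis
  next
    fix y assume y: "y \<in> ext_alg N" "\<forall>w\<in>Ann N ?t. clifford_mult N w y = 0"
    have "y S = 0" if S: "S \<noteq> {1..N}" for S
    proof (rule ccontr)
      assume nz: "y S \<noteq> 0"
      then have "S \<subseteq> {1..N}" using y(1) unfolding ext_alg_def by blast
      then obtain k where k: "k \<in> {1..N}" "k \<notin> S" using S by blast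
      have "gen_op N k y (insert k S) = 0"
        using y(2) unit[OF k(1)] clifford_mult_unit[of k N y] k by (auto simp: fun_eq_iff)
      then show False using k nz by (simp add: gen_op_def sgn_at_nonzero insert_absorb)
    qed
    then have "y = scl (y {1..N}) ?t" by (auto simp: scl_def unit_fun_def)
    then show "y \<in> pt ?t" using pt_iff by blast
  qed
qed

text \<open>Nonzero representatives instead of projective points, so that sums and products with
  vectors can be formed.\<close>

definition in_cone :: "nat \<Rightarrow> (nat set \<Rightarrow> complex) \<Rightarrow> bool" where
  "in_cone N x \<longleftrightarrow> x \<noteq> 0 \<and> pt x \<in> spinor_variety N"

lemma Spin_act_nonzero: "g \<in> Spin N \<Longrightarrow> x \<noteq> 0 \<Longrightarrow> clifford_act N g x \<noteq> 0"
  using Spin_act_inverse(1)[of g N x] act_scl_spinor[of "inv\<^bsub>Cl N\<^esub> g" N 0 0]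
    monoid.Units_inv_closed[OF ring.is_monoid[OF ring_clifford] Spin_Units] by auto

lemma in_coneE:
  assumes "in_cone N x"
  obtains g c where "g \<in> Spin N" "c \<noteq> 0" "x = scl c (clifford_act N g (ext_basis {1..N}))"
  using assms pt_eqD unfolding in_cone_def spinor_variety_def spin_orbit_def by blast

lemma in_coneI:
  assumes "g \<in> Spin N" "c \<noteq> 0"
  shows "in_cone N (scl c (clifford_act N g (ext_basis {1..N})))"
  using assms Spin_act_nonzero[OF assms(1) pure_nonzero[OF pure_top]]
  unfolding in_cone_def spinor_variety_def spin_orbit_def by (auto simp: pt_scl)

lemma spinor_varietyE:
  assumes "p \<in> spinor_variety N"
  obtains x where "in_cone N x" "p = pt x"
proof -
  obtain g where "g \<in> Spin N" "p = pt (clifford_act N g (ext_basis {1..N}))"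
    using assms unfolding spinor_variety_def spin_orbit_def by blast
  then show ?thesis using that in_coneI[of g N 1] by simp
qed

lemma in_cone_nonzero: "in_cone N x \<Longrightarrow> x \<noteq> 0"
  and in_cone_variety: "in_cone N x \<Longrightarrow> pt x \<in> spinor_variety N"
  by (auto simp: in_cone_def)

lemma in_cone_pure: "in_cone N x \<Longrightarrow> pure_spinor N x"
  by (elim in_coneE) (simp add: pure_scl pure_Spin pure_top del: One_nat_def)

lemma ext_even_scl: "x \<in> ext_even N \<Longrightarrow> scl c x \<in> ext_even N"
  by (auto simp: ext_even_def scl_def)

lemma in_cone_even: "in_cone N x \<Longrightarrow> even N \<Longrightarrow> x \<in> ext_even N"
proof (elim in_coneE)
  fix g c assume "even N" "g \<in> Spin N" "x = scl c (clifford_act N g (ext_basis {1..N}))"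
  moreover have "ext_basis {1..N} \<in> ext_even N" if "even N"
    using that by (auto simp: ext_even_def unit_fun_def split: if_splits)
  ultimately show "x \<in> ext_even N" by (simp add: ext_even_scl act_ext_even Spin_even)
qed

lemma in_cone_scl: "in_cone N x \<Longrightarrow> c \<noteq> 0 \<Longrightarrow> in_cone N (scl c x)"
  by (simp add: in_cone_def pt_scl)

lemma in_cone_Spin: "in_cone N x \<Longrightarrow> g \<in> Spin N \<Longrightarrow> in_cone N (clifford_act N g x)"
proof (elim in_coneE)
  fix h c assume h: "g \<in> Spin N" "h \<in> Spin N" "c \<noteq> 0" "x = scl c (clifford_act N h (ext_basis {1..N}))"
  then have "clifford_act N g x = scl c (clifford_act N (g \<otimes>\<^bsub>Cl N\<^esub> h) (ext_basis {1..N}))"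
    by (simp add: act_scl_spinor act_mult Spin_carrier)
  then show ?thesis using h in_coneI Spin_mult by simp
qed

lemma in_cone_unit_vectors:
  assumes "in_cone N x" "u \<in> Vspace N" "quad_form N u = 1" "w \<in> Vspace N" "quad_form N w = 1"
  shows "in_cone N (clifford_mult N w (clifford_mult N u x))"
  using in_cone_Spin[OF assms(1) Spin_mult_unit_vectors[OF assms(2-5)]] assms
  by (simp add: act_mult cvec_closed act_vec)

text \<open>The vectors are arbitrary, possibly isotropic. Each is exchanged for one of square one
  with the same effect on the spinor it meets, and two such vectors multiply to an element of the
  spin group.\<close>

lemma in_cone_mult2:
  assumes b: "in_cone N b" and e: "e1 \<in> Vspace N" "e2 \<in> Vspace N"
    and nz: "clifford_mult N e2 (clifford_mult N e1 b) \<noteq> 0"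
  shows "in_cone N (clifford_mult N e2 (clifford_mult N e1 b))"
proof -
  have nz1: "clifford_mult N e1 b \<noteq> 0" using nz by auto
  obtain u where u: "u \<in> Vspace N" "quad_form N u = 1" "clifford_mult N u b = clifford_mult N e1 b"
    using pure_unit_representative[OF in_cone_pure[OF b] e(1) nz1] .
  obtain w where w: "w \<in> Vspace N" "quad_form N w = 1"
    "clifford_mult N w (clifford_mult N e1 b) = clifford_mult N e2 (clifford_mult N e1 b)"
    using pure_unit_representative[OF pure_mult[OF in_cone_pure[OF b] e(1) nz1] e(2) nz] .
  show ?thesis using in_cone_unit_vectors[OF b u(1,2) w(1,2)] u w by simp
qed

text \<open>For \<open>f\<^sub>1\<close> annihilating \<open>b\<close> with \<open>bil e\<^sub>1 f\<^sub>1 = 1\<close> and \<open>bil e\<^sub>2 f\<^sub>1 = 0\<close>, the spinor is the image of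
  \<open>b\<close> under the product \<open>(e\<^sub>1 + f\<^sub>1 + t e\<^sub>2) (e\<^sub>1 + f\<^sub>1)\<close> of two vectors of square one.\<close>

lemma in_cone_add_mult2:
  assumes b: "in_cone N b" and e: "e1 \<in> Vspace N" "e2 \<in> Vspace N"
    and iso: "quad_form N e1 = 0" "quad_form N e2 = 0" "bil N e1 e2 = 0"
  shows "in_cone N (b + scl t (clifford_mult N e2 (clifford_mult N e1 b)))"
proof (cases "clifford_mult N e2 (clifford_mult N e1 b) = 0")
  case True
  then show ?thesis using b by simp
next
  case False
  note pb = in_cone_pure[OF b]
  have swap: "clifford_mult N e2 (clifford_mult N e1 b) = - clifford_mult N e1 (clifford_mult N e2 b)"
    using clifford_mult_swap[of N e2 e1 b] iso by (simp add: bil_sym)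
  have "clifford_mult N e2 b \<noteq> 0" using False swap by auto
  then obtain f where f: "f \<in> Ann N b" "bil N e2 f = 1"
    using pure_dual[OF pb e(2)] by blast
  \<comment> \<open>Otherwise \<open>bil N e1\<close> would be a multiple of \<open>bil N e2\<close>
    on \<open>Ann N b\<close>; by maximality \<open>e1 b\<close> would be a multiple of
    \<open>e2 b\<close>, and \<open>e2 e1 b\<close> would vanish.\<close>
  have "\<exists>f1 \<in> Ann N b. bil N e2 f1 = 0 \<and> bil N e1 f1 \<noteq> 0"
  proof (rule ccontr)
    assume no: "\<not> ?thesis"
    have "e1 - scl (bil N e1 f) e2 \<in> Ann N b"
    proof (rule pure_maximal[OF pb])
      show "e1 - scl (bil N e1 f) e2 \<in> Vspace N" using e by (simp add: Vspace_diff Vspace_scl)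
      fix z assume z: "z \<in> Ann N b"
      let ?z = "z - scl (bil N e2 z) f"
      have "?z \<in> Ann N b" "bil N e2 ?z = 0" using z f by (auto simp: Ann_diff Ann_scl bil_simps)
      then have "bil N e1 ?z = 0" using no by blast
      then show "bil N (e1 - scl (bil N e1 f) e2) z = 0" by (simp add: bil_simps)
    qed
    then have "clifford_mult N e1 b = scl (bil N e1 f) (clifford_mult N e2 b)"
      by (auto dest: Ann_mult simp: clifford_mult_diff_vec clifford_mult_scl_vec)
    then show False using False iso by (simp add: clifford_mult_scl clifford_mult_square)
  qed
  then obtain f0 where f0: "f0 \<in> Ann N b" "bil N e2 f0 = 0" "bil N e1 f0 \<noteq> 0" by blast
  define f1 where "f1 = scl (1 / bil N e1 f0) f0"
  have f1: "f1 \<in> Ann N b" "bil N e2 f1 = 0" "bil N e1 f1 = 1"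
    using f0 by (auto simp: f1_def Ann_scl bil_simps)
  define u where "u = e1 + f1"
  define w where "w = u + scl t e2"
  have "quad_form N f1 = 0" by (rule Ann_quad_form[OF pure_nonzero[OF pb] f1(1)])
  then have u: "u \<in> Vspace N" "quad_form N u = 1"
    using e f1 iso by (auto simp: u_def Vspace_add Ann_Vspace quad_form_add)
  have "bil N u e2 = 0" using f1 iso by (simp add: u_def bil_simps bil_sym[of N f1 e2])
  then have w: "w \<in> Vspace N" "quad_form N w = 1"
    using u e iso by (auto simp: w_def Vspace_add Vspace_scl quad_form_add quad_form_scl bil_simps)
  have ub: "clifford_mult N u b = clifford_mult N e1 b"
    using f1(1) by (simp add: u_def clifford_mult_add_vec Ann_mult)
  have "clifford_mult N w (clifford_mult N u b)
      = clifford_mult N u (clifford_mult N u b) + scl t (clifford_mult N e2 (clifford_mult N u b))"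
    by (simp add: w_def clifford_mult_add_vec clifford_mult_scl_vec)
  also have "\<dots> = b + scl t (clifford_mult N e2 (clifford_mult N e1 b))"
    using u clifford_mult_square[of N u b] by (simp add: ub)
  finally show ?thesis using in_cone_unit_vectors[OF b u w] by simp
qed

section \<open>Joins, lines and chains\<close>

lemma proj_join_iff:
  assumes "x \<noteq> 0"
  shows "pt x \<in> proj_join (pt c) (pt d) \<longleftrightarrow> (\<exists>\<alpha> \<beta>. x = scl \<alpha> c + scl \<beta> d)"
proof -
  have span: "cfun.span (pt c \<union> pt d) = {scl \<alpha> c + scl \<beta> d | \<alpha> \<beta>. True}"
  proof -
    have "cfun.span (pt y) = {scl k y | k. True}" for y :: "'a \<Rightarrow> complex"
      unfolding pt_def cfun.span_span by (auto simp: cfun.span_singleton)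
    then show ?thesis unfolding cfun.span_Un by auto
  qed
  have "x \<in> cfun.span (pt c \<union> pt d)" if "pt x = pt y" "y \<in> cfun.span (pt c \<union> pt d)" for y
    using pt_eqD[OF that(1) assms] that(2) cfun.span_scale by auto
  then have "pt x \<in> proj_join (pt c) (pt d) \<longleftrightarrow> x \<in> cfun.span (pt c \<union> pt d)"
    using assms unfolding proj_join_def projectivize_def by auto
  then show ?thesis unfolding span by auto
qed

text \<open>Up to a scalar, the plane consists of \<open>d = e2 e1 b\<close> and the spinors
  \<open>b + t d\<close>, all of them in the cone. It is a plane because \<open>e1\<close>
  annihilates \<open>d\<close> but not \<open>b\<close>.\<close>

lemma line_in_variety:
  assumes b: "in_cone N b" and e: "e1 \<in> Vspace N" "e2 \<in> Vspace N"
    and iso: "quad_form N e1 = 0" "quad_form N e2 = 0" "bil N e1 e2 = 0"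
    and nz: "clifford_mult N e2 (clifford_mult N e1 b) \<noteq> 0"
  shows "\<exists>L. proj_line L \<and> L \<subseteq> spinor_variety N \<and> pt b \<in> L \<and> pt (clifford_mult N e2 (clifford_mult N e1 b)) \<in> L"
proof -
  define d where "d = clifford_mult N e2 (clifford_mult N e1 b)"
  let ?W = "cfun.span {b, d}"
  have d: "in_cone N d" unfolding d_def by (rule in_cone_mult2[OF b e nz])
  have "clifford_mult N e1 d = 0"
    unfolding d_def using clifford_mult_swap[of N e1 e2 "clifford_mult N e1 b"] iso
    by (simp add: clifford_mult_square)
  moreover have "clifford_mult N e1 b \<noteq> 0" using nz by auto
  ultimately have b_d: "b \<notin> cfun.span {d}"
    by (auto simp: cfun.span_singleton clifford_mult_scl)
  have ind: "cfun.independent {b, d}"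
    using b_d in_cone_nonzero[OF d] cfun.span_base[of b "{d}"] by (auto simp: cfun.independent_insert)
  have "b \<noteq> d" using b_d cfun.span_base[of b "{d}"] by auto
  then have "cfun.dim ?W = 2" using cfun.dim_span_eq_card_independent[OF ind] by simp
  then have "proj_line (projectivize ?W)" unfolding proj_line_def by blast
  moreover have "projectivize ?W \<subseteq> spinor_variety N"
  proof
    fix p assume "p \<in> projectivize ?W"
    then obtain v where v: "p = pt v" "v \<in> ?W" "v \<noteq> 0" by (auto simp: projectivize_def)
    then obtain \<alpha> \<beta> where ab: "v - scl \<alpha> b = scl \<beta> d"
      unfolding cfun.span_insert cfun.span_singleton by auto
    have "in_cone N v"
    proof (cases "\<alpha> = 0")
      case True
      then have "v = scl \<beta> d" using ab by simp
      then show ?thesis using v d by (auto intro: in_cone_scl)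
    next
      case False
      have "v = scl \<alpha> (b + scl (\<beta> / \<alpha>) d)"
        using ab False by (simp add: cfun.scale_right_distrib algebra_simps)
      moreover have "in_cone N (b + scl (\<beta> / \<alpha>) d)"
        unfolding d_def by (rule in_cone_add_mult2[OF b e iso])
      ultimately show ?thesis using False in_cone_scl by metis
    qed
    then show "p \<in> spinor_variety N" using v in_cone_variety by blast
  qed
  moreover have "pt b \<in> projectivize ?W" "pt d \<in> projectivize ?W"
    using in_cone_nonzero[OF b] in_cone_nonzero[OF d] cfun.span_base[of _ "{b, d}"]
    unfolding projectivize_def by blast+
  ultimately show ?thesis unfolding d_def by blast
qed

lemma line_chain_0: "line_chain N 0 p p"
  unfolding line_chain_def by auto

lemma line_chain_Suc:
  assumes "line_chain N n p q" "proj_line L" "L \<subseteq> spinor_variety N" "q \<in> L" "r \<in> L"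
  shows "line_chain N (Suc n) p r"
proof -
  obtain c where c: "c 0 = p" "c n = q"
    "\<And>i. i < n \<Longrightarrow> \<exists>L. proj_line L \<and> L \<subseteq> spinor_variety N \<and> c i \<in> L \<and> c (Suc i) \<in> L"
    using assms(1) unfolding line_chain_def by blast
  have "\<exists>M. proj_line M \<and> M \<subseteq> spinor_variety N \<and> (c(Suc n := r)) i \<in> M \<and> (c(Suc n := r)) (Suc i) \<in> M"
    if "i < Suc n" for i
    using c that assms(2-5) by (cases "i = n") auto
  then show ?thesis unfolding line_chain_def using c by (intro exI[of _ "c(Suc n := r)"]) auto
qed

text \<open>Two consecutive orthogonal isotropic factors make one step along a line; removing them
  from the front of the list leaves the earlier part of the chain.\<close>

lemma line_chain_factorization:
  assumes b: "in_cone N b"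
    and iso: "set es \<subseteq> Vspace N" "\<And>e e'. e \<in> set es \<Longrightarrow> e' \<in> set es \<Longrightarrow> bil N e e' = 0"
    and n: "length es = 2 * n" and nz: "foldr (clifford_mult N) es b \<noteq> 0"
  shows "in_cone N (foldr (clifford_mult N) es b) \<and> line_chain N n (pt b) (pt (foldr (clifford_mult N) es b))"
  using iso n nz
proof (induction n arbitrary: es)
  case 0
  then show ?case using b by (auto simp: line_chain_def)
next
  case (Suc n)
  obtain x y fs where es: "es = x # y # fs" using Suc.prems(3) by (cases es; cases "tl es") auto
  define d where "d = foldr (clifford_mult N) fs b"
  have nz: "clifford_mult N x (clifford_mult N y d) \<noteq> 0" using Suc.prems(4) by (simp add: es d_def zero_fun_def)
  then have "d \<noteq> 0" by auto
  then have IH: "in_cone N d" "line_chain N n (pt b) (pt d)"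
    unfolding d_def using Suc.IH[of fs] Suc.prems by (auto simp: es zero_fun_def)
  have "bil N x x = 0" "bil N y y = 0" "bil N y x = 0" using Suc.prems(2) by (auto simp: es)
  then have iso: "quad_form N y = 0" "quad_form N x = 0" "bil N y x = 0" by (auto simp: bil_self)
  have V: "y \<in> Vspace N" "x \<in> Vspace N" using Suc.prems(1) by (auto simp: es)
  show ?case
    using line_in_variety[OF IH(1) V iso nz] line_chain_Suc[OF IH(2)] in_cone_mult2[OF IH(1) V nz]
    by (auto simp: es d_def)
qed

lemma foldr_clifford_spinors: "x \<in> spinors N p \<Longrightarrow> foldr (clifford_mult N) es x \<in> spinors N (length es + p)"
  by (induction es) (simp_all add: clifford_mult_spinors)

text \<open>Every vector factor flips the parity, while \<open>a\<close> and \<open>b\<close> are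
  both even for even \<open>N\<close>. So at most four factors means zero, two or four, that is, at
  most two lines.\<close>

lemma hamming_dist_le_2:
  assumes a: "in_cone N a" and b: "in_cone N b" and N: "even N"
    and ts: "set ts \<subseteq> Vspace N" "length ts \<le> 4"
    and near: "\<And>z. z \<in> Ann N a \<Longrightarrow> (\<And>t. t \<in> set ts \<Longrightarrow> bil N t z = 0) \<Longrightarrow> z \<in> Ann N b"
  shows "hamming_dist N (pt b) (pt a) \<le> 2"
proof -
  obtain es where es: "length es \<le> length ts" "set es \<subseteq> Ann N a" "a \<in> pt (foldr (clifford_mult N) es b)"
    using near_factorization[OF in_cone_pure[OF a] in_cone_pure[OF b] ts(1) near] by blast
  let ?d = "foldr (clifford_mult N) es b"
  obtain c where c: "a = scl c ?d" using es by (auto simp: pt_iff)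
  note a0 = in_cone_nonzero[OF a]
  have d0: "?d \<noteq> 0" using c a0 by auto
  obtain S where S: "a S \<noteq> 0" using a0 by (auto simp: fun_eq_iff)
  then have "?d S \<noteq> 0" using c by (auto simp: scl_def)
  moreover have "?d \<in> spinors N (length es)"
    using foldr_clifford_spinors[of b N 0 es] in_cone_even[OF b N] by (simp add: spinors_0)
  ultimately have "even (length es)"
    using S in_cone_even[OF a N] by (auto simp: spinors_def ext_even_def)
  then obtain n where n: "length es = 2 * n" by (elim evenE)
  have "bil N e e' = 0" if "e \<in> set es" "e' \<in> set es" for e e'
    using Ann_isotropic[OF a0] es(2) that by blast
  then have "line_chain N n (pt b) (pt ?d)"
    using line_chain_factorization[OF b _ _ n d0] es(2) Ann_Vspace by blast
  moreover have "pt a = pt ?d" using pt_eqI[OF es(3) a0] .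
  ultimately have "hamming_dist N (pt b) (pt a) \<le> enat n"
    unfolding hamming_dist_def by (intro Inf_lower) auto
  moreover have "n \<le> 2" using n es ts by simp
  ultimately show ?thesis by (metis enat_ord_simps(1) numeral_eq_enat order_trans)
qed

section \<open>Identifiability of sums of two pure spinors\<close>

text \<open>The hypothesis \<open>far\<close> contradicts both nearness results: the one for pure
  sums, with two conditions, and the one for two decompositions, with four.\<close>

lemma identifiable_of_far:
  assumes a: "in_cone N a" and b: "in_cone N b" and x0: "a + b \<noteq> 0"
    and far: "\<And>ts. set ts \<subseteq> Vspace N \<Longrightarrow> length ts \<le> 4 \<Longrightarrow>
      \<exists>z \<in> Ann N b. (\<forall>t \<in> set ts. bil N t z = 0) \<and> z \<notin> Ann N a"
  shows "identifiable N (pt (a + b))"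
proof -
  note pa = in_cone_pure[OF a] and pb = in_cone_pure[OF b]
  \<comment> \<open>All nonzero coefficients are needed, not only \<open>a + b\<close>: once one
    point of a second decomposition is known, the other representative is some combination of
    \<open>a\<close> and \<open>b\<close>.\<close>
  have F: "\<not> pure_spinor N (scl \<alpha> a + scl \<beta> b)" if nz: "\<alpha> \<noteq> 0" "\<beta> \<noteq> 0" for \<alpha> \<beta>
  proof
    assume "pure_spinor N (scl \<alpha> a + scl \<beta> b)"
    then have "pure_spinor N (scl \<beta> b + scl \<alpha> a)" by (simp add: add.commute)
    then obtain w d where "w \<in> Vspace N" "d \<in> Vspace N"
      "\<And>z. z \<in> Ann N (scl \<beta> b) \<Longrightarrow> bil N w z = 0 \<Longrightarrow> bil N d z = 0 \<Longrightarrow> z \<in> Ann N (scl \<alpha> a)"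
      using near_of_pure_sum[OF pure_scl[OF pb nz(2)] pure_scl[OF pa nz(1)]] by metis
    then show False using far[of "[w, d]"] nz by (auto simp: Ann_scl_spinor)
  qed
  have unique: "{p, q} = {pt a, pt b}"
    if pq: "p \<in> spinor_variety N" "q \<in> spinor_variety N" "pt (a + b) \<in> proj_join p q" for p q
  proof -
    obtain c d where cd: "in_cone N c" "p = pt c" "in_cone N d" "q = pt d"
      using pq spinor_varietyE by metis
    then obtain \<alpha> \<beta> where eq: "a + b = scl \<alpha> c + scl \<beta> d" using pq x0 proj_join_iff by metis
    have pure_cd: "pure_spinor N (scl \<gamma> c)" "pure_spinor N (scl \<gamma> d)" if "\<gamma> \<noteq> 0" for \<gamma>
      using that cd pure_scl in_cone_pure by blast+
    have "\<not> pure_spinor N (a + b)" using F[of 1 1] by simp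
    then have nz: "\<alpha> \<noteq> 0" "\<beta> \<noteq> 0"
      using pure_cd eq x0 by (metis add.left_neutral add.right_neutral scl_zero_iff)+
    \<comment> \<open>If the first points agree, the other summand is \<open>b'\<close> plus a
      multiple of \<open>a'\<close>; its purity forces that multiple to be zero.\<close>
    have match: "pt d = pt b'"
      if pt: "pt c = pt a'" "a' + b' = a + b" and np: "\<And>\<gamma>. \<gamma> \<noteq> 0 \<Longrightarrow> \<not> pure_spinor N (scl \<gamma> a' + b')" for a' b'
    proof -
      obtain \<rho> where \<rho>: "c = scl \<rho> a'" using pt_eqD[OF pt(1) in_cone_nonzero[OF cd(1)]] by blast
      have d: "scl \<beta> d = scl (1 - \<alpha> * \<rho>) a' + b'"
        using eq pt(2) by (simp add: \<rho> fun_eq_iff scl_def algebra_simps)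
      then have "1 - \<alpha> * \<rho> = 0" using np pure_cd(2)[OF nz(2)] by metis
      then have "scl \<beta> d = b'" using d by simp
      then show ?thesis using nz pt_scl by metis
    qed
    have "pt c = pt a \<or> pt c = pt b"
    proof (rule ccontr)
      assume "\<not> ?thesis"
      then have ne: "pt (scl \<alpha> c) \<noteq> pt b" "pt (scl \<alpha> c) \<noteq> pt a" using nz by (simp_all add: pt_scl)
      \<comment> \<open>The summands are exchanged because \<open>far\<close> counts conditions on
        \<open>Ann N b\<close>.\<close>
      have "b + a = scl \<alpha> c + scl \<beta> d" using eq by (simp add: add.commute)
      from near_of_two_decompositions[OF pb pa pure_cd(1)[OF nz(1)] pure_cd(2)[OF nz(2)] this ne]
      obtain t1 t2 t3 t4 where t: "set [t1, t2, t3, t4] \<subseteq> Vspace N"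
        "\<And>z. z \<in> Ann N b \<Longrightarrow> (\<And>t. t \<in> set [t1, t2, t3, t4] \<Longrightarrow> bil N t z = 0) \<Longrightarrow> z \<in> Ann N a"
        by metis
      from far[OF t(1)] obtain z where "z \<in> Ann N b" "\<forall>t\<in>set [t1, t2, t3, t4]. bil N t z = 0" "z \<notin> Ann N a"
        by auto
      then show False using t(2) by blast
    qed
    then show ?thesis
    proof
      assume "pt c = pt a"
      then show ?thesis using match[of a b] F[of _ 1] cd by auto
    next
      assume "pt c = pt b"
      then show ?thesis using match[of b a] F[of 1] cd by (auto simp: add.commute)
    qed
  qed
  have "pt (a + b) \<in> proj_join (pt a) (pt b)"
    unfolding proj_join_iff[OF x0] by (intro exI[of _ 1]) simp
  then show ?thesis
    unfolding identifiable_def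
    by (intro ex1I[of _ "{pt a, pt b}"])
      (use in_cone_variety[OF a] in_cone_variety[OF b] unique in blast)+
qed

lemma Sigma_orbit_identifiable:
  assumes N: "even N" and l: "l \<ge> 3" and p: "p \<in> Sigma_orbit l N"
  shows "identifiable N p"
proof -
  obtain a b where ab: "p = pt (a + b)" "a + b \<noteq> 0" "in_cone N a" "in_cone N b"
    "hamming_dist N (pt a) (pt b) = enat l"
    using p unfolding Sigma_orbit_def in_cone_def by blast
  have "\<exists>z \<in> Ann N b. (\<forall>t \<in> set ts. bil N t z = 0) \<and> z \<notin> Ann N a"
    if "set ts \<subseteq> Vspace N" "length ts \<le> 4" for ts
  proof (rule ccontr)
    assume "\<not> ?thesis"
    then have "hamming_dist N (pt a) (pt b) \<le> 2"
      using hamming_dist_le_2[OF ab(4,3) N that] by blast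
    then show False using ab(5) l by (simp add: numeral_eq_enat)
  qed
  then show ?thesis using identifiable_of_far ab by blast
qed

lemma proj_line_member:
  assumes "L = projectivize W" "cfun.subspace W" "pt x \<in> L" "x \<noteq> 0"
  shows "x \<in> W"
proof -
  obtain y where "pt x = pt y" "y \<in> W" using assms by (auto simp: projectivize_def)
  then show ?thesis using pt_eqD[of x y] assms cfun.subspace_scale by auto
qed

lemma Inf_enat_mem: "A \<noteq> {} \<Longrightarrow> Inf A \<in> A" for A :: "enat set"
  using LeastI_ex[of "\<lambda>x. x \<in> A"] by (auto simp: Inf_enat_def)

lemma Sigma_2_not_identifiable:
  assumes "p \<in> Sigma_orbit 2 N"
  shows "\<not> identifiable N p"
proof -
  obtain a b where ab: "p = pt (a + b)" "a + b \<noteq> 0" "in_cone N a" "in_cone N b"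
    "hamming_dist N (pt a) (pt b) = enat 2"
    using assms unfolding Sigma_orbit_def in_cone_def by blast
  note a0 = in_cone_nonzero[OF ab(3)] and b0 = in_cone_nonzero[OF ab(4)]
  let ?A = "{enat n | n. line_chain N n (pt a) (pt b)}"
  have "Inf ?A = enat 2" using ab(5) by (simp add: hamming_dist_def)
  have "?A \<noteq> {}"
  proof
    assume "?A = {}"
    then have "Inf ?A = \<infinity>" by (simp only: Inf_empty top_enat_def)
    then show False using \<open>Inf ?A = enat 2\<close> by simp
  qed
  \<comment> \<open>A finite infimum is attained, which provides a chain of exactly two
    lines.\<close>
  then have "Inf ?A \<in> ?A" by (rule Inf_enat_mem)
  then have "enat 2 \<in> ?A" by (simp only: \<open>Inf ?A = enat 2\<close>)
  then have chain: "line_chain N 2 (pt a) (pt b)" by auto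
  \<comment> \<open>Minimality enters only here. It separates the middle point \<open>c\<close> from
    \<open>a\<close> and from \<open>b\<close>, and \<open>a + c\<close> from
    \<open>b\<close>.\<close>
  have no_line: "\<not> (L \<subseteq> spinor_variety N \<and> pt a \<in> L \<and> pt b \<in> L)" if "proj_line L" for L
  proof
    assume "L \<subseteq> spinor_variety N \<and> pt a \<in> L \<and> pt b \<in> L"
    then have "line_chain N (Suc 0) (pt a) (pt b)"
      using line_chain_Suc[OF line_chain_0 that] by blast
    then have "Inf ?A \<le> enat (Suc 0)" by (intro Inf_lower) blast
    then show False using \<open>Inf ?A = enat 2\<close> by simp
  qed
  obtain f where f: "f 0 = pt a" "f 2 = pt b"
    "\<And>i. i < 2 \<Longrightarrow> \<exists>L. proj_line L \<and> L \<subseteq> spinor_variety N \<and> f i \<in> L \<and> f (Suc i) \<in> L"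
    using chain unfolding line_chain_def by blast
  obtain L where L: "proj_line L" "L \<subseteq> spinor_variety N" "pt a \<in> L" "f 1 \<in> L" using f(1) f(3)[of 0] by auto
  obtain M where M: "proj_line M" "M \<subseteq> spinor_variety N" "f 1 \<in> M" "pt b \<in> M"
    using f(2) f(3)[of 1] by (auto simp: numeral_2_eq_2)
  obtain c where c: "in_cone N c" "f 1 = pt c" using spinor_varietyE L by blast
  note c0 = in_cone_nonzero[OF c(1)]
  obtain W where W: "cfun.subspace W" "L = projectivize W" using L(1) by (auto simp: proj_line_def)
  obtain W' where W': "cfun.subspace W'" "M = projectivize W'" using M(1) by (auto simp: proj_line_def)
  have mem: "a \<in> W" "c \<in> W" "b \<in> W'" "c \<in> W'"
    using proj_line_member W W' L M c a0 b0 c0 by metis+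
  have ca: "pt c \<noteq> pt a" using no_line[OF M(1)] M c by metis
  have cb: "pt c \<noteq> pt b" using no_line[OF L(1)] L c by metis
  have ac0: "a + c \<noteq> 0"
  proof
    assume "a + c = 0"
    then have "c = scl (-1) a" by (simp add: eq_neg_iff_add_eq_0 add.commute)
    then show False using ca pt_scl[of "-1" a] by simp
  qed
  have bc0: "b - c \<noteq> 0" using cb by auto
  have ac: "pt (a + c) \<in> L" using ac0 mem W by (auto simp: projectivize_def cfun.subspace_add)
  have bc: "pt (b - c) \<in> M" using bc0 mem W' by (auto simp: projectivize_def cfun.subspace_diff)
  have "{pt (a + c), pt (b - c)} \<noteq> {pt a, pt b}"
  proof
    assume "{pt (a + c), pt (b - c)} = {pt a, pt b}"
    then consider "pt (a + c) = pt a" | "pt (a + c) = pt b" by (auto simp: doubleton_eq_iff)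
    then show False
    proof cases
      case 1
      then obtain k where "a + c = scl k a" using pt_eqD[OF 1 ac0] by blast
      then have "c = scl (k - 1) a" by (simp add: fun_eq_iff scl_def algebra_simps)
      then have "c \<in> pt a" by (auto simp: pt_iff)
      then show False using pt_eqI c0 ca by blast
    next
      case 2
      then show False using no_line[OF L(1)] L ac by metis
    qed
  qed
  moreover have "p \<in> proj_join (pt a) (pt b)"
    unfolding ab(1) proj_join_iff[OF ab(2)] by (intro exI[of _ 1]) simp
  moreover have "p \<in> proj_join (pt (a + c)) (pt (b - c))"
    unfolding ab(1) proj_join_iff[OF ab(2)] by (intro exI[of _ 1]) simp
  moreover have "pt (a + c) \<in> spinor_variety N" "pt (b - c) \<in> spinor_variety N"
    "pt a \<in> spinor_variety N" "pt b \<in> spinor_variety N" using ac bc L M by auto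
  ultimately show ?thesis unfolding identifiable_def by metis
qed

section \<open>Tangential identifiability\<close>

lemma gen_op_contract_basis:
  assumes "k \<ge> 1"
  shows "gen_op N (N + k) (ext_basis S) = (if k \<in> S then scl (sgn_at k (S - {k})) (ext_basis (S - {k})) else 0)"
proof
  fix R
  have "insert k R = S \<longleftrightarrow> R = S - {k} \<and> k \<in> S" if "k \<notin> R" using that by auto
  then show "gen_op N (N + k) (ext_basis S) R = (if k \<in> S then scl (sgn_at k (S - {k})) (ext_basis (S - {k})) else 0) R"
    using assms by (cases "k \<in> R") (auto simp: gen_op_def unit_fun_def scl_def simp del: insert_Diff_single)
qed

lemma gen_op_wedge_basis:
  assumes "k \<le> N" "k \<notin> S"
  shows "gen_op N k (ext_basis S) = scl (sgn_at k S) (ext_basis (insert k S))"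
proof
  fix R
  have "R - {k} = S \<longleftrightarrow> R = insert k S" if "k \<in> R" using that assms by auto
  moreover have "sgn_at k (insert k S) = sgn_at k S" by (simp add: sgn_at_insert)
  ultimately show "gen_op N k (ext_basis S) R = scl (sgn_at k S) (ext_basis (insert k S)) R"
    using assms by (cases "k \<in> R") (auto simp: gen_op_def unit_fun_def scl_def simp del: insert_Diff_single)
qed

text \<open>Contracting the top form by the \<open>f_k\<close> with the two largest remaining
  indices at a time stays in the orbit; an even \<open>N\<close> allows this to reach the empty set.
  The pairs \<open>e_(2i-1) \<and> e_(2i)\<close> are tangent directions at this point.\<close>

lemma in_cone_empty:
  assumes "even N"
  shows "in_cone N (ext_basis {})"
proof -
  have "in_cone N (ext_basis {1..N - 2 * m})" if "2 * m \<le> N" for m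
    using that
  proof (induction m)
    case 0
    have "clifford_act N \<one>\<^bsub>Cl N\<^esub> (ext_basis {1..N}) = ext_basis {1..N}" by (rule act_one)
    moreover have "\<one>\<^bsub>Cl N\<^esub> \<in> Spin N" by (rule Spin_one)
    ultimately show ?case using in_coneI[of "\<one>\<^bsub>Cl N\<^esub>" N 1] by simp
  next
    case (Suc m)
    obtain n where n: "N - 2 * m = Suc (Suc n)" "N - 2 * Suc m = n" "Suc (Suc n) \<le> N"
    proof -
      have "N - 2 * m = Suc (Suc (N - 2 * Suc m))" "Suc (Suc (N - 2 * Suc m)) \<le> N" using Suc.prems by simp_all
      then show ?thesis using that by blast
    qed
    let ?F = "\<lambda>k. unit_fun (N + k) :: nat \<Rightarrow> complex"
    have V: "?F (Suc (Suc n)) \<in> Vspace N" "?F (Suc n) \<in> Vspace N" using n by (auto intro!: Vspace_unit)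
    have s: "{1..Suc k} - {Suc k} = {1..k}" for k :: nat by auto
    have F: "clifford_mult N (?F (Suc k)) (ext_basis {1..Suc k}) = scl (sgn_at (Suc k) {1..k}) (ext_basis {1..k})"
      if "Suc k \<le> N" for k
      using that gen_op_contract_basis[of "Suc k" N "{1..Suc k}"]
      by (subst clifford_mult_unit) (simp_all only: s, auto)
    let ?c = "sgn_at (Suc (Suc n)) {1..Suc n} * sgn_at (Suc n) {1..n}"
    have eq: "clifford_mult N (?F (Suc n)) (clifford_mult N (?F (Suc (Suc n))) (ext_basis {1..Suc (Suc n)}))
        = scl ?c (ext_basis {1..n})"
      using n by (simp only: F Suc_leD clifford_mult_scl scl_scl)
    have nz: "ext_basis {1..n} \<noteq> 0" by (auto simp: fun_eq_iff unit_fun_def)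
    have c: "?c \<noteq> 0" by (simp add: sgn_at_nonzero)
    have "in_cone N (ext_basis {1..Suc (Suc n)})" using Suc n by simp
    from in_cone_mult2[OF this V] have "in_cone N (scl ?c (ext_basis {1..n}))"
      unfolding eq using c nz by simp
    from in_cone_scl[OF this, of "1 / ?c"] show ?case unfolding n(2) using c by simp
  qed
  from this[of "N div 2"] show ?thesis using assms by simp
qed

text \<open>The vector \<open>quad_vec N S x\<close> is the \<open>S\<close>-coordinate, in the second factor, of Cartan's tensor
  \<open>\<Sum>\<^sub>i e\<^sub>i \<otimes> f\<^sub>i x + f\<^sub>i \<otimes> e\<^sub>i x\<close>. It is orthogonal to every vector annihilating \<open>x\<close>, hence itself
  annihilates a pure \<open>x\<close>; these are the quadrics containing the cone over the spinor variety.\<close>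

definition quad_vec :: "nat \<Rightarrow> nat set \<Rightarrow> (nat set \<Rightarrow> complex) \<Rightarrow> nat \<Rightarrow> complex" where
  "quad_vec N S x = (\<lambda>j. if j \<in> {1..N} then gen_op N (N + j) x S
     else if j \<in> {N+1..2*N} then gen_op N (j - N) x S else 0)"

lemma quad_vec_Vspace: "quad_vec N S x \<in> Vspace N"
  by (auto simp: quad_vec_def Vspace_def split: if_splits)

lemma bil_quad_vec: "bil N w (quad_vec N S x) = clifford_mult N w x S"
proof -
  have "bil N w (quad_vec N S x) = (\<Sum>k=1..N. w k * gen_op N k x S + w (N + k) * gen_op N (N + k) x S)"
    unfolding bil_def by (intro sum.cong) (auto simp: quad_vec_def)
  then show ?thesis unfolding clifford_mult_gen_op by (simp only: sum_two_halves sum.distrib)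
qed

lemma pure_quadrics: "pure_spinor N x \<Longrightarrow> clifford_mult N (quad_vec N S x) x = 0"
  by (intro Ann_mult[OF pure_maximal] quad_vec_Vspace)
    (simp_all add: bil_sym[of N "quad_vec N S x"] bil_quad_vec Ann_mult)

lemma gen_op_line: "gen_op N k (x + scl t y) S = gen_op N k x S + t * gen_op N k y S"
  by (simp add: gen_op_def scl_def algebra_simps)

lemma quad_vec_line: "quad_vec N S (x + scl t y) = quad_vec N S x + scl t (quad_vec N S y)"
  by (auto simp: quad_vec_def gen_op_line fun_eq_iff) (simp_all add: scl_def)

lemma quad_vec_scl: "quad_vec N S (scl c x) = scl c (quad_vec N S x)"
  by (auto simp: quad_vec_def gen_op_def scl_def fun_eq_iff)

section \<open>Polynomial functions and their differentials\<close>

lemma polynomial_fun_sum: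
  "finite A \<Longrightarrow> (\<And>i. i \<in> A \<Longrightarrow> polynomial_fun (F i)) \<Longrightarrow> polynomial_fun (\<lambda>x. \<Sum>i\<in>A. F i x)"
  by (induction A rule: finite_induct) (auto intro: polynomial_fun.intros)

lemma polynomial_fun_gen_op: "polynomial_fun (\<lambda>x. gen_op N k x S)"
  unfolding gen_op_def
  by (cases "k \<le> N"; cases "k \<in> S"; cases "k - N \<in> S") (auto intro!: polynomial_fun.intros)

lemma polynomial_fun_quadric: "polynomial_fun (\<lambda>x. clifford_mult N (quad_vec N S x) x R)"
proof -
  have "polynomial_fun (\<lambda>x. quad_vec N S x k)" for k
    unfolding quad_vec_def
    by (cases "k \<in> {1..N}"; cases "k \<in> {N+1..2*N}") (auto intro: polynomial_fun_gen_op polynomial_fun.const)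
  then show ?thesis unfolding clifford_mult_gen_op
    by (intro polynomial_fun_sum polynomial_fun.mult polynomial_fun_gen_op) auto
qed

text \<open>Of the linearity of the differential only additivity is kept: it suffices to pass from
  tangent directions along lines to their sums.\<close>

lemma polynomial_fun_derivative:
  assumes "polynomial_fun F"
  shows "\<exists>D. (\<forall>u v. D (u + v) = D u + D v) \<and>
    (\<forall>v. ((\<lambda>t. F (a + scl t v)) has_field_derivative D v) (at 0))"
  using assms
proof induction
  case (const c)
  show ?case by (intro exI[of _ "\<lambda>_. 0"]) auto
next
  case (coord i)
  show ?case by (intro exI[of _ "\<lambda>v. v i"]) (auto simp: scl_def intro!: derivative_eq_intros)
next
  case (add F G)
  then obtain D E where *: "\<forall>u v. D (u + v) = D u + D v" "\<forall>u v. E (u + v) = E u + E v"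
    "\<And>v. ((\<lambda>t. F (a + scl t v)) has_field_derivative D v) (at 0)"
    "\<And>v. ((\<lambda>t. G (a + scl t v)) has_field_derivative E v) (at 0)" by blast
  have "((\<lambda>t. F (a + scl t v) + G (a + scl t v)) has_field_derivative (D v + E v)) (at 0)" for v
    using DERIV_add[OF *(3)[of v] *(4)[of v]] by simp
  then show ?case using *(1,2) by (intro exI[of _ "\<lambda>v. D v + E v"]) (auto simp: plus_fun_def)
next
  case (mult F G)
  then obtain D E where *: "\<forall>u v. D (u + v) = D u + D v" "\<forall>u v. E (u + v) = E u + E v"
    "\<And>v. ((\<lambda>t. F (a + scl t v)) has_field_derivative D v) (at 0)"
    "\<And>v. ((\<lambda>t. G (a + scl t v)) has_field_derivative E v) (at 0)" by blast
  have "((\<lambda>t. F (a + scl t v) * G (a + scl t v)) has_field_derivative (D v * G a + E v * F a)) (at 0)" for v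
    using DERIV_mult[OF *(3)[of v] *(4)[of v]] by simp
  then show ?case using *(1,2) by (intro exI[of _ "\<lambda>v. D v * G a + E v * F a"]) (auto simp: plus_fun_def algebra_simps)
qed

text \<open>The coefficient of \<open>t\<close> in a quadric along \<open>b + t y\<close> is its
  polarization at \<open>b\<close> and \<open>y\<close>; it vanishes for tangent \<open>y\<close>.
  The two terms of the polarization are a vector times \<open>y\<close>, with the vector depending
  only on \<open>b\<close>, and a vector times \<open>b\<close>.\<close>

lemma tangent_quadrics:
  assumes b: "in_cone N b" and y: "y \<noteq> 0" "pt y \<in> proj_tangent_space W (spinor_variety N) (pt b)"
  shows "clifford_mult N (quad_vec N S b) y = - clifford_mult N (quad_vec N S y) b"
proof -
  let ?Q = "\<lambda>R x. clifford_mult N (quad_vec N S x) x R"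
  obtain y' where y': "pt y = pt y'"
    "\<And>F a. polynomial_fun F \<Longrightarrow> (\<forall>x \<in> \<Union>(spinor_variety N). F x = 0) \<Longrightarrow> a \<in> pt b - {0} \<Longrightarrow>
      ((\<lambda>t. F (a + scl t y')) has_field_derivative 0) (at 0)"
    using y(2) unfolding proj_tangent_space_def projectivize_def by blast
  have vanish: "?Q R x = 0" if x: "x \<in> \<Union>(spinor_variety N)" for R x
  proof (cases "x = 0")
    case False
    obtain p where p: "p \<in> spinor_variety N" "x \<in> p" using x by blast
    then obtain z where z: "in_cone N z" "p = pt z" using spinor_varietyE by blast
    then have "in_cone N x" using p False pt_eqI[of x z] by (simp add: in_cone_def)
    then show ?thesis using pure_quadrics in_cone_pure by (simp add: zero_fun_def)
  qed simp
  have "clifford_mult N (quad_vec N S b) y' R + clifford_mult N (quad_vec N S y') b R = 0" for R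
  proof -
    have eq: "?Q R (b + scl t y') = ?Q R b + t * (clifford_mult N (quad_vec N S b) y' R + clifford_mult N (quad_vec N S y') b R)
        + t\<^sup>2 * ?Q R y'" for t
      by (simp add: quad_vec_line clifford_mult_add clifford_mult_add_vec clifford_mult_scl clifford_mult_scl_vec)
        (simp add: scl_def algebra_simps power2_eq_square)
    have "((\<lambda>t. ?Q R (b + scl t y')) has_field_derivative
      (clifford_mult N (quad_vec N S b) y' R + clifford_mult N (quad_vec N S y') b R)) (at 0)"
      unfolding eq by (auto intro!: derivative_eq_intros)
    moreover have "((\<lambda>t. ?Q R (b + scl t y')) has_field_derivative 0) (at 0)"
      using y'(2)[OF polynomial_fun_quadric] vanish pt_self in_cone_nonzero[OF b] by blast
    ultimately show ?thesis by (rule DERIV_unique)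
  qed
  then have y'_eq: "clifford_mult N (quad_vec N S b) y' = - clifford_mult N (quad_vec N S y') b"
    by (auto simp: fun_eq_iff eq_neg_iff_add_eq_0)
  obtain c where c: "y = scl c y'" using pt_eqD[OF y'(1) y(1)] by blast
  have "quad_vec N S y = scl c (quad_vec N S y')"
    by (simp add: c quad_vec_scl)
  then show ?thesis
    by (simp add: c clifford_mult_scl clifford_mult_scl_vec y'_eq)
qed

definition pair_sum :: "nat \<Rightarrow> nat set \<Rightarrow> complex" where
  "pair_sum l = (\<Sum>i=1..l. ext_basis {2*i - 1, 2*i})"

text \<open>With \<open>Y = v \<cdot> pair_sum l\<close> pure, three pairs suffice: applying four of the \<open>f\<^sub>i\<close> to \<open>w \<cdot> Y = 0\<close>
  shows that all \<open>w\<close> annihilating \<open>Y\<close> have \<open>w\<^sub>p v\<^sub>j = w\<^sub>j v\<^sub>p\<close>, so that \<open>v\<^sub>p f\<^sub>j - v\<^sub>j f\<^sub>p\<close> is orthogonal to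
  them and must annihilate \<open>Y\<close> as well; a direct computation refutes this.\<close>

lemma pair_vector_not_pure:
  assumes l: "l \<ge> 3" "2 * l \<le> N" and v: "v \<in> Vspace N" "clifford_mult N v (ext_basis {}) \<noteq> 0"
  shows "clifford_mult N v (pair_sum l) \<noteq> 0 \<and> \<not> pure_spinor N (clifford_mult N v (pair_sum l))"
proof -
  define f where "f k = clifford_mult N (unit_fun (N + k))" for k
  let ?a = "ext_basis {}" and ?\<omega> = "pair_sum l"
  define Y where "Y = clifford_mult N v ?\<omega>"
  have a0: "?a \<noteq> 0" by (auto simp: fun_eq_iff unit_fun_def)
  have f_gen: "f k = gen_op N (N + k)" if "k \<in> {1..N}" for k
    using that by (auto simp: f_def clifford_mult_unit)
  have f_swap: "f k (clifford_mult N w x) = scl (w k) x - clifford_mult N w (f k x)" if "k \<in> {1..N}" for k w x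
    unfolding f_def using clifford_mult_swap[of N "unit_fun (N + k)" w x] bil_unit(2)[OF that, of w]
    by (simp add: bil_sym)
  have f_lin: "f k (scl c x) = scl c (f k x)" "f k (x + y) = f k x + f k y" "f k (x - y) = f k x - f k y" "f k 0 = 0"
    for k c x y by (simp_all add: f_def clifford_mult_scl clifford_mult_add clifford_mult_diff)
  have f_sum: "f k ?\<omega> = (\<Sum>i=1..l. f k (ext_basis {2*i - 1, 2*i}))" for k
    unfolding f_def pair_sum_def by (rule clifford_mult_sum)
  have f_basis: "f k (ext_basis S) = (if k \<in> S then scl (sgn_at k (S - {k})) (ext_basis (S - {k})) else 0)"
    if "k \<in> {1..N}" for k S
    using that by (simp add: f_gen gen_op_contract_basis)
  have f_one: "f k ?a = 0" if "k \<in> {1..N}" for k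
    using that by (simp add: f_gen gen_op_contract_basis)
  have f_single: "f k (ext_basis {j}) = (if k = j then ?a else 0)" if "k \<in> {1..N}" for k j
    using that by (auto simp: f_gen gen_op_contract_basis sgn_at_def)
  \<comment> \<open>Each summand contains only one pair, so contracting with indices of two
    different pairs kills it.\<close>
  have f_pair: "f i (f p ?\<omega>) = 0"
    if ip: "i \<in> {1..N}" "p \<in> {1..N}" "i \<in> {2*k - 1, 2*k}" "p \<notin> {2*k - 1, 2*k}" "k \<ge> 1" for i p k
  proof -
    have "f i (f p (ext_basis {2*m - 1, 2*m})) = 0" if m: "m \<in> {1..l}" for m
    proof -
      have "\<not> (p \<in> {2*m - 1, 2*m} \<and> i \<in> {2*m - 1, 2*m})"
      proof
        assume *: "p \<in> {2*m - 1, 2*m} \<and> i \<in> {2*m - 1, 2*m}"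
        then have "m = k" using ip(3,5) m by auto
        then show False using * ip(4) by blast
      qed
      then show ?thesis using ip(1,2) by (auto simp: f_basis f_lin)
    qed
    then show ?thesis
      unfolding f_sum by (subst f_def, subst clifford_mult_sum) (simp add: f_def)
  qed
  have f_odd: "f (2*k - 1) ?\<omega> = ext_basis {2*k}" if "k \<in> {1..l}" for k
  proof -
    have "2*k - 1 \<in> {1..N}" using that l by auto
    have s: "{2*k - 1, 2*k} - {2*k - 1} = {2*k}" "{i \<in> {2*k}. i < 2*k - 1} = {}" using that by auto
    have "f (2*k - 1) ?\<omega> = (\<Sum>i=1..l. if i = k then ext_basis {2*k} else 0)"
      unfolding f_sum
    proof (rule sum.cong[OF refl])
      fix i assume i: "i \<in> {1..l}"
      show "f (2*k - 1) (ext_basis {2*i - 1, 2*i}) = (if i = k then ext_basis {2*k} else 0)"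
      proof (cases "i = k")
        case True
        have "sgn_at (2*k - 1) {2*k} = 1" unfolding sgn_at_def s(2) by simp
        then show ?thesis unfolding True f_basis[OF \<open>2*k - 1 \<in> {1..N}\<close>] s(1) by simp
      next
        case False
        then have "2*k - 1 \<notin> {2*i - 1, 2*i}" using that i by auto
        then show ?thesis unfolding f_basis[OF \<open>2*k - 1 \<in> {1..N}\<close>] using False by simp
      qed
    qed
    then show ?thesis using that by simp
  qed
  \<comment> \<open>Contractions kill the unit spinor, so a vector not annihilating it has a nonzero
    component in E.\<close>
  obtain p where p: "p \<in> {1..N}" "v p \<noteq> 0"
  proof -
    have "\<exists>p\<in>{1..N}. v p \<noteq> 0"
    proof (rule ccontr)
      assume "\<not> ?thesis"
      moreover have "gen_op N (N + k) ?a = 0" if "k \<in> {1..N}" for k using f_one f_gen that by simp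
      ultimately have "clifford_mult N v ?a = 0"
        by (intro ext, unfold clifford_mult_gen_op, subst sum_two_halves) simp
      then show False using v(2) by simp
    qed
    then show ?thesis using that by blast
  qed
  \<comment> \<open>The index \<open>p\<close> lies in at most one of the first three pairs, which
    leaves two pairs avoiding it; this is the use of \<open>l \<ge> 3\<close>.\<close>
  obtain k1 k2 where k: "k1 \<in> {1..l}" "k2 \<in> {1..l}" "p \<notin> {2*k1 - 1, 2*k1}" "p \<notin> {2*k2 - 1, 2*k2}" "k1 \<noteq> k2"
  proof -
    have *: "p \<notin> {2*k - 1, 2*k} \<or> p \<notin> {2*m - 1, 2*m}" if "k \<ge> 1" "m \<ge> 1" "k \<noteq> m" for k m using that by auto
    show ?thesis
    proof (cases "p \<in> {2*1 - 1, 2*1}")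
      case True
      then show ?thesis using l *[of 1 2] *[of 1 3] that[of 2 3] by auto
    next
      case False
      then show ?thesis using l *[of 2 3] that[of 1 2] that[of 1 3] by auto
    qed
  qed
  define j where "j = 2*k1 - 1" define j' where "j' = 2*k1"
  define m where "m = 2*k2 - 1" define m' where "m' = 2*k2"
  have idx: "j \<in> {1..N}" "j' \<in> {1..N}" "m \<in> {1..N}" "m' \<in> {1..N}"
    using k l by (auto simp: j_def j'_def m_def m'_def)
  have ne: "p \<noteq> j" "p \<noteq> j'" "p \<noteq> m" "p \<noteq> m'" "j \<noteq> m" "j \<noteq> m'" "j' \<noteq> m" "j' \<noteq> m'" "j \<noteq> j'" "m \<noteq> m'"
    using k by (auto simp: j_def j'_def m_def m'_def; presburger)+
  have fj: "f j ?\<omega> = ext_basis {j'}" and fm: "f m ?\<omega> = ext_basis {m'}"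
    using f_odd k by (auto simp: j_def j'_def m_def m'_def)
  have fp0: "f j (f p ?\<omega>) = 0" "f j' (f p ?\<omega>) = 0" "f m (f p ?\<omega>) = 0" "f m' (f p ?\<omega>) = 0"
    by (rule f_pair[OF idx(1) p(1) _ k(3)] f_pair[OF idx(2) p(1) _ k(3)]
        f_pair[OF idx(3) p(1) _ k(4)] f_pair[OF idx(4) p(1) _ k(4)];
      use k in \<open>simp add: j_def j'_def m_def m'_def\<close>)+
  have fpp: "f p (f p ?\<omega>) = 0"
    using clifford_mult_square[of N "unit_fun (N + p)" ?\<omega>] bil_unit(2)[of p N "unit_fun (N + p)"] p
    by (simp add: f_def bil_self) (simp add: unit_fun_def)
  have fY: "f i Y = scl (v i) ?\<omega> - clifford_mult N v (f i ?\<omega>)" if "i \<in> {1..N}" for i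
    unfolding Y_def using f_swap[OF that] .
  have fmpY: "f m (f p Y) = scl (v p) (ext_basis {m'}) - scl (v m) (f p ?\<omega>)"
    using idx p fm fp0 by (simp add: fY f_lin f_swap)
  have fjpY: "f j (f p Y) = scl (v p) (ext_basis {j'}) - scl (v j) (f p ?\<omega>)"
    using idx p fj fp0 by (simp add: fY f_lin f_swap)
  have fmjY: "f m (f j Y) = scl (v j) (ext_basis {m'}) - scl (v m) (ext_basis {j'})"
    using idx fj fm ne by (simp add: fY f_lin f_swap f_single)
  have 1: "f m' (f m (f p Y)) = scl (v p) ?a"
    using idx fp0 by (simp add: fmpY f_lin f_single)
  have 2: "f m' (f m (f j Y)) = scl (v j) ?a"
    using idx ne by (simp add: fmjY f_lin f_single)
  have 3: "f m (f j (f p Y)) = 0" "f m' (f j (f p Y)) = 0"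
    using idx fp0 ne by (simp_all add: fjpY f_lin f_single)
  have "Y \<noteq> 0"
  proof
    assume "Y = 0"
    then have "scl (v p) ?a = 0" using 1 by (simp add: f_lin)
    then show False using p a0 by simp
  qed
  moreover have "\<not> pure_spinor N Y"
  proof
    assume pure: "pure_spinor N Y"
    have minor: "v p * w j = v j * w p" if w: "w \<in> Ann N Y" for w
    proof -
      let ?w = "clifford_mult N w"
      \<comment> \<open>Moving the contractions past \<open>w\<close> produces one term for each
        omitted contraction and one omitting none. By \<open>3\<close> only the terms omitting
        \<open>f p\<close> or \<open>f j\<close> survive, and \<open>1\<close> and \<open>2\<close>
        evaluate them.\<close>
      have "f m' (f m (f j (f p (?w Y)))) = scl (w p * v j) ?a - scl (w j * v p) ?a"
        using idx p by (simp add: f_swap f_lin 1 2 3)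
      moreover have "?w Y = 0" using w by (rule Ann_mult)
      ultimately have "scl (w p * v j - w j * v p) ?a = 0"
        by (simp add: f_lin cfun.scale_left_diff_distrib)
      then show ?thesis using a0 by (simp add: mult.commute)
    qed
    define u where "u = scl (v p) (unit_fun (N + j)) - scl (v j) (unit_fun (N + p))"
    have "u \<in> Ann N Y"
    proof (rule pure_maximal[OF pure])
      show "u \<in> Vspace N" unfolding u_def using idx p by (intro Vspace_diff Vspace_scl Vspace_unit) auto
      fix w assume "w \<in> Ann N Y"
      then show "bil N u w = 0"
        using minor[of w] bil_unit(2)[of j N w] bil_unit(2)[of p N w] idx p
        by (simp add: u_def bil_simps bil_sym[of N _ w])
    qed
    then have "scl (v p) (f j Y) - scl (v j) (f p Y) = 0"
      by (auto dest!: Ann_mult simp: u_def clifford_mult_diff_vec clifford_mult_scl_vec f_def)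
    \<comment> \<open>These two contractions isolate the coefficient \<open>v p\<close> of
      \<open>ext_basis {j'}\<close> in \<open>f p (f j Y)\<close>; the other contributions
      vanish.\<close>
    then have "f j' (f p (scl (v p) (f j Y) - scl (v j) (f p Y))) = 0" by (simp add: f_lin)
    moreover have "f j' (f p (scl (v p) (f j Y) - scl (v j) (f p Y))) = - scl (v p * v p) ?a"
      using idx p ne by (simp add: fY fj f_lin f_swap f_single fp0 fpp cfun.scale_right_diff_distrib mult.commute)
    ultimately show False using p a0 by simp
  qed
  ultimately show ?thesis unfolding Y_def by blast
qed

lemma pair_sum_eq: "l \<le> N div 2 \<Longrightarrow> i \<in> {1..l} \<Longrightarrow>
  ext_basis {2*i - 1, 2*i} = clifford_mult N (unit_fun (2*i - 1)) (clifford_mult N (unit_fun (2*i)) (ext_basis {}))"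
proof -
  assume i: "l \<le> N div 2" "i \<in> {1..l}"
  have "{j \<in> {2*i}. j < 2*i - 1} = {}" by auto
  then have "sgn_at (2*i - 1) {2*i} = 1" unfolding sgn_at_def by (simp only:) simp
  moreover have "sgn_at (2*i) {} = 1" by (simp add: sgn_at_def)
  moreover have "2*i \<in> {1..2*N}" "2*i - 1 \<in> {1..2*N}" "2*i \<le> N" "2*i - 1 \<le> N" "2*i - 1 \<notin> {2*i}"
    using i by auto
  ultimately show ?thesis by (simp only: clifford_mult_unit gen_op_wedge_basis empty_iff not_False_eq_True scl_one)
qed

lemma pair_sum_nonzero: "l \<ge> 1 \<Longrightarrow> pair_sum l \<noteq> 0"
proof
  assume l: "l \<ge> 1" "pair_sum l = 0"
  have "pair_sum l {1, 2} = (\<Sum>i=1..l. ext_basis {2*i - 1, 2*i} {1, 2})"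
    unfolding pair_sum_def by (rule additive.sum[where f="\<lambda>h. h {1, 2}"]) (simp add: additive_def)
  also have "\<dots> = (\<Sum>i=1..l. if i = 1 then 1 else 0)"
  proof (rule sum.cong[OF refl])
    fix i assume "i \<in> {1..l}"
    moreover have "{1, 2} \<noteq> {2*i - 1, 2*i}" if "i \<ge> 2"
    proof -
      have "2*i \<notin> {1, 2}" using that by auto
      then show ?thesis by blast
    qed
    ultimately show "ext_basis {2*i - 1, 2*i} {1, 2} = (if i = 1 then 1 else 0)"
      by (cases "i = 1") (auto simp: unit_fun_def)
  qed
  finally show False using l by simp
qed

text \<open>Each summand spans with the base spinor a line in the variety, along which a polynomial
  vanishing on the cone is constant; additivity of the differential then covers the whole
  sum.\<close>

lemma Theta_tangent:
  assumes N: "even N" and l: "1 \<le> l" "l \<le> N div 2" and g: "g \<in> Spin N"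
  shows "pt (clifford_act N g (pair_sum l)) \<in>
    proj_tangent_space (ext_even N) (spinor_variety N) (pt (clifford_act N g (ext_basis {})))"
proof -
  let ?a = "clifford_act N g (ext_basis {})"
  let ?v = "\<lambda>i. clifford_act N g (ext_basis {2*i - 1, 2*i})"
  let ?x = "clifford_act N g (pair_sum l)"
  have sum: "?x = (\<Sum>i=1..l. ?v i)"
    unfolding pair_sum_def
    by (rule additive.sum[where f="clifford_act N g"]) (simp add: additive_def act_add_spinor Spin_carrier g)
  have line: "in_cone N (scl c ?a + scl t (?v i))" if i: "i \<in> {1..l}" and c: "c \<noteq> 0" for i c t
  proof -
    let ?e1 = "unit_fun (2*i) :: nat \<Rightarrow> complex" and ?e2 = "unit_fun (2*i - 1) :: nat \<Rightarrow> complex"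
    have r: "2*i \<in> {1..N}" "2*i - 1 \<in> {1..N}" using i l by auto
    have V: "?e1 \<in> Vspace N" "?e2 \<in> Vspace N" using r by (auto intro!: Vspace_unit)
    have "bil N ?e1 ?e1 = 0" "bil N ?e2 ?e2 = 0" "bil N ?e1 ?e2 = 0"
      using bil_unit(1)[OF r(1), of ?e1] bil_unit(1)[OF r(2), of ?e1] bil_unit(1)[OF r(2), of ?e2] r
      by (auto simp: unit_fun_def)
    then have iso: "quad_form N ?e1 = 0" "quad_form N ?e2 = 0" "bil N ?e1 ?e2 = 0" by (auto simp: bil_self)
    have "in_cone N (ext_basis {} + scl (t / c) (ext_basis {2*i - 1, 2*i}))"
      unfolding pair_sum_eq[OF l(2) i] by (rule in_cone_add_mult2[OF in_cone_empty[OF N] V iso])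
    from in_cone_scl[OF in_cone_Spin[OF this g] c] show ?thesis
      using c by (simp add: act_add_spinor act_scl_spinor Spin_carrier g cfun.scale_right_distrib)
  qed
  have "((\<lambda>t. F (b + scl t ?x)) has_field_derivative 0) (at 0)"
    if F: "polynomial_fun F" "\<forall>x \<in> \<Union>(spinor_variety N). F x = 0" and b: "b \<in> pt ?a - {0}" for F b
  proof -
    obtain D where D: "\<And>u v. D (u + v) = D u + D v"
      "\<And>v. ((\<lambda>t. F (b + scl t v)) has_field_derivative D v) (at 0)"
      using polynomial_fun_derivative[OF F(1)] by blast
    obtain c where c: "b = scl c ?a" "c \<noteq> 0" using b by (auto simp: pt_iff)
    have "D (?v i) = 0" if "i \<in> {1..l}" for i
    proof -
      have "F (b + scl t (?v i)) = 0" for t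
      proof -
        have "pt (b + scl t (?v i)) \<in> spinor_variety N"
          using line[OF that c(2)] c(1) in_cone_variety by blast
        then show ?thesis using F(2) pt_self by blast
      qed
      then have "((\<lambda>t. F (b + scl t (?v i))) has_field_derivative 0) (at 0)" by simp
      then show ?thesis using D(2) DERIV_unique by blast
    qed
    then have "D ?x = 0"
      unfolding sum using additive.sum[of D ?v "{1..l}"] D(1) by (simp add: additive_def)
    then show ?thesis using D(2)[of ?x] by simp
  qed
  moreover have "?x \<noteq> 0" using Spin_act_nonzero[OF g pair_sum_nonzero[OF l(1)]] .
  moreover have "?x \<in> ext_even N"
  proof (rule act_ext_even[OF Spin_even[OF g]])
    have "ext_basis {2*i - 1, 2*i} \<in> ext_even N" if "i \<in> {1..l}" for i
      using that l by (auto simp: ext_even_def unit_fun_def card_insert_if split: if_splits)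
    moreover have "\<exists>i\<in>{1..l}. ext_basis {2*i - 1, 2*i} S \<noteq> 0" if "pair_sum l S \<noteq> 0" for S
      using sum_scl_nonzero[of "\<lambda>_. 1" "\<lambda>i. ext_basis {2*i - 1, 2*i}" "{1..l}" S] that
      unfolding pair_sum_def scl_one by blast
    ultimately show "pair_sum l \<in> ext_even N" unfolding ext_even_def by blast
  qed
  ultimately show ?thesis unfolding proj_tangent_space_def projectivize_def by blast
qed

lemma Theta_tangent_unique:
  assumes N: "even N" and l: "3 \<le> l" "l \<le> N div 2" and g: "g \<in> Spin N"
    and p: "p \<in> spinor_variety N"
      "pt (clifford_act N g (pair_sum l)) \<in> proj_tangent_space (ext_even N) (spinor_variety N) p"
  shows "p = pt (clifford_act N g (ext_basis {}))"
proof (rule ccontr)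
  let ?a = "clifford_act N g (ext_basis {})" and ?x = "clifford_act N g (pair_sum l)"
  assume ne: "p \<noteq> pt ?a"
  obtain b where b: "in_cone N b" "p = pt b" using spinor_varietyE[OF p(1)] by blast
  have a: "in_cone N ?a" by (rule in_cone_Spin[OF in_cone_empty[OF N] g])
  have x0: "?x \<noteq> 0" using Spin_act_nonzero[OF g pair_sum_nonzero] l by simp
  \<comment> \<open>The pairings of \<open>w\<close> with the vectors \<open>quad_vec N S b\<close>
    are the coordinates of \<open>w b\<close>. If all these vectors lay in the isotropic
    \<open>Ann N ?a\<close>, every \<open>w\<close> in it would annihilate \<open>b\<close>, and the
    points would coincide.\<close>
  have "\<exists>S. quad_vec N S b \<notin> Ann N ?a"
  proof (rule ccontr)
    assume no: "\<not> ?thesis"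
    have "Ann N ?a \<subseteq> Ann N b"
    proof
      fix w assume w: "w \<in> Ann N ?a"
      have "clifford_mult N w b S = 0" for S
        using Ann_isotropic[OF in_cone_nonzero[OF a] w, of "quad_vec N S b"] no by (simp add: bil_quad_vec)
      then show "w \<in> Ann N b" using w by (auto simp: Ann_def fun_eq_iff)
    qed
    then show False using ne b pure_Ann_subset_pt in_cone_pure a by blast
  qed
  then obtain S where S: "clifford_mult N (quad_vec N S b) ?a \<noteq> 0"
    using quad_vec_Vspace by (auto simp: Ann_def)
  define v where "v = quad_vec N S b"
  \<comment> \<open>Pulling the vector back by \<open>g\<close> reduces the rank argument to the
    standard sum of pairs at the unit spinor.\<close>
  obtain v' where v': "v' \<in> Vspace N" "\<And>y. clifford_mult N v (clifford_act N g y) = clifford_act N g (clifford_mult N v' y)"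
    using Spin_vector_backward[OF g quad_vec_Vspace] unfolding v_def by metis
  have act0: "clifford_act N g 0 = 0" using act_scl_spinor[OF Spin_carrier[OF g], of 0 0] by simp
  have "clifford_mult N v' (ext_basis {}) \<noteq> 0" using S v'(2) act0 unfolding v_def by metis
  then have not_pure: "clifford_mult N v' (pair_sum l) \<noteq> 0" "\<not> pure_spinor N (clifford_mult N v' (pair_sum l))"
    using pair_vector_not_pure[OF l(1) _ v'(1)] l by auto
  have "clifford_mult N v ?x = - clifford_mult N (quad_vec N S ?x) b"
    unfolding v_def using tangent_quadrics[OF b(1) x0] p(2) b(2) by blast
  also have "\<dots> = clifford_mult N (scl (-1) (quad_vec N S ?x)) b"
    unfolding clifford_mult_scl_vec by simp
  finally have eq: "clifford_mult N v ?x = clifford_mult N (scl (-1) (quad_vec N S ?x)) b" .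
  moreover have "clifford_mult N v ?x \<noteq> 0"
    unfolding v'(2) by (rule Spin_act_nonzero[OF g not_pure(1)])
  ultimately have "pure_spinor N (clifford_mult N v ?x)"
    using pure_mult[OF in_cone_pure[OF b(1)] Vspace_scl[OF quad_vec_Vspace]] by metis
  then have "pure_spinor N (clifford_act N g (clifford_mult N v' (pair_sum l)))" by (simp add: v'(2))
  from pure_Spin[OF Spin_inverse[OF g] this] show False
    using not_pure by (simp add: Spin_act_inverse g)
qed

lemma Theta_orbit_tangential_identifiable:
  assumes "even N" "3 \<le> l" "l \<le> N div 2" "q \<in> Theta_orbit l N"
  shows "tangential_identifiable N q"
proof -
  obtain g where g: "g \<in> Spin N" "q = pt (clifford_act N g (pair_sum l))"
    using assms(4) unfolding Theta_orbit_def spin_orbit_def pair_sum_def by blast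
  show ?thesis
    unfolding tangential_identifiable_def
  proof (rule ex1I[of _ "pt (clifford_act N g (ext_basis {}))"])
    show "pt (clifford_act N g (ext_basis {})) \<in> spinor_variety N \<and>
      q \<in> proj_tangent_space (ext_even N) (spinor_variety N) (pt (clifford_act N g (ext_basis {})))"
      using Theta_tangent[OF assms(1) _ assms(3) g(1)] assms(2) g(2)
        in_cone_variety[OF in_cone_Spin[OF in_cone_empty[OF assms(1)] g(1)]] by simp
  qed (use Theta_tangent_unique[OF assms(1-3) g(1)] g(2) in blast)
qed

theorem mainTheorem1:
  fixes N :: nat
  assumes "even N" and "N \<ge> 6"
  shows "(\<forall>p \<in> Sigma_orbit 2 N. \<not> identifiable N p) \<and>
    (\<forall>l. 3 \<le> l \<and> l \<le> N div 2 \<longrightarrow> (\<forall>p \<in> Sigma_orbit l N. identifiable N p)) \<and>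
    (\<forall>l. 3 \<le> l \<and> l \<le> N div 2 \<longrightarrow> (\<forall>q \<in> Theta_orbit l N. tangential_identifiable N q))"
  using assms Sigma_2_not_identifiable Sigma_orbit_identifiable Theta_orbit_tangential_identifiable by blast

end
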